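(* Let $(X,\mathscr{B},\mu,T,d)$ be an exponentially mixing metric measure preserving system such that $\mu$ is Ahlfors $s$-regular with $0<s<\infty$. Let $\{\ell_n\}_{n\ge 1}$ be a sequence of positive numbers tending to $0$ whose upper Besicovitch-Taylor index $\alpha$ satisfies $\alpha<s$. For $x\in X$ let $E(x)=\{y\in X: T^nx\in B(y,\ell_n)\text{ for infinitely many } n\}$. Then for any analytic set $G\subset X$ that is regular in the sense that $\dim_{\rm H}(G)=\dim_{\rm P}(G)$, for $\mu$-almost every $x\in X$: (i) $\dim_{\rm H}(E(x)\cap G)=\dim_{\rm P}(G)+\alpha-s$ if $\dim_{\rm P}(G)>s-\alpha$; (ii) $\dim_{\rm H}(E(x)\cap G)=-\infty$ if $\dim_{\rm P}(G)<s-\alpha$.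
   Context: A metric measure preserving system $(X,\mathscr{B},\mu,T,d)$ consists of a compact metric space $(X,d)$ with Borel $\sigma$-algebra $\mathscr{B}$, a measurable map $T:X\to X$ and a $T$-invariant Borel probability measure $\mu$. $B(x,r)$ denotes the closed ball with center $x$ and radius $r$. The system is exponentially mixing if there are constants $C>0$ and $0<\rho<1$ such that $|\mu(E\mid T^{-n}F)-\mu(E)|\le C\rho^n$ for all $n\ge1$, all balls $E\subseteq X$ and all $F\in\mathscr{B}$ with $\mu(F)>0$, where $\mu(A\mid B)=\mu(A\cap B)/\mu(B)$. A Borel measure $\mu$ is Ahlfors $s$-regular if there is a constant $1\le c_1<\infty$ with $c_1^{-1}r^s\le\mu(B(x,r))\le c_1r^s$ for all $x\in X$ and $0<r\le\operatorname{diam}X$. The upper Besicovitch-Taylor index of $\{\ell_n\}$ is $\alpha=\inf\{t\le s:\sum_{n=1}^\infty\ell_n^t<\infty\}=\sup\{t\le s:\sum_{n=1}^\infty\ell_n^t=\infty\}$. $\dim_{\rm H}$ and $\dim_{\rm P}$ denote Hausdorff and packing dimension in $(X,d)$; by convention both equal $-\infty$ for the empty set.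
   Formalization: The space X is assumed to have at least two points; on a one-point space Ahlfors s-regularity holds vacuously (diam X = 0) for every s, and claim (ii) fails for nonempty G. *)

theory Defs
  imports "HOL-Probability.Probability"
begin

section \<open>Hausdorff and packing dimension\<close>

text \<open>
  The gauge \<open>(diam U)\<^sup>t\<close>, with the usual conventions that the empty set contributes \<open>0\<close> and that
  \<open>0\<^sup>0 = 1\<close> for nonempty sets. (In HOL, \<open>0 powr 0 = 0\<close>.)
\<close>
definition diam_pow :: "real \<Rightarrow> 'a::metric_space set \<Rightarrow> ennreal" where
  "diam_pow t U = (if U = {} then 0 else if t = 0 then 1 else ennreal (diameter U powr t))"

text \<open>
  Boundedness of the covering sets is stated separately because \<^const>\<open>diameter\<close> is a real number,
  which is meaningless for unbounded sets.
\<close>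
definition hausdorff_premeasure :: "real \<Rightarrow> real \<Rightarrow> 'a::metric_space set \<Rightarrow> ennreal" where
  "hausdorff_premeasure t \<delta> A =
     (INF U \<in> {U :: nat \<Rightarrow> 'a set. A \<subseteq> (\<Union>i. U i) \<and> (\<forall>i. bounded (U i) \<and> diameter (U i) \<le> \<delta>)}.
        \<Sum>i. diam_pow t (U i))"

definition hausdorff_measure :: "real \<Rightarrow> 'a::metric_space set \<Rightarrow> ennreal" where
  "hausdorff_measure t A = (SUP \<delta> \<in> {0<..}. hausdorff_premeasure t \<delta> A)"

definition hausdorff_dim :: "'a::metric_space set \<Rightarrow> ereal" where
  "hausdorff_dim A =
     (if A = {} then -\<infinity> else Inf {ereal t | t. 0 \<le> t \<and> hausdorff_measure t A = 0})"

text \<open>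
  A \<open>\<delta>\<close>-packing of \<open>A\<close> is a countable family of pairwise disjoint closed balls of radius at most
  \<open>\<delta>\<close> centred in \<open>A\<close>. It is recorded as a set of pairs (centre, radius), since in a metric space a
  ball does not determine its centre and radius.
\<close>
definition is_packing :: "real \<Rightarrow> 'a::metric_space set \<Rightarrow> ('a \<times> real) set \<Rightarrow> bool" where
  "is_packing \<delta> A P \<longleftrightarrow>
     countable P \<and>
     (\<forall>(x, r) \<in> P. x \<in> A \<and> 0 < r \<and> r \<le> \<delta>) \<and>
     pairwise (\<lambda>(x, r) (x', r'). disjnt (cball x r) (cball x' r')) P"

definition packing_premeasure :: "real \<Rightarrow> 'a::metric_space set \<Rightarrow> ennreal" where
  "packing_premeasure t A =
     (INF \<delta> \<in> {0<..}. SUP P \<in> Collect (is_packing \<delta> A).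
        \<Sum>\<^sub>\<infinity>(x, r)\<in>P. ennreal ((2 * r) powr t))"

definition packing_measure :: "real \<Rightarrow> 'a::metric_space set \<Rightarrow> ennreal" where
  "packing_measure t A =
     (INF U \<in> {U :: nat \<Rightarrow> 'a set. A \<subseteq> (\<Union>i. U i)}. \<Sum>i. packing_premeasure t (U i))"

definition packing_dim :: "'a::metric_space set \<Rightarrow> ereal" where
  "packing_dim A =
     (if A = {} then -\<infinity> else Inf {ereal t | t. 0 \<le> t \<and> packing_measure t A = 0})"


section \<open>Analytic sets\<close>

text \<open>
  The type \<open>nat \<Rightarrow> nat\<close> carries the product of the discrete topologies, i.e. it is the Baire space.
\<close>
definition analytic_set :: "'a::topological_space set \<Rightarrow> bool" where
  "analytic_set A \<longleftrightarrow>
     A = {} \<or> (\<exists>f :: (nat \<Rightarrow> nat) \<Rightarrow> 'a. continuous_on UNIV f \<and> range f = A)"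


section \<open>Metric measure preserving systems\<close>

text \<open>The compact metric space is the whole type \<open>'a\<close>.\<close>

locale metric_mps = prob_space M
  for M :: "'a::metric_space measure" +
  fixes T :: "'a \<Rightarrow> 'a"
  assumes compact_space: "compact (UNIV :: 'a set)"
    and sets_eq_borel: "sets M = sets borel"
    and measurable_map: "T \<in> M \<rightarrow>\<^sub>M M"
    and invariant: "\<And>A. A \<in> sets M \<Longrightarrow> emeasure M (T -` A) = emeasure M A"

definition exponentially_mixing :: "'a::metric_space measure \<Rightarrow> ('a \<Rightarrow> 'a) \<Rightarrow> bool" where
  "exponentially_mixing M T \<longleftrightarrow>
     (\<exists>C \<rho>. 0 < C \<and> 0 < \<rho> \<and> \<rho> < 1 \<and>
        (\<forall>n\<ge>1. \<forall>z r F. 0 < r \<longrightarrow> F \<in> sets M \<longrightarrow> 0 < measure M F \<longrightarrow>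
           \<bar>\<P>(y in M. y \<in> cball z r \<bar> y \<in> (T ^^ n) -` F) - measure M (cball z r)\<bar> \<le> C * \<rho> ^ n))"

text \<open>
  On a one-point space the diameter is \<open>0\<close> and the condition is vacuous, so every \<open>s\<close> qualifies.
\<close>
definition ahlfors_regular :: "real \<Rightarrow> 'a::metric_space measure \<Rightarrow> bool" where
  "ahlfors_regular s M \<longleftrightarrow>
     (\<exists>c\<ge>1. \<forall>x r. 0 < r \<longrightarrow> r \<le> diameter (UNIV :: 'a set) \<longrightarrow>
        inverse c * r powr s \<le> measure M (cball x r) \<and> measure M (cball x r) \<le> c * r powr s)"


section \<open>The upper Besicovitch--Taylor index\<close>

text \<open>
  Sequences are indexed from \<open>1\<close>, the value \<open>l 0\<close> is irrelevant. The supremum is taken rather than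
  the infimum of the \<open>t \<le> s\<close> with convergent series because the latter set may be empty;
  when it is not, the two agree, see \<open>upper_BT_index_eq_Inf\<close>. When it is, the index is \<open>s\<close>.
\<close>
definition upper_BT_index :: "real \<Rightarrow> (nat \<Rightarrow> real) \<Rightarrow> real" where
  "upper_BT_index s l = Sup {t. t \<le> s \<and> \<not> summable (\<lambda>n. l (Suc n) powr t)}"

lemma not_summable_powr_nonpos:
  fixes l :: "nat \<Rightarrow> real"
  assumes pos: "\<And>n. n \<ge> 1 \<Longrightarrow> 0 < l n" and lim: "l \<longlonglongrightarrow> 0" and "t \<le> 0"
  shows "\<not> summable (\<lambda>n. l (Suc n) powr t)"
proof
  assume "summable (\<lambda>n. l (Suc n) powr t)"
  then have "(\<lambda>n. l (Suc n) powr t) \<longlonglongrightarrow> 0"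
    by (rule summable_LIMSEQ_zero)
  then have 1: "\<forall>\<^sub>F n in sequentially. l (Suc n) powr t < 1"
    by (rule order_tendstoD) simp
  have "(\<lambda>n. l (Suc n)) \<longlonglongrightarrow> 0"
    using lim by (rule LIMSEQ_Suc)
  then have 2: "\<forall>\<^sub>F n in sequentially. l (Suc n) < 1"
    by (rule order_tendstoD) simp
  have "\<forall>\<^sub>F n in sequentially. False"
    using 1 2
  proof eventually_elim
    case (elim n)
    have "1 powr t \<le> l (Suc n) powr t"
      using pos[of "Suc n"] elim \<open>t \<le> 0\<close> by (intro powr_mono2') auto
    with elim show ?case by simp
  qed
  then show False by simp
qed

lemma summable_powr_mono_exponent:
  fixes l :: "nat \<Rightarrow> real"
  assumes pos: "\<And>n. n \<ge> 1 \<Longrightarrow> 0 < l n" and lim: "l \<longlonglongrightarrow> 0"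
    and summ: "summable (\<lambda>n. l (Suc n) powr t)" and "t \<le> u"
  shows "summable (\<lambda>n. l (Suc n) powr u)"
proof (rule summable_comparison_test_ev[OF _ summ])
  have "(\<lambda>n. l (Suc n)) \<longlonglongrightarrow> 0"
    using lim by (rule LIMSEQ_Suc)
  then have "\<forall>\<^sub>F n in sequentially. l (Suc n) < 1"
    by (rule order_tendstoD) simp
  then show "\<forall>\<^sub>F n in sequentially. norm (l (Suc n) powr u) \<le> l (Suc n) powr t"
  proof eventually_elim
    case (elim n)
    with pos[of "Suc n"] \<open>t \<le> u\<close> show ?case
      by (simp add: powr_mono')
  qed
qed

lemma upper_BT_index_eq_Inf:
  fixes l :: "nat \<Rightarrow> real"
  assumes pos: "\<And>n. n \<ge> 1 \<Longrightarrow> 0 < l n" and lim: "l \<longlonglongrightarrow> 0"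
    and ex: "\<exists>t\<le>s. summable (\<lambda>n. l (Suc n) powr t)"
  shows "upper_BT_index s l = Inf {t. t \<le> s \<and> summable (\<lambda>n. l (Suc n) powr t)}"
proof -
  define D where "D = {t. t \<le> s \<and> \<not> summable (\<lambda>n. l (Suc n) powr t)}"
  define C where "C = {t. t \<le> s \<and> summable (\<lambda>n. l (Suc n) powr t)}"
  have less: "d \<le> c" if "d \<in> D" "c \<in> C" for d c
    using that summable_powr_mono_exponent[OF pos lim, of c d] unfolding C_def D_def
    by (cases "d \<le> c") auto
  have C: "C \<noteq> {}"
    using ex by (auto simp: C_def)
  have "min 0 s \<in> D"
    using not_summable_powr_nonpos[OF pos lim, of "min 0 s"] by (auto simp: D_def)
  then have D: "D \<noteq> {}" by blast
  have bC: "bdd_below C" and bD: "bdd_above D"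
    using C D less by (meson bdd_belowI bdd_aboveI ex_in_conv)+
  have "Sup D \<le> Inf C"
    using less by (intro cSup_least[OF D] cInf_greatest[OF C])
  moreover have "\<not> Sup D < Inf C"
  proof
    assume "Sup D < Inf C"
    then obtain t where t: "Sup D < t" "t < Inf C"
      using dense by blast
    obtain c where "c \<in> C" using C by blast
    then have "t \<le> s"
      using t(2) cInf_lower[OF _ bC, of c] by (auto simp: C_def)
    then have "t \<in> C \<or> t \<in> D"
      by (auto simp: C_def D_def)
    with t cInf_lower[OF _ bC, of t] cSup_upper[OF _ bD, of t] show False by auto
  qed
  ultimately show ?thesis
    unfolding upper_BT_index_def C_def D_def by simp
qed


section \<open>The dynamical covering set\<close>

definition covered_set :: "('a \<Rightarrow> 'a) \<Rightarrow> (nat \<Rightarrow> real) \<Rightarrow> 'a \<Rightarrow> 'a::metric_space set" where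
  "covered_set T l x = {y. \<exists>\<^sub>\<infinity>n. (T ^^ n) x \<in> cball y (l n)}"

end

theory Submission
  imports Defs
begin

text \<open>
  The number of visits of an orbit to a ball of radius \<open>l\<^sub>n\<close> has expectation of order \<open>l\<^sub>n\<^sup>s\<close>, so
  \<open>E(x)\<close> behaves like a random covering set of codimension \<open>s - \<alpha>\<close>, and it should meet a set of
  dimension \<open>d\<close> in a set of dimension \<open>d - (s - \<alpha>)\<close>. The upper estimate is governed by the packing
  dimension of \<open>G\<close>, the lower one by its Hausdorff dimension, and regularity of \<open>G\<close> makes them agree.

  \<^bold>\<open>Upper bound.\<close> If \<open>t\<close> exceeds the packing dimension, \<open>G\<close> is a countable union of sets \<open>U\<close> each of
  which contains only \<open>O(l\<^sub>n\<^sup>-\<^sup>t)\<close> points at mutual distance more than \<open>2l\<^sub>n\<close>. By invariance of \<open>\<mu>\<close>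
  the expected number of those points that \<open>T\<^sup>nx\<close> approaches up to \<open>3l\<^sub>n\<close> is \<open>O(l\<^sub>n\<^sup>s\<^sup>-\<^sup>t)\<close>. Hence
  \<open>\<Sum>\<^sub>n l\<^sub>n\<^sup>s\<^sup>-\<^sup>t\<^sup>+\<^sup>u < \<infinity>\<close> makes the \<open>u\<close>-dimensional measure of \<open>E(x) \<inter> U\<close> vanish almost surely, and for
  \<open>u = 0\<close> it makes the intersection empty (\<open>AE_covered_set_null\<close>).

  \<^bold>\<open>Lower bound.\<close> If \<open>G\<close> has positive \<open>t\<close>-dimensional Hausdorff measure, there are closed sets
  \<open>K\<^sub>0 \<supseteq> K\<^sub>1 \<supseteq> \<dots>\<close> with intersection inside \<open>G\<close> and finitely supported probability weights on each
  \<open>K\<^sub>k\<close> which give mass at most \<open>C r\<^sup>t\<^sup>'\<close> to balls of radius \<open>r\<close>, down to any prescribed scale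
  (\<open>analytic_frostman\<close>). This is Frostman's lemma together with the approximation of analytic sets from
  inside. Both are carried out for a net content on the tree of cells of a sequence of finite
  partitions, where the increasing sets lemma (\<open>content_incseq\<close>) and the flow that produces the measure
  (\<open>frostman_flow\<close>) are elementary.

  Since \<open>\<Sum>\<^sub>n l\<^sub>n\<^sup>a\<close> diverges for \<open>a < \<alpha>\<close>, there are arbitrarily small \<open>r\<close> with about \<open>r\<^sup>-\<^sup>a\<close> times
  \<open>n\<close> such that \<open>l\<^sub>n \<ge> r\<close>; by the pigeonhole principle these times may be taken so far apart that mixing
  makes the visits to balls of radius \<open>r\<close> nearly independent (\<open>spaced_block_exists\<close>). For such a block
  of times let \<open>f(x, y)\<close> be the number of visits of \<open>x\<close> to \<open>B(y, r)\<close>, normalised to have expectation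
  about \<open>1\<close>. Then \<open>f(\<cdot>, y)\<close> and \<open>f(\<cdot>, z)\<close> are almost uncorrelated, except that for \<open>d(y, z) \<le> 2r\<close>
  their correlation may reach a multiple of \<open>r\<^sup>a\<^sup>-\<^sup>s\<close> (\<open>block_second_moment\<close>). Multiplying a Frostman
  measure by such densities along a rapidly decreasing sequence of scales changes neither its total
  mass nor its \<open>u\<close>-energy by much, in mean square and in mean respectively, as long as
  \<open>u + s - a < t\<close> (\<open>expectation_double_sum_le\<close>). So with probability near \<open>1\<close> there are, for infinitely
  many \<open>k\<close>, measures of mass at least \<open>1/2\<close> and bounded energy that live on \<open>K\<^sub>k\<close> and on the balls
  hit during the first \<open>k\<close> blocks. Those sets are compact and decrease to a subset of
  \<open>E(x) \<inter> G\<close>, which therefore has positive \<open>u\<close>-dimensional measure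
  (\<open>hausdorff_measure_pos_of_energy\<close>, \<open>covered_intersection_large_event\<close>).
\<close>

section \<open>Null sets of Hausdorff measures\<close>

text \<open>
  Covers arise below with index sets such as pairs or finite sequences; the empty set costs nothing,
  so they can be padded to sequences.
\<close>
lemma hausdorff_premeasure_le_nn_integral:
  fixes U :: "'i \<Rightarrow> 'a::metric_space set"
  assumes I: "countable I" and cov: "A \<subseteq> (\<Union>i\<in>I. U i)" and "0 \<le> \<delta>"
    and small: "\<And>i. i \<in> I \<Longrightarrow> bounded (U i) \<and> diameter (U i) \<le> \<delta>"
  shows "hausdorff_premeasure t \<delta> A \<le> (\<integral>\<^sup>+i. diam_pow t (U i) \<partial>count_space I)"
proof -
  define V where "V n = (if n \<in> to_nat_on I ` I then U (from_nat_into I n) else {})" for n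
  have inj: "bij_betw (to_nat_on I) I (to_nat_on I ` I)"
    using inj_on_to_nat_on[OF I] by (rule inj_on_imp_bij_betw)
  have V: "V (to_nat_on I i) = U i" if "i \<in> I" for i
    using that I by (simp add: V_def)
  have "A \<subseteq> (\<Union>n. V n)"
    using cov V by fastforce
  moreover have "bounded (V n) \<and> diameter (V n) \<le> \<delta>" for n
  proof (cases "n \<in> to_nat_on I ` I")
    case True
    then show ?thesis using small V by auto
  next
    case False
    then show ?thesis using \<open>0 \<le> \<delta>\<close> by (simp add: V_def)
  qed
  ultimately have "hausdorff_premeasure t \<delta> A \<le> (\<Sum>n. diam_pow t (V n))"
    unfolding hausdorff_premeasure_def by (intro INF_lower) auto
  also have "\<dots> = (\<integral>\<^sup>+n. diam_pow t (V n) \<partial>count_space UNIV)"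
    by (simp add: nn_integral_count_space_nat)
  also have "\<dots> = (\<integral>\<^sup>+n. diam_pow t (V n) \<partial>count_space (to_nat_on I ` I))"
    by (intro nn_integral_count_space_eq) (auto simp: V_def diam_pow_def)
  also have "\<dots> = (\<integral>\<^sup>+i. diam_pow t (V (to_nat_on I i)) \<partial>count_space I)"
    using nn_integral_bij_count_space[OF inj, of "\<lambda>n. diam_pow t (V n)"] by simp
  also have "\<dots> = (\<integral>\<^sup>+i. diam_pow t (U i) \<partial>count_space I)"
    by (intro nn_integral_cong) (simp add: V)
  finally show ?thesis .
qed

lemma hausdorff_null_iff:
  "hausdorff_measure t A = 0 \<longleftrightarrow> (\<forall>\<delta>>0. hausdorff_premeasure t \<delta> A = 0)"
proof -
  have "hausdorff_measure t A = 0 \<longleftrightarrow> (\<forall>\<delta>>0. hausdorff_premeasure t \<delta> A \<le> 0)"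
    unfolding hausdorff_measure_def by (subst le_zero_eq[symmetric], subst SUP_le_iff) auto
  then show ?thesis by simp
qed

lemma hausdorff_nullI:
  assumes "\<And>\<delta> e::real. 0 < \<delta> \<Longrightarrow> 0 < e \<Longrightarrow> hausdorff_premeasure t \<delta> A \<le> ennreal e"
  shows "hausdorff_measure t A = 0"
  unfolding hausdorff_null_iff
proof (intro allI impI)
  fix \<delta> :: real assume "0 < \<delta>"
  have "hausdorff_premeasure t \<delta> A \<le> 0"
  proof (rule ennreal_le_epsilon)
    fix e :: real assume "0 < e"
    with assms[OF \<open>0 < \<delta>\<close>] show "hausdorff_premeasure t \<delta> A \<le> 0 + ennreal e" by simp
  qed
  then show "hausdorff_premeasure t \<delta> A = 0" by simp
qed

lemma hausdorff_null_coverE: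
  assumes "hausdorff_measure t A = 0" "0 < \<delta>" "0 < e"
  obtains U :: "nat \<Rightarrow> 'a::metric_space set"
    where "A \<subseteq> (\<Union>i. U i)" "\<And>i. bounded (U i)" "\<And>i. diameter (U i) \<le> \<delta>"
      "(\<Sum>i. diam_pow t (U i)) < ennreal e"
proof -
  have "hausdorff_premeasure t \<delta> A < ennreal e"
    using assms by (auto simp: hausdorff_null_iff)
  then show ?thesis
    unfolding hausdorff_premeasure_def INF_less_iff using that by blast
qed

lemma hausdorff_null_subset:
  assumes "hausdorff_measure t B = 0" "A \<subseteq> B"
  shows "hausdorff_measure t A = 0"
proof -
  have "hausdorff_premeasure t \<delta> A \<le> hausdorff_premeasure t \<delta> B" for \<delta>
    unfolding hausdorff_premeasure_def using \<open>A \<subseteq> B\<close> by (intro INF_superset_mono) auto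
  with assms(1) show ?thesis
    by (metis hausdorff_null_iff le_zero_eq)
qed

lemma hausdorff_null_UN:
  fixes A :: "nat \<Rightarrow> 'a::metric_space set"
  assumes "\<And>i. hausdorff_measure t (A i) = 0"
  shows "hausdorff_measure t (\<Union>i. A i) = 0"
proof (rule hausdorff_nullI)
  fix \<delta> e :: real assume pos: "0 < \<delta>" "0 < e"
  have "\<exists>U. A i \<subseteq> (\<Union>j. U j) \<and> (\<forall>j. bounded (U j) \<and> diameter (U j) \<le> \<delta>) \<and>
      (\<Sum>j. diam_pow t (U j)) \<le> ennreal (e * (1/2)^Suc i)" for i
    using hausdorff_null_coverE[OF assms[of i] pos(1), of "e * (1/2)^Suc i"] pos
    by (metis less_imp_le mult_pos_pos zero_less_power half_gt_zero zero_less_one)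
  then obtain U where U: "\<And>i. A i \<subseteq> (\<Union>j. U i j)"
      "\<And>i j. bounded (U i j) \<and> diameter (U i j) \<le> \<delta>"
      "\<And>i. (\<Sum>j. diam_pow t (U i j)) \<le> ennreal (e * (1/2)^Suc i)"
    by metis
  have "hausdorff_premeasure t \<delta> (\<Union>i. A i)
      \<le> (\<integral>\<^sup>+p. diam_pow t (case p of (i, j) \<Rightarrow> U i j) \<partial>count_space UNIV)"
  proof (rule hausdorff_premeasure_le_nn_integral)
    show "(\<Union>i. A i) \<subseteq> (\<Union>p\<in>UNIV. case p of (i, j) \<Rightarrow> U i j)"
      using U(1) by fastforce
  qed (use U(2) pos in auto)
  also have "\<dots> = (\<integral>\<^sup>+i. \<integral>\<^sup>+j. diam_pow t (U i j) \<partial>count_space UNIV \<partial>count_space UNIV)"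
    by (subst nn_integral_fst_count_space[symmetric]) simp
  also have "\<dots> = (\<Sum>i. \<Sum>j. diam_pow t (U i j))"
    by (simp add: nn_integral_count_space_nat)
  also have "\<dots> \<le> (\<Sum>i. ennreal (e * (1/2)^Suc i))"
    using U(3) by (intro suminf_le) auto
  also have "\<dots> = ennreal e"
    using sums_mult[OF power_half_series, of e] pos
    by (subst suminf_ennreal2) (auto simp: sums_iff)
  finally show "hausdorff_premeasure t \<delta> (\<Union>i. A i) \<le> ennreal e" .
qed

lemma diam_pow_antimono:
  assumes "0 \<le> t" "t \<le> u" "diameter U \<le> 1" "bounded U"
  shows "diam_pow u U \<le> diam_pow t U"
proof (cases "t = 0")
  case True
  have "diameter U powr u \<le> 1"
    using assms diameter_ge_0[OF assms(4)] by (intro powr_le1) auto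
  with True show ?thesis by (simp add: diam_pow_def)
next
  case False
  have "diameter U powr u \<le> diameter U powr t"
    using assms diameter_ge_0[OF assms(4)] by (intro powr_mono') auto
  with False assms(1,2) show ?thesis by (simp add: diam_pow_def ennreal_leI)
qed

lemma hausdorff_null_mono_exponent:
  assumes null: "hausdorff_measure t A = 0" and "0 \<le> t" "t \<le> u"
  shows "hausdorff_measure u A = 0"
proof (rule hausdorff_nullI)
  fix \<delta> e :: real assume "0 < \<delta>" "0 < e"
  obtain U where U: "A \<subseteq> (\<Union>i. U i)" "\<And>i. bounded (U i)" "\<And>i. diameter (U i) \<le> min \<delta> 1"
      "(\<Sum>i. diam_pow t (U i)) < ennreal e"
    using hausdorff_null_coverE[OF null, of "min \<delta> 1" e] \<open>0 < \<delta>\<close> \<open>0 < e\<close> by auto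
  have "hausdorff_premeasure u \<delta> A \<le> (\<Sum>i. diam_pow u (U i))"
    unfolding hausdorff_premeasure_def using U by (intro INF_lower) auto
  also have "\<dots> \<le> (\<Sum>i. diam_pow t (U i))"
    using U assms(2,3) by (intro suminf_le diam_pow_antimono) auto
  finally show "hausdorff_premeasure u \<delta> A \<le> ennreal e"
    using U(4) by (meson less_imp_le order_trans)
qed

lemma hausdorff_dim_le:
  assumes "hausdorff_measure u A = 0" "0 \<le> u"
  shows "hausdorff_dim A \<le> ereal u"
  unfolding hausdorff_dim_def using assms by (auto intro!: Inf_lower)

text \<open>
  The exponents of vanishing measure form an up-set (\<open>hausdorff_null_mono_exponent\<close>), so none of them
  lies below \<open>u\<close>; and the set is nonempty, since the empty set is null for every exponent.
\<close>
lemma hausdorff_dim_ge: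
  assumes "hausdorff_measure u A \<noteq> 0" "0 \<le> u"
  shows "ereal u \<le> hausdorff_dim A"
proof -
  have "A \<noteq> {}"
  proof
    assume "A = {}"
    have "hausdorff_premeasure u \<delta> A \<le> ennreal e" if "0 < \<delta>" for \<delta> e
      using hausdorff_premeasure_le_nn_integral[of "{}" A "\<lambda>_. {}" \<delta> u] that \<open>A = {}\<close> by simp
    then have "hausdorff_measure u A = 0"
      by (intro hausdorff_nullI) auto
    with assms show False by simp
  qed
  moreover have *: "u \<le> t" if "0 \<le> t" "hausdorff_measure t A = 0" for t
    using that hausdorff_null_mono_exponent[of t A u] assms by (cases "u \<le> t") auto
  have "ereal u \<le> Inf {ereal t | t. 0 \<le> t \<and> hausdorff_measure t A = 0}"
    by (intro Inf_greatest) (use * in auto)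
  ultimately show ?thesis
    unfolding hausdorff_dim_def by simp
qed

lemma hausdorff_measure_nonzero_below_dim:
  assumes "ereal t < hausdorff_dim A" "0 \<le> t"
  shows "hausdorff_measure t A \<noteq> 0"
proof
  assume "hausdorff_measure t A = 0"
  from hausdorff_dim_le[OF this assms(2)] assms(1) show False by simp
qed

lemma packing_dim_lessE:
  assumes "packing_dim A < ereal t" "A \<noteq> {}"
  obtains u where "0 \<le> u" "u < t" "packing_measure u A = 0"
proof -
  have "packing_dim A = Inf {ereal t | t. 0 \<le> t \<and> packing_measure t A = 0}"
    unfolding packing_dim_def using assms(2) by (rule if_not_P)
  with assms(1) have "\<exists>x\<in>{ereal t | t. 0 \<le> t \<and> packing_measure t A = 0}. x < ereal t"
    by (simp only: Inf_less_iff)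
  then obtain u where "0 \<le> u" "packing_measure u A = 0" "ereal u < ereal t"
    by blast
  then show ?thesis
    using that[of u] by simp
qed

section \<open>Separated sets in an Ahlfors regular system\<close>

lemma diameter_leI:
  fixes S :: "'a::metric_space set"
  assumes "0 \<le> d" "\<And>x y. x \<in> S \<Longrightarrow> y \<in> S \<Longrightarrow> dist x y \<le> d"
  shows "diameter S \<le> d"
  using assms by (auto simp: diameter_def intro!: cSUP_least)

definition separated :: "real \<Rightarrow> 'a::metric_space set \<Rightarrow> bool" where
  "separated \<delta> Z \<longleftrightarrow> (\<forall>x\<in>Z. \<forall>y\<in>Z. x \<noteq> y \<longrightarrow> \<delta> < dist x y)"

text \<open>
  Ahlfors regularity with the bounds extended past the diameter: the upper one to all radii, the
  lower one to all radii up to \<open>1\<close>. This removes case distinctions at the scale of the whole space.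
\<close>
locale regular_mps = metric_mps M T
  for M :: "'a::metric_space measure" and T :: "'a \<Rightarrow> 'a" +
  fixes s c :: real
  assumes s_pos: "0 < s" and c_ge_1: "1 \<le> c"
    and ball_upper: "\<And>x r. 0 < r \<Longrightarrow> measure M (cball x r) \<le> c * r powr s"
    and ball_lower: "\<And>x r. 0 < r \<Longrightarrow> r \<le> 1 \<Longrightarrow> r powr s / c \<le> measure M (cball x r)"
begin

lemma space_M [simp]: "space M = UNIV"
  using sets_eq_imp_space_eq[OF sets_eq_borel] by simp

lemma sets_cball [measurable, simp]: "cball x r \<in> sets M"
  by (simp add: sets_eq_borel)

lemma T_pow_measurable [measurable]: "T ^^ n \<in> M \<rightarrow>\<^sub>M M"
proof (induction n)
  case (Suc n)
  show ?case
    using measurable_comp[OF Suc measurable_map] by (simp add: comp_def)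
qed (simp add: id_def)

lemma T_pow_emeasure:
  assumes "A \<in> sets M"
  shows "emeasure M ((T ^^ n) -` A) = emeasure M A"
proof (induction n)
  case (Suc n)
  have "(T ^^ n) -` A \<in> sets M"
    using measurable_sets[OF T_pow_measurable assms, of n] by simp
  then have "emeasure M (T -` ((T ^^ n) -` A)) = emeasure M ((T ^^ n) -` A)"
    by (rule invariant)
  moreover have "T -` ((T ^^ n) -` A) = (T ^^ Suc n) -` A"
    by (simp add: funpow_swap1 vimage_def)
  ultimately show ?case using Suc by (simp only:)
qed simp

text \<open>
  Volume comparison: balls of radius \<open>\<delta>/2\<close> around the points are disjoint and lie in a ball of
  radius \<open>R + \<delta>\<close>.
\<close>
lemma card_separated_le:
  fixes Z :: "'a set"
  assumes "separated \<delta> Z" "Z \<subseteq> cball y R" "0 < \<delta>" "\<delta> \<le> 1" "0 < R"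
  shows "finite Z \<and> real (card Z) \<le> c\<^sup>2 * (2 * (R + \<delta>) / \<delta>) powr s"
proof -
  let ?K = "c\<^sup>2 * (2 * (R + \<delta>) / \<delta>) powr s"
  have fin: "real (card W) \<le> ?K" if W: "finite W" "W \<subseteq> Z" for W
  proof -
    have disj: "disjoint_family_on (\<lambda>z. cball z (\<delta>/2)) W"
      unfolding disjoint_family_on_def
    proof (intro ballI impI)
      fix a b assume "a \<in> W" "b \<in> W" "a \<noteq> b"
      then have "\<delta> < dist a b" using assms(1) W(2) by (auto simp: separated_def)
      then show "cball a (\<delta>/2) \<inter> cball b (\<delta>/2) = {}"
        by (intro disjoint_cballI) simp
    qed
    have "real (card W) * ((\<delta>/2) powr s / c) = (\<Sum>z\<in>W. (\<delta>/2) powr s / c)" by simp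
    also have "\<dots> \<le> (\<Sum>z\<in>W. measure M (cball z (\<delta>/2)))"
      using assms by (intro sum_mono ball_lower) auto
    also have "\<dots> = measure M (\<Union>z\<in>W. cball z (\<delta>/2))"
      using disj W by (intro finite_measure_finite_Union[symmetric]) auto
    also have "\<dots> \<le> measure M (cball y (R + \<delta>))"
    proof (intro finite_measure_mono subsetI)
      fix p assume "p \<in> (\<Union>z\<in>W. cball z (\<delta>/2))"
      then obtain z where "z \<in> W" "dist z p \<le> \<delta>/2" by auto
      moreover from this have "dist y z \<le> R" using assms(2) W(2) by auto
      ultimately show "p \<in> cball y (R + \<delta>)"
        using dist_triangle[of y p z] \<open>0 < \<delta>\<close> by auto
    qed simp
    also have "\<dots> \<le> c * (R + \<delta>) powr s"
      using assms by (intro ball_upper) auto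
    finally have "real (card W) * ((\<delta>/2) powr s / c) \<le> c * (R + \<delta>) powr s" .
    then have "real (card W) \<le> c * c * ((R + \<delta>) powr s / (\<delta>/2) powr s)"
      using c_ge_1 assms by (simp add: field_simps)
    also have "(R + \<delta>) powr s / (\<delta>/2) powr s = (2 * (R + \<delta>) / \<delta>) powr s"
      using assms by (subst powr_divide[symmetric]) (auto simp: field_simps)
    finally show ?thesis by (simp add: power2_eq_square)
  qed
  have "finite Z"
  proof (rule conjunct1[OF finite_if_finite_subsets_card_bdd[of Z "nat \<lfloor>?K\<rfloor>"]])
    show "card W \<le> nat \<lfloor>?K\<rfloor>" if "W \<subseteq> Z" "finite W" for W
      using fin[OF that(2,1)] by (simp add: le_nat_floor)
  qed
  then show ?thesis using fin by auto
qed

text \<open>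
  Cardinalities of separated sets are bounded by compactness, so one of largest cardinality exists,
  and it cannot be extended.
\<close>
lemma maximal_separated_subset:
  fixes A :: "'a set"
  assumes "0 < \<delta>" "\<delta> \<le> 1"
  obtains Z where "finite Z" "Z \<subseteq> A" "separated \<delta> Z" "A \<subseteq> (\<Union>z\<in>Z. cball z \<delta>)"
proof -
  obtain y :: 'a and R where R: "UNIV \<subseteq> cball y R"
    using compact_imp_bounded[OF compact_space] by (auto simp: bounded_subset_cball)
  have R': "UNIV \<subseteq> cball y (max R 1)" using R by auto
  define P where "P Z \<longleftrightarrow> Z \<subseteq> A \<and> separated \<delta> Z" for Z
  define K where "K = nat \<lfloor>c\<^sup>2 * (2 * (max R 1 + \<delta>) / \<delta>) powr s\<rfloor>"
  have bd: "finite Z \<and> card Z \<le> K" if "P Z" for Z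
  proof -
    have "Z \<subseteq> cball y (max R 1)" using R' by blast
    then have "finite Z \<and> real (card Z) \<le> c\<^sup>2 * (2 * (max R 1 + \<delta>) / \<delta>) powr s"
      using that assms by (intro card_separated_le) (auto simp: P_def)
    then show ?thesis unfolding K_def using le_nat_floor by blast
  qed
  have "P {}" by (simp add: P_def separated_def)
  then obtain Z where Z: "P Z" "\<And>W. P W \<Longrightarrow> card W \<le> card Z"
    using ex_has_greatest_nat[of P "{}" card "Suc K"] bd by (metis less_Suc_eq_le)
  have "A \<subseteq> (\<Union>z\<in>Z. cball z \<delta>)"
  proof (rule ccontr)
    assume "\<not> A \<subseteq> (\<Union>z\<in>Z. cball z \<delta>)"
    then obtain a where a: "a \<in> A" "a \<notin> (\<Union>z\<in>Z. cball z \<delta>)" by blast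
    then have a: "a \<in> A" "\<And>z. z \<in> Z \<Longrightarrow> \<delta> < dist z a"
      by (simp_all add: not_le)
    then have "a \<notin> Z" using assms by force
    moreover have "P (insert a Z)"
      using a Z(1) by (auto simp: P_def separated_def dist_commute)
    ultimately show False
      using Z(2)[of "insert a Z"] bd[OF Z(1)] by simp
  qed
  with Z(1) bd[OF Z(1)] that show ?thesis by (auto simp: P_def)
qed

text \<open>
  A separated set of centres with equal radii is a packing, so a finite packing premeasure bounds the
  box-counting numbers of the set.
\<close>
lemma packing_bound:
  assumes fin: "packing_premeasure t U < \<infinity>"
  obtains \<delta> K where "0 < \<delta>" "0 \<le> K"
    "\<And>r Z. 0 < r \<Longrightarrow> r \<le> \<delta> \<Longrightarrow> finite Z \<Longrightarrow> Z \<subseteq> U \<Longrightarrow> separated (2 * r) Z \<Longrightarrow>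
        real (card Z) * r powr t \<le> K"
proof -
  obtain \<delta> where "0 < \<delta>"
    and less: "(SUP P \<in> Collect (is_packing \<delta> U). \<Sum>\<^sub>\<infinity>(x, r)\<in>P. ennreal ((2 * r) powr t)) < \<infinity>"
      (is "?S < _")
    using fin unfolding packing_premeasure_def INF_less_iff by auto
  define K where "K = enn2real ?S"
  have K: "?S = ennreal K" using less by (simp add: K_def less_top)
  have "real (card Z) * r powr t \<le> K / 2 powr t"
    if r: "0 < r" "r \<le> \<delta>" and Z: "finite Z" "Z \<subseteq> U" "separated (2 * r) Z" for r Z
  proof -
    define P where "P = (\<lambda>z. (z, r)) ` Z"
    have "finite P" using Z by (simp add: P_def)
    have "is_packing \<delta> U P"
      unfolding is_packing_def
    proof (intro conjI)
      show "countable P" using \<open>finite P\<close> by (rule countable_finite)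
      show "\<forall>(x, r')\<in>P. x \<in> U \<and> 0 < r' \<and> r' \<le> \<delta>" using r Z by (auto simp: P_def)
      show "pairwise (\<lambda>(x, r) (x', r'). disjnt (cball x r) (cball x' r')) P"
      proof (rule pairwiseI)
        fix p q assume "p \<in> P" "q \<in> P" "p \<noteq> q"
        then obtain a b where "p = (a, r)" "q = (b, r)" "a \<in> Z" "b \<in> Z" "a \<noteq> b"
          by (auto simp: P_def)
        moreover from this have "2 * r < dist a b" using Z(3) by (auto simp: separated_def)
        ultimately show "(case p of (x, r) \<Rightarrow> \<lambda>(x', r'). disjnt (cball x r) (cball x' r')) q"
          by (simp add: disjnt_def disjoint_cballI)
      qed
    qed
    then have "(\<Sum>\<^sub>\<infinity>(x, r)\<in>P. ennreal ((2 * r) powr t)) \<le> ?S"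
      by (intro SUP_upper) simp
    also have "(\<Sum>\<^sub>\<infinity>(x, r)\<in>P. ennreal ((2 * r) powr t)) = (\<Sum>(x, r)\<in>P. ennreal ((2 * r) powr t))"
      using \<open>finite P\<close> by simp
    also have "\<dots> = (\<Sum>z\<in>Z. ennreal ((2 * r) powr t))"
      unfolding P_def by (subst sum.reindex) (auto simp: inj_on_def)
    also have "\<dots> = ennreal (real (card Z) * (2 * r) powr t)"
      by (simp add: ennreal_mult ennreal_of_nat_eq_real_of_nat)
    finally have "ennreal (real (card Z) * (2 * r) powr t) \<le> ennreal K" by (simp only: K)
    then have "real (card Z) * (2 * r) powr t \<le> K"
      by (subst (asm) ennreal_le_iff) (simp_all add: K_def)
    then show ?thesis using r by (simp add: powr_mult field_simps)
  qed
  moreover have "0 \<le> K / 2 powr t" by (simp add: K_def)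
  ultimately show ?thesis using that[of \<delta> "K / 2 powr t"] \<open>0 < \<delta>\<close> by blast
qed

end

section \<open>The upper bound\<close>

context regular_mps
begin

text \<open>
  First moment argument. Points of \<open>U\<close> within \<open>l\<^sub>n\<close> of \<open>T\<^sup>nx\<close> are covered by the balls of radius
  \<open>2l\<^sub>n\<close> around those net points \<open>z\<close> with \<open>d(z, T\<^sup>nx) \<le> 3l\<^sub>n\<close>. The expected total of the \<open>u\<close>-th powers
  of their radii is a convergent series, so almost surely the tails of the series tend to \<open>0\<close>; for
  \<open>u = 0\<close> the terms are integers and hence eventually vanish.
\<close>
lemma AE_covered_set_null:
  fixes U :: "'a set"
  assumes fin: "packing_premeasure t U < \<infinity>"
    and pos: "\<And>n. n \<ge> 1 \<Longrightarrow> 0 < l n" and lim: "l \<longlonglongrightarrow> 0"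
    and summ: "summable (\<lambda>n. l (Suc n) powr (s - t + u))" and u: "0 \<le> u"
  shows "AE x in M. (u = 0 \<longrightarrow> covered_set T l x \<inter> U = {}) \<and>
                    (0 < u \<longrightarrow> hausdorff_measure u (covered_set T l x \<inter> U) = 0)"
proof -
  obtain \<delta> K where \<delta>: "0 < \<delta>" and K: "0 \<le> K" and pack:
    "\<And>r Z. 0 < r \<Longrightarrow> r \<le> \<delta> \<Longrightarrow> finite Z \<Longrightarrow> Z \<subseteq> U \<Longrightarrow> separated (2 * r) Z \<Longrightarrow>
        real (card Z) * r powr t \<le> K"
    using packing_bound[OF fin] by blast
  \<comment> \<open>\<open>\<delta>\<close> is the range of the packing bound, and \<open>2 l\<^sub>n \<le> 1\<close> is required for separated nets.\<close>
  have "\<forall>\<^sub>F n in sequentially. l n < min \<delta> (1/2)"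
    using \<delta> by (intro order_tendstoD(2)[OF lim]) auto
  then obtain N where N: "\<And>n. n \<ge> N \<Longrightarrow> l n < min \<delta> (1/2)"
    unfolding eventually_sequentially by blast
  define n0 where "n0 = max N 1"
  define L where "L n = l (n + n0)" for n
  have L_pos: "0 < L n" for n using pos[of "n + n0"] by (simp add: L_def n0_def)
  have L_le: "L n \<le> \<delta>" "2 * L n \<le> 1" for n
  proof -
    have "l (n + n0) < min \<delta> (1/2)" by (rule N) (simp add: n0_def)
    then show "L n \<le> \<delta>" "2 * L n \<le> 1" by (simp_all add: L_def)
  qed
  have L_lim: "L \<longlonglongrightarrow> 0" unfolding L_def using lim by (rule LIMSEQ_ignore_initial_segment)
  have L_summ: "summable (\<lambda>n. L n powr (s - t + u))"
  proof -
    have "Suc (n + (n0 - 1)) = n + n0" for n by (simp add: n0_def)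
    then show ?thesis
      using summable_ignore_initial_segment[OF summ, of "n0 - 1"] by (simp only: L_def)
  qed
  have "\<exists>Z. finite Z \<and> Z \<subseteq> U \<and> separated (2 * L n) Z \<and> U \<subseteq> (\<Union>z\<in>Z. cball z (2 * L n))" for n
  proof -
    obtain Z where "finite Z" "Z \<subseteq> U" "separated (2 * L n) Z" "U \<subseteq> (\<Union>z\<in>Z. cball z (2 * L n))"
    proof (rule maximal_separated_subset)
      show "0 < 2 * L n" "2 * L n \<le> 1" using L_pos[of n] L_le[of n] by simp_all
    qed
    then show ?thesis by blast
  qed
  then obtain Z where Z: "\<And>n. finite (Z n)" "\<And>n. Z n \<subseteq> U" "\<And>n. separated (2 * L n) (Z n)"
      "\<And>n. U \<subseteq> (\<Union>z\<in>Z n. cball z (2 * L n))"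
    by metis
  define H where "H n x = {z \<in> Z n. (T ^^ (n + n0)) x \<in> cball z (3 * L n)}" for n x
  have H_fin: "finite (H n x)" for n x using Z(1) by (simp add: H_def)
  define a where "a n x = real (card (H n x)) * L n powr u" for n x
  define C where "C = c * 3 powr s * K"
  have a_sum: "ennreal (a n x) =
      (\<Sum>z\<in>Z n. ennreal (L n powr u) * indicator ((T ^^ (n + n0)) -` cball z (3 * L n)) x)" for n x
  proof -
    have "real (card (H n x)) = (\<Sum>z\<in>Z n. indicator ((T ^^ (n + n0)) -` cball z (3 * L n)) x)"
      using Z(1)[of n] by (simp add: H_def indicator_def sum.If_cases Int_def)
    then have "a n x = (\<Sum>z\<in>Z n. L n powr u * indicator ((T ^^ (n + n0)) -` cball z (3 * L n)) x)"
      by (simp add: a_def sum_distrib_left mult.commute)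
    then show ?thesis
      by (simp add: sum_ennreal[symmetric] ennreal_mult ennreal_indicator)
  qed
  have pre_sets: "(T ^^ n) -` cball z r \<in> sets M" for n z r
    using measurable_sets[OF T_pow_measurable, of "cball z r" n] by simp
  have a_meas[measurable]: "(\<lambda>x. ennreal (a n x)) \<in> borel_measurable M" for n
    unfolding a_sum using pre_sets by measurable
  have a_int: "(\<integral>\<^sup>+x. ennreal (a n x) \<partial>M) \<le> ennreal (C * L n powr (s - t + u))" for n
  proof -
    have "(\<integral>\<^sup>+x. ennreal (a n x) \<partial>M)
        = (\<Sum>z\<in>Z n. ennreal (L n powr u) * emeasure M ((T ^^ (n + n0)) -` cball z (3 * L n)))"
      unfolding a_sum using pre_sets by (subst nn_integral_sum) (auto simp: nn_integral_cmult_indicator)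
    also have "\<dots> = (\<Sum>z\<in>Z n. ennreal (L n powr u * measure M (cball z (3 * L n))))"
      unfolding T_pow_emeasure[OF sets_cball] by (simp add: emeasure_eq_measure ennreal_mult)
    also have "\<dots> \<le> (\<Sum>z\<in>Z n. ennreal (L n powr u * (c * (3 * L n) powr s)))"
      using L_pos[of n] by (intro sum_mono ennreal_leI mult_left_mono ball_upper) auto
    also have "\<dots> = ennreal (real (card (Z n)) * (L n powr u * (c * (3 * L n) powr s)))"
      using c_ge_1 by (simp add: ennreal_mult ennreal_of_nat_eq_real_of_nat)
    also have "real (card (Z n)) * (L n powr u * (c * (3 * L n) powr s))
        = (real (card (Z n)) * L n powr t) * (c * 3 powr s * L n powr (s - t + u))"
      using L_pos[of n] by (simp add: powr_mult powr_add powr_diff)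
    also have "ennreal \<dots> \<le> ennreal (K * (c * 3 powr s * L n powr (s - t + u)))"
      using pack[OF L_pos L_le(1) Z(1-3)] c_ge_1 by (intro ennreal_leI mult_right_mono) auto
    finally show ?thesis by (simp add: C_def mult_ac)
  qed
  have C: "0 \<le> C" using K c_ge_1 by (simp add: C_def)
  have "(\<integral>\<^sup>+x. (\<Sum>n. ennreal (a n x)) \<partial>M) = (\<Sum>n. \<integral>\<^sup>+x. ennreal (a n x) \<partial>M)"
    by (rule nn_integral_suminf) simp
  also have "\<dots> \<le> (\<Sum>n. ennreal (C * L n powr (s - t + u)))"
    using a_int by (intro suminf_le) auto
  also have "\<dots> < \<infinity>"
    using summable_mult[OF L_summ, of C] C by (simp add: suminf_ennreal2)
  finally have "AE x in M. (\<Sum>n. ennreal (a n x)) \<noteq> \<infinity>"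
    by (intro nn_integral_PInf_AE) auto
  then show ?thesis
  proof (eventually_elim, intro conjI impI)
    fix x assume "(\<Sum>n. ennreal (a n x)) \<noteq> \<infinity>"
    then have sa: "summable (\<lambda>n. a n x)"
      by (intro summable_suminf_not_top) (auto simp: a_def)
    have cover: "\<exists>n\<ge>m. \<exists>z\<in>H n x. y \<in> cball z (2 * L n)" if y: "y \<in> covered_set T l x \<inter> U" for m y
    proof -
      from y have "\<exists>\<^sub>\<infinity>n. (T ^^ n) x \<in> cball y (l n)" by (simp add: covered_set_def)
      then obtain k where k: "k \<ge> m + n0" "(T ^^ k) x \<in> cball y (l k)"
        unfolding INFM_nat_le by blast
      define n where "n = k - n0"
      have n: "n \<ge> m" "k = n + n0" using k by (auto simp: n_def)
      obtain z where z: "z \<in> Z n" "y \<in> cball z (2 * L n)" using Z(4)[of n] y by blast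
      have "dist z ((T ^^ k) x) \<le> dist z y + dist y ((T ^^ k) x)" by (rule dist_triangle)
      then have "z \<in> H n x" using z k(2) n by (simp add: H_def L_def)
      with z n show ?thesis by blast
    qed
    {
      assume "u = 0"
      then have "(\<lambda>n. real (card (H n x))) \<longlonglongrightarrow> 0"
        using summable_LIMSEQ_zero[OF sa] L_pos by (simp add: a_def less_imp_neq[symmetric])
      then have "\<forall>\<^sub>F n in sequentially. real (card (H n x)) < 1"
        by (rule order_tendstoD) simp
      then obtain m where "\<And>n. n \<ge> m \<Longrightarrow> card (H n x) = 0"
        unfolding eventually_sequentially by fastforce
      then have "H n x = {}" if "n \<ge> m" for n using that H_fin by simp
      with cover[of _ m] show "covered_set T l x \<inter> U = {}" by blast
    next
      assume "0 < u"
      show "hausdorff_measure u (covered_set T l x \<inter> U) = 0"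
      proof (rule hausdorff_nullI)
        fix d e :: real assume "0 < d" "0 < e"
        have "\<forall>\<^sub>F n in sequentially. L n < d / 4"
          using \<open>0 < d\<close> by (intro order_tendstoD(2)[OF L_lim]) auto
        then obtain m1 where m1: "\<And>n. n \<ge> m1 \<Longrightarrow> L n < d / 4"
          unfolding eventually_sequentially by blast
        obtain m2 where m2: "\<And>n. n \<ge> m2 \<Longrightarrow> norm (\<Sum>i. a (i + n) x) < e / 4 powr u"
          using suminf_exist_split[OF _ sa, of "e / 4 powr u"] \<open>0 < e\<close> by auto
        define m where "m = max m1 m2"
        have diam: "diameter (cball z (2 * L n)) \<le> 4 * L n" for z :: 'a and n
        proof (rule diameter_leI)
          fix p q assume "p \<in> cball z (2 * L n)" "q \<in> cball z (2 * L n)"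
          then show "dist p q \<le> 4 * L n" using dist_triangle2[of p q z] by (simp add: dist_commute)
        qed (use L_pos[of n] in simp)
        let ?I = "SIGMA n:{m..}. H n x"
        have "hausdorff_premeasure u d (covered_set T l x \<inter> U)
            \<le> (\<integral>\<^sup>+p. diam_pow u (case p of (n, z) \<Rightarrow> cball z (2 * L n)) \<partial>count_space ?I)"
        proof (rule hausdorff_premeasure_le_nn_integral)
          show "countable ?I" using countable_finite[OF H_fin] by (intro countable_SIGMA) auto
          show "covered_set T l x \<inter> U \<subseteq> (\<Union>p\<in>?I. case p of (n, z) \<Rightarrow> cball z (2 * L n))"
            using cover[of _ m] by fastforce
          fix p assume "p \<in> ?I"
          then obtain n z where p: "p = (n, z)" "n \<ge> m" by auto
          show "bounded (case p of (n, z) \<Rightarrow> cball z (2 * L n)) \<and>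
              diameter (case p of (n, z) \<Rightarrow> cball z (2 * L n)) \<le> d"
            using diam[of z n] m1[of n] p by (simp add: m_def)
        qed (use \<open>0 < d\<close> in simp)
        also have "\<dots> \<le> (\<integral>\<^sup>+p. (case p of (n, z) \<Rightarrow> ennreal ((4 * L n) powr u)) \<partial>count_space ?I)"
        proof (intro nn_integral_mono)
          fix p :: "nat \<times> 'a"
          obtain n z where p: "p = (n, z)" by (cases p)
          have "diameter (cball z (2 * L n)) powr u \<le> (4 * L n) powr u"
            using diam[of z n] \<open>0 < u\<close> by (intro powr_mono2) (auto intro!: diameter_ge_0)
          then show "diam_pow u (case p of (n, z) \<Rightarrow> cball z (2 * L n))
              \<le> (case p of (n, z) \<Rightarrow> ennreal ((4 * L n) powr u))"
            using \<open>0 < u\<close> by (simp add: p diam_pow_def ennreal_leI)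
        qed
        also have "\<dots> = (\<integral>\<^sup>+p. (case p of (n, z) \<Rightarrow> ennreal ((4 * L n) powr u)) * indicator ?I p \<partial>count_space UNIV)"
          by (rule nn_integral_count_space_indicator) simp
        also have "\<dots> = (\<integral>\<^sup>+n. \<integral>\<^sup>+z. ennreal ((4 * L n) powr u) * indicator ?I (n, z) \<partial>count_space UNIV \<partial>count_space UNIV)"
          by (subst nn_integral_fst_count_space[symmetric]) simp
        also have "\<dots> = (\<integral>\<^sup>+n. ennreal (4 powr u * a n x) * indicator {m..} n \<partial>count_space UNIV)"
        proof (intro nn_integral_cong)
          fix n :: nat
          have "(\<integral>\<^sup>+z. ennreal ((4 * L n) powr u) * indicator ?I (n, z) \<partial>count_space UNIV)
             = (\<integral>\<^sup>+z. (ennreal ((4 * L n) powr u) * indicator {m..} n) * indicator (H n x) z \<partial>count_space UNIV)"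
            by (intro nn_integral_cong) (simp add: indicator_def)
          also have "\<dots> = (ennreal ((4 * L n) powr u) * indicator {m..} n) * of_nat (card (H n x))"
            by (subst nn_integral_cmult_indicator) (simp_all add: H_fin)
          also have "\<dots> = ennreal (4 powr u * a n x) * indicator {m..} n"
            using L_pos[of n] by (simp add: a_def powr_mult ennreal_mult ennreal_of_nat_eq_real_of_nat mult_ac)
          finally show "(\<integral>\<^sup>+z. ennreal ((4 * L n) powr u) * indicator ?I (n, z) \<partial>count_space UNIV)
             = ennreal (4 powr u * a n x) * indicator {m..} n" .
        qed
        also have "\<dots> = (\<Sum>n. ennreal (4 powr u * a n x) * indicator {m..} n)"
          by (simp add: nn_integral_count_space_nat)
        also have "\<dots> = (\<Sum>n. ennreal (4 powr u * a (n + m) x))"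
          by (subst suminf_offset[of _ m]) simp_all
        also have "\<dots> = ennreal (\<Sum>n. 4 powr u * a (n + m) x)"
          using summable_ignore_initial_segment[OF sa, of m]
          by (intro suminf_ennreal2 summable_mult) (auto simp: a_def)
        also have "\<dots> \<le> ennreal e"
        proof (rule ennreal_leI)
          have "(\<Sum>n. 4 powr u * a (n + m) x) = 4 powr u * (\<Sum>n. a (n + m) x)"
            using summable_ignore_initial_segment[OF sa, of m] by (rule suminf_mult)
          moreover have "(\<Sum>n. a (n + m) x) < e / 4 powr u"
            using m2[of m] by (simp add: m_def)
          ultimately show "(\<Sum>n. 4 powr u * a (n + m) x) \<le> e"
            by (simp add: field_simps)
        qed
        finally show "hausdorff_premeasure u d (covered_set T l x \<inter> U) \<le> ennreal e" .
      qed
    }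
  qed
qed

text \<open>
  Packing measure is built from packing premeasure by countable covers, and both conclusions of
  \<open>AE_covered_set_null\<close> are stable under countable unions.
\<close>
lemma AE_covered_intersection_null:
  assumes null: "packing_measure t G = 0"
    and pos: "\<And>n. n \<ge> 1 \<Longrightarrow> 0 < l n" and lim: "l \<longlonglongrightarrow> 0"
    and summ: "summable (\<lambda>n. l (Suc n) powr (s - t + u))" and u: "0 \<le> u"
  shows "AE x in M. (u = 0 \<longrightarrow> covered_set T l x \<inter> G = {}) \<and>
                    (0 < u \<longrightarrow> hausdorff_measure u (covered_set T l x \<inter> G) = 0)"
proof -
  have "packing_measure t G < 1" using null by simp
  then obtain U where U: "G \<subseteq> (\<Union>i. U i)" "(\<Sum>i. packing_premeasure t (U i)) < 1"
    unfolding packing_measure_def INF_less_iff by blast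
  have "packing_premeasure t (U i) < \<infinity>" for i
  proof -
    have "packing_premeasure t (U i) \<le> (\<Sum>i. packing_premeasure t (U i))"
      using sum_le_suminf[of "\<lambda>i. packing_premeasure t (U i)" "{i}"] by simp
    also have "\<dots> < 1" by (rule U(2))
    finally show ?thesis by (rule less_trans) simp
  qed
  then have "AE x in M. \<forall>i. (u = 0 \<longrightarrow> covered_set T l x \<inter> U i = {}) \<and>
                    (0 < u \<longrightarrow> hausdorff_measure u (covered_set T l x \<inter> U i) = 0)"
    unfolding AE_all_countable using AE_covered_set_null[OF _ pos lim summ u] by blast
  then show ?thesis
  proof eventually_elim
    case (elim x)
    have sub: "covered_set T l x \<inter> G \<subseteq> (\<Union>i. covered_set T l x \<inter> U i)" using U(1) by blast
    show ?case
    proof (intro conjI impI)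
      assume "u = 0"
      with elim have "covered_set T l x \<inter> U i = {}" for i by blast
      with sub show "covered_set T l x \<inter> G = {}" by simp
    next
      assume "0 < u"
      with elim have "hausdorff_measure u (\<Union>i. covered_set T l x \<inter> U i) = 0"
        by (intro hausdorff_null_UN) blast
      then show "hausdorff_measure u (covered_set T l x \<inter> G) = 0" using sub by (rule hausdorff_null_subset)
    qed
  qed
qed

end

section \<open>Contents on a tree of cells\<close>

text \<open>
  A sequence of finite partitions of a set, the \<open>i\<close>-th one into the fibres of \<open>code i\<close>. A cell of
  level \<open>n\<close> consists of the points with a prescribed string of first \<open>n\<close> codes; the nonempty cells form
  a finitely branching tree. A cell of level \<open>n\<close> has weight \<open>\<beta>\<^sup>n\<close>.
\<close>
locale tree_coding =
  fixes code :: "nat \<Rightarrow> 'a \<Rightarrow> nat" and \<beta> :: real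
  assumes beta: "0 < \<beta>" "\<beta> < 1" and finite_code: "\<And>i. finite (range (code i))"
begin

definition pre :: "nat \<Rightarrow> 'a \<Rightarrow> nat list" where
  "pre n y = map (\<lambda>i. code i y) [0..<n]"

definition cell :: "nat list \<Rightarrow> 'a set" where
  "cell p = {y. pre (length p) y = p}"

definition cost :: "nat list set \<Rightarrow> ennreal" where
  "cost S = (\<integral>\<^sup>+p. ennreal (\<beta> ^ length p) \<partial>count_space S)"

definition covers :: "nat list set \<Rightarrow> 'a set \<Rightarrow> bool" where
  "covers S A \<longleftrightarrow> (\<forall>y\<in>A. \<exists>n. pre n y \<in> S)"

text \<open>
  The net content of Besicovitch and Rogers: the least total weight of a family of cells that covers
  the set.
\<close>
definition content :: "'a set \<Rightarrow> ennreal" where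
  "content A = (INF S\<in>{S. covers S A}. cost S)"

lemma length_pre [simp]: "length (pre n y) = n"
  by (simp add: pre_def)

lemma take_pre: "m \<le> n \<Longrightarrow> take m (pre n y) = pre m y"
  by (simp add: pre_def take_map)

lemma in_cell_iff: "y \<in> cell p \<longleftrightarrow> pre (length p) y = p"
  by (simp add: cell_def)

lemma cell_Nil [simp]: "cell [] = UNIV"
  by (auto simp: cell_def pre_def)

lemma in_cell_pre [simp]: "y \<in> cell (pre n y)"
  by (simp add: in_cell_iff)

lemma in_cell_snoc: "y \<in> cell (p @ [j]) \<longleftrightarrow> y \<in> cell p \<and> code (length p) y = j"
  by (simp add: cell_def pre_def)

lemma cost_indicator: "cost S = (\<integral>\<^sup>+p. ennreal (\<beta> ^ length p) * indicator S p \<partial>count_space UNIV)"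
  unfolding cost_def by (rule nn_integral_count_space_indicator) simp

lemma cost_single [simp]: "cost {p} = ennreal (\<beta> ^ length p)"
  by (simp add: cost_def nn_integral_count_space_finite)

lemma cost_empty [simp]: "cost {} = 0"
  by (simp add: cost_def nn_integral_count_space_finite)

lemma cost_ge: "p \<in> S \<Longrightarrow> ennreal (\<beta> ^ length p) \<le> cost S"
  unfolding cost_def by (rule nn_integral_ge_point)

lemma cost_UN:
  assumes "countable I"
  shows "cost (\<Union>i\<in>I. S i) \<le> (\<integral>\<^sup>+i. cost (S i) \<partial>count_space I)"
proof -
  have "indicator (\<Union>i\<in>I. S i) p \<le> (\<integral>\<^sup>+i. indicator (S i) p \<partial>count_space I :: ennreal)" for p
  proof (cases "p \<in> (\<Union>i\<in>I. S i)")
    case True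
    then obtain i where "i \<in> I" "p \<in> S i" by blast
    then show ?thesis
      using nn_integral_ge_point[of i I "\<lambda>i. indicator (S i) p"] True by simp
  qed simp
  then have "cost (\<Union>i\<in>I. S i)
      \<le> (\<integral>\<^sup>+p. ennreal (\<beta> ^ length p) * (\<integral>\<^sup>+i. indicator (S i) p \<partial>count_space I) \<partial>count_space UNIV)"
    unfolding cost_indicator by (intro nn_integral_mono mult_left_mono) auto
  also have "\<dots> = (\<integral>\<^sup>+p. \<integral>\<^sup>+i. ennreal (\<beta> ^ length p) * indicator (S i) p \<partial>count_space I \<partial>count_space UNIV)"
    by (simp add: nn_integral_cmult)
  also have "\<dots> = (\<integral>\<^sup>+i. cost (S i) \<partial>count_space I)"
    unfolding cost_indicator using assms by (intro nn_integral_count_space_nn_integral) auto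
  finally show ?thesis .
qed

lemma cost_Un: "cost (S \<union> S') \<le> cost S + cost S'"
proof -
  have "cost (S \<union> S') \<le> (\<integral>\<^sup>+p. ennreal (\<beta> ^ length p) * indicator S p
      + ennreal (\<beta> ^ length p) * indicator S' p \<partial>count_space UNIV)"
    unfolding cost_indicator by (intro nn_integral_mono) (auto simp: indicator_def)
  then show ?thesis by (simp add: nn_integral_add cost_indicator)
qed

lemma content_le_cost: "covers S A \<Longrightarrow> content A \<le> cost S"
  unfolding content_def by (intro INF_lower) simp

lemma content_lessE:
  assumes "content A < e"
  obtains S where "covers S A" "cost S < e"
  using assms unfolding content_def INF_less_iff by auto

lemma content_mono: "A \<subseteq> B \<Longrightarrow> content A \<le> content B"
  unfolding content_def by (intro INF_superset_mono) (auto simp: covers_def)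

lemma content_cell: "content (A \<inter> cell p) \<le> ennreal (\<beta> ^ length p)"
proof -
  have "covers {p} (A \<inter> cell p)" by (auto simp: covers_def cell_def)
  from content_le_cost[OF this] show ?thesis by simp
qed

lemma content_le_1: "content A \<le> 1"
  using content_cell[of A "[]"] by simp

lemma content_finite: "content A < \<infinity>"
  using content_le_1[of A] by (rule le_less_trans) simp

lemma content_empty [simp]: "content {} = 0"
  using content_le_cost[of "{}" "{}"] by (simp add: covers_def)

lemma content_UN: "content (\<Union>n::nat. A n) \<le> (\<Sum>n. content (A n))"
proof (rule ennreal_le_epsilon)
  fix e :: real assume "0 < e"
  have "\<exists>S. covers S (A n) \<and> cost S \<le> content (A n) + ennreal (e * (1/2)^Suc n)" for n
  proof -
    have "content (A n) < content (A n) + ennreal (e * (1/2)^Suc n)"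
      using \<open>0 < e\<close> content_finite[of "A n"] by (simp add: less_top)
    then show ?thesis by (metis content_lessE less_imp_le)
  qed
  then obtain S where S: "\<And>n. covers (S n) (A n)"
      "\<And>n. cost (S n) \<le> content (A n) + ennreal (e * (1/2)^Suc n)"
    by metis
  have "covers (\<Union>n. S n) (\<Union>n. A n)" using S(1) by (fastforce simp: covers_def)
  then have "content (\<Union>n. A n) \<le> cost (\<Union>n. S n)" by (rule content_le_cost)
  also have "\<dots> \<le> (\<Sum>n. cost (S n))"
    using cost_UN[of UNIV S] by (simp add: nn_integral_count_space_nat)
  also have "\<dots> \<le> (\<Sum>n. content (A n) + ennreal (e * (1/2)^Suc n))"
    using S(2) by (intro suminf_le) auto
  also have "\<dots> = (\<Sum>n. content (A n)) + (\<Sum>n. ennreal (e * (1/2)^Suc n))"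
    by (rule suminf_add[symmetric]) auto
  also have "(\<Sum>n. ennreal (e * (1/2)^Suc n)) = ennreal e"
    using sums_mult[OF power_half_series, of e] \<open>0 < e\<close>
    by (subst suminf_ennreal2) (auto simp: sums_iff)
  finally show "content (\<Union>n. A n) \<le> (\<Sum>n. content (A n)) + ennreal e" .
qed

lemma content_children:
  "content (A \<inter> cell p) \<le> (\<Sum>j\<in>range (code (length p)). content (A \<inter> cell (p @ [j])))"
proof -
  let ?J = "range (code (length p))"
  define B where "B j = (if j \<in> ?J then A \<inter> cell (p @ [j]) else {})" for j
  have "A \<inter> cell p = (\<Union>j. B j)" by (auto simp: B_def in_cell_snoc)
  then have "content (A \<inter> cell p) \<le> (\<Sum>j. content (B j))" using content_UN[of B] by simp
  also have "\<dots> = (\<Sum>j\<in>?J. content (B j))"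
    using finite_code by (intro suminf_finite) (auto simp: B_def)
  finally show ?thesis by (simp add: B_def)
qed

text \<open>
  A cover that is cheaper than the cell itself uses only proper subcells, so it splits into covers
  of the children.
\<close>
lemma content_split:
  assumes less: "content (A \<inter> cell p) < ennreal (\<beta> ^ length p)"
  shows "(\<Sum>j\<in>range (code (length p)). content (A \<inter> cell (p @ [j]))) \<le> content (A \<inter> cell p)"
proof (rule ccontr)
  let ?J = "range (code (length p))"
  let ?sum = "\<Sum>j\<in>?J. content (A \<inter> cell (p @ [j]))"
  assume "\<not> ?thesis"
  then have "content (A \<inter> cell p) < min ?sum (ennreal (\<beta> ^ length p))"
    using less by auto
  then obtain S where S: "covers S (A \<inter> cell p)" "cost S < min ?sum (ennreal (\<beta> ^ length p))"
    by (rule content_lessE)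
  define R where "R j = {q \<in> S. take (Suc (length p)) q = p @ [j]}" for j
  have long: "length p < n" if "pre n y \<in> S" for n y
  proof (rule ccontr)
    assume "\<not> length p < n"
    then have "ennreal (\<beta> ^ length p) \<le> ennreal (\<beta> ^ n)"
      using beta by (intro ennreal_leI power_decreasing) auto
    also have "\<dots> \<le> cost S" using cost_ge[OF that] by simp
    also have "\<dots> < ennreal (\<beta> ^ length p)" using S(2) by simp
    finally show False by simp
  qed
  have "covers (R j) (A \<inter> cell (p @ [j]))" for j
    unfolding covers_def
  proof
    fix y assume y: "y \<in> A \<inter> cell (p @ [j])"
    then obtain n where n: "pre n y \<in> S"
      using S(1) by (auto simp: covers_def in_cell_snoc)
    have "take (Suc (length p)) (pre n y) = pre (Suc (length p)) y"
      using long[OF n] by (intro take_pre) simp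
    also have "\<dots> = p @ [j]" using y by (simp add: in_cell_iff)
    finally show "\<exists>n. pre n y \<in> R j" using n by (auto simp: R_def)
  qed
  then have "?sum \<le> (\<Sum>j\<in>?J. cost (R j))"
    by (intro sum_mono content_le_cost)
  also have "\<dots> = (\<integral>\<^sup>+q. (\<Sum>j\<in>?J. ennreal (\<beta> ^ length q) * indicator (R j) q) \<partial>count_space UNIV)"
    unfolding cost_indicator by (simp add: nn_integral_sum)
  also have "\<dots> \<le> cost S"
    unfolding cost_indicator
  proof (intro nn_integral_mono)
    fix q :: "nat list"
    have "(\<Sum>j\<in>?J. indicator (R j) q :: ennreal) \<le> indicator S q"
    proof (cases "\<exists>j. q \<in> R j")
      case True
      then obtain j where j: "q \<in> R j" by blast
      then have "q \<in> R i \<longleftrightarrow> i = j" for i by (auto simp: R_def)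
      then have "(\<Sum>i\<in>?J. indicator (R i) q :: ennreal) = (\<Sum>i\<in>?J. if i = j then 1 else 0)"
        by (intro sum.cong) (auto simp: indicator_def)
      also have "\<dots> \<le> 1" using finite_code by (simp add: sum.delta)
      finally show ?thesis using j by (simp add: R_def)
    next
      case False
      then show ?thesis by (simp add: indicator_def)
    qed
    then show "(\<Sum>j\<in>?J. ennreal (\<beta> ^ length q) * indicator (R j) q)
        \<le> ennreal (\<beta> ^ length q) * indicator S q"
      by (simp add: sum_distrib_left[symmetric] mult_left_mono)
  qed
  also have "\<dots> < ?sum" using S(2) by simp
  finally show False by simp
qed

text \<open>
  If every cell meets \<open>B\<close> in content at most \<open>\<theta>\<close> times its weight, each cell of a cover of \<open>B\<close>
  can be replaced by a cover which is cheaper by a fixed factor below \<open>1\<close>. Hence the content of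
  \<open>B\<close> is at most that factor times itself.
\<close>
lemma content_null_of_thin:
  assumes "\<theta> < 1" "0 < \<theta>"
    and thin: "\<And>n y. y \<in> B \<Longrightarrow> content (B \<inter> cell (pre n y)) \<le> ennreal (\<theta> * \<beta> ^ n)"
  shows "content B = 0"
proof (rule ccontr)
  assume "content B \<noteq> 0"
  define \<eta> where "\<eta> = (1 + \<theta>) / 2"
  have \<eta>: "\<theta> < \<eta>" "0 < \<eta>" "\<eta> < 1" using assms by (auto simp: \<eta>_def)
  define m where "m = enn2real (content B)"
  have m: "content B = ennreal m" "0 < m"
    using content_finite[of B] \<open>content B \<noteq> 0\<close>
    by (auto simp: m_def enn2real_positive_iff less_top zero_less_iff_neq_zero)
  have "content B < ennreal (m / \<eta>)"
    using m \<eta> by (simp add: ennreal_less_iff field_simps)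
  then obtain S where S: "covers S B" "cost S < ennreal (m / \<eta>)" by (rule content_lessE)
  have "\<exists>R. covers R (B \<inter> cell p) \<and> cost R \<le> ennreal (\<eta> * \<beta> ^ length p)" for p
  proof (cases "B \<inter> cell p = {}")
    case True
    then show ?thesis by (intro exI[of _ "{}"]) (simp add: covers_def)
  next
    case False
    then obtain y where y: "y \<in> B" "p = pre (length p) y" by (metis IntE ex_in_conv in_cell_iff)
    have "content (B \<inter> cell p) \<le> ennreal (\<theta> * \<beta> ^ length p)"
      using thin[OF y(1), of "length p"] y(2) by simp
    also have "\<dots> < ennreal (\<eta> * \<beta> ^ length p)"
      using \<eta> beta assms by (intro ennreal_lessI) auto
    finally show ?thesis by (metis content_lessE less_imp_le)
  qed
  then obtain R where R: "\<And>p. covers (R p) (B \<inter> cell p)"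
      "\<And>p. cost (R p) \<le> ennreal (\<eta> * \<beta> ^ length p)" by metis
  have "covers (\<Union>p\<in>S. R p) B"
    unfolding covers_def
  proof
    fix y assume "y \<in> B"
    then obtain n where n: "pre n y \<in> S" using S(1) by (auto simp: covers_def)
    then obtain k where "pre k y \<in> R (pre n y)"
      using R(1)[of "pre n y"] \<open>y \<in> B\<close> unfolding covers_def by (meson IntI in_cell_pre)
    with n show "\<exists>n. pre n y \<in> (\<Union>p\<in>S. R p)" by blast
  qed
  then have "content B \<le> cost (\<Union>p\<in>S. R p)" by (rule content_le_cost)
  also have "\<dots> \<le> (\<integral>\<^sup>+p. cost (R p) \<partial>count_space S)" by (intro cost_UN) simp
  also have "\<dots> \<le> (\<integral>\<^sup>+p. ennreal \<eta> * ennreal (\<beta> ^ length p) \<partial>count_space S)"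
    using R(2) \<eta> beta by (intro nn_integral_mono) (simp add: ennreal_mult)
  also have "\<dots> = ennreal \<eta> * cost S" by (simp add: nn_integral_cmult cost_def)
  also have "\<dots> < ennreal \<eta> * ennreal (m / \<eta>)"
    using S(2) \<eta> by (intro ennreal_mult_strict_left_mono) auto
  also have "\<dots> = content B" using \<eta> m by (simp add: ennreal_mult[symmetric])
  finally show False by simp
qed

text \<open>
  Let \<open>h p\<close> be the limit of the contents of \<open>A\<^sub>k\<close> within the cell \<open>p\<close>. Cells with
  \<open>h p > \<theta> \<beta>\<^sup>|\<^sup>p\<^sup>|\<close> are saturated, and the maximal ones among them form the family \<open>S\<close>. By
  \<open>content_split\<close>, the value of \<open>h\<close> at a cell which is not saturated is at least the sum of its values at the
  children, so the sum of \<open>h\<close> over \<open>S\<close> is at most its value at the root. Thus \<open>S\<close> costs at most \<open>1/\<theta>\<close> times the limit of the contents. The points that belong to no saturated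
  cell contribute nothing by \<open>content_null_of_thin\<close>.
\<close>
lemma content_UN_incseq_le:
  assumes "incseq A" and \<theta>: "0 < \<theta>" "\<theta> < 1"
  shows "ennreal \<theta> * content (\<Union>k. A k) \<le> (SUP k. content (A k))"
proof -
  define h where "h p = (SUP k. content (A k \<inter> cell p))" for p
  define Sat where "Sat = {p. ennreal (\<theta> * \<beta> ^ length p) < h p}"
  define S where "S = {p \<in> Sat. \<forall>m<length p. take m p \<notin> Sat}"
  define D where "D p n = {q \<in> S. take (length p) q = p \<and> length q \<le> length p + n}" for p n
  define ch where "ch p = range (code (length p))" for p :: "nat list"
  have h_split: "(\<Sum>j\<in>ch p. h (p @ [j])) \<le> h p" if "p \<notin> Sat" for p
  proof -
    have "(\<Sum>j\<in>ch p. h (p @ [j])) = (SUP k. \<Sum>j\<in>ch p. content (A k \<inter> cell (p @ [j])))"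
      unfolding h_def ch_def
      by (rule ennreal_SUP_sum[symmetric])
        (use \<open>incseq A\<close> in \<open>auto simp: incseq_def intro!: content_mono\<close>)
    also have "\<dots> \<le> h p"
    proof (rule SUP_least)
      fix k
      have k: "content (A k \<inter> cell p) \<le> h p" unfolding h_def by (rule SUP_upper) simp
      also have "h p \<le> ennreal (\<theta> * \<beta> ^ length p)" using that by (simp add: Sat_def)
      also have "\<dots> < ennreal (\<beta> ^ length p)" using \<theta> beta by (intro ennreal_lessI) auto
      finally have "(\<Sum>j\<in>ch p. content (A k \<inter> cell (p @ [j]))) \<le> content (A k \<inter> cell p)"
        unfolding ch_def by (rule content_split)
      with k show "(\<Sum>j\<in>ch p. content (A k \<inter> cell (p @ [j]))) \<le> h p" by simp
    qed
    finally show ?thesis .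
  qed
  have single: "(\<integral>\<^sup>+q. h q * indicator X q \<partial>count_space UNIV) \<le> h p" if "X \<subseteq> {p}" for X p
  proof -
    have "(\<integral>\<^sup>+q. h q * indicator X q \<partial>count_space UNIV) \<le> (\<integral>\<^sup>+q. h q * indicator {p} q \<partial>count_space UNIV)"
      using that by (intro nn_integral_mono mult_left_mono) (auto simp: indicator_def)
    also have "\<dots> = (\<integral>\<^sup>+q. h q \<partial>count_space {p})"
      by (rule nn_integral_count_space_indicator[symmetric]) simp
    also have "\<dots> = h p" by (simp add: nn_integral_count_space_finite)
    finally show ?thesis .
  qed
  have D_le: "(\<integral>\<^sup>+q. h q * indicator (D p n) q \<partial>count_space UNIV) \<le> h p"
    if "\<forall>m<length p. take m p \<notin> Sat" for p n
    using that
  proof (induction n arbitrary: p)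
    case 0
    have "D p 0 \<subseteq> {p}" by (auto simp: D_def)
    then show ?case by (rule single)
  next
    case (Suc n)
    show ?case
    proof (cases "p \<in> Sat")
      case True
      have "D p (Suc n) \<subseteq> {p}"
      proof
        fix q assume q: "q \<in> D p (Suc n)"
        then have "take (length p) q \<in> Sat" using True by (simp add: D_def)
        then have "\<not> length p < length q" using q by (auto simp: D_def S_def)
        with q show "q \<in> {p}" by (simp add: D_def)
      qed
      then show ?thesis by (rule single)
    next
      case False
      have sub: "D p (Suc n) \<subseteq> (\<Union>j\<in>ch p. D (p @ [j]) n)"
      proof
        fix q assume q: "q \<in> D p (Suc n)"
        then have "q \<in> Sat" "take (length p) q = p" by (auto simp: D_def S_def)
        then have "q \<noteq> p" using False by blast
        then have len: "length p < length q"
          using \<open>take (length p) q = p\<close> by (metis not_less take_all)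
        have "0 < h q" using \<open>q \<in> Sat\<close> by (auto simp: Sat_def intro: le_less_trans)
        then obtain k where "0 < content (A k \<inter> cell q)"
          unfolding h_def less_SUP_iff by blast
        then obtain y where "y \<in> cell q" by (metis Int_empty_right content_empty ex_in_conv less_irrefl)
        then have "q = pre (length q) y" by (simp add: in_cell_iff)
        then have "q ! length p = code (length p) y"
          using len by (metis diff_zero nth_map_upt plus_nat.add_0 pre_def)
        moreover have "take (Suc (length p)) q = p @ [q ! length p]"
          using len \<open>take (length p) q = p\<close> by (simp add: take_Suc_conv_app_nth)
        ultimately show "q \<in> (\<Union>j\<in>ch p. D (p @ [j]) n)"
          using q by (auto simp: D_def ch_def)
      qed
      have "(\<integral>\<^sup>+q. h q * indicator (D p (Suc n)) q \<partial>count_space UNIV)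
          \<le> (\<integral>\<^sup>+q. (\<Sum>j\<in>ch p. h q * indicator (D (p @ [j]) n) q) \<partial>count_space UNIV)"
      proof (intro nn_integral_mono)
        fix q
        show "h q * indicator (D p (Suc n)) q \<le> (\<Sum>j\<in>ch p. h q * indicator (D (p @ [j]) n) q)"
        proof (cases "q \<in> D p (Suc n)")
          case True
          then obtain j where "j \<in> ch p" "q \<in> D (p @ [j]) n" using sub by blast
          then show ?thesis
            using True member_le_sum[of j "ch p" "\<lambda>j. h q * indicator (D (p @ [j]) n) q"] finite_code
            by (simp add: ch_def)
        qed simp
      qed
      also have "\<dots> = (\<Sum>j\<in>ch p. \<integral>\<^sup>+q. h q * indicator (D (p @ [j]) n) q \<partial>count_space UNIV)"
        by (rule nn_integral_sum) simp
      also have "\<dots> \<le> (\<Sum>j\<in>ch p. h (p @ [j]))"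
      proof (intro sum_mono Suc.IH allI impI)
        fix j m assume "m < length (p @ [j])"
        then show "take m (p @ [j]) \<notin> Sat"
          using Suc.prems False by (cases "m = length p") (auto simp: less_Suc_eq)
      qed
      also have "\<dots> \<le> h p" using False by (rule h_split)
      finally show ?thesis .
    qed
  qed
  have "(\<integral>\<^sup>+q. h q * indicator S q \<partial>count_space UNIV)
      = (\<integral>\<^sup>+q. (SUP n. h q * indicator (D [] n) q) \<partial>count_space UNIV)"
  proof (intro nn_integral_cong antisym)
    fix q
    show "h q * indicator S q \<le> (SUP n. h q * indicator (D [] n) q)"
      by (rule SUP_upper2[of "length q"]) (auto simp: D_def indicator_def)
    show "(SUP n. h q * indicator (D [] n) q) \<le> h q * indicator S q"
      by (rule SUP_least) (auto simp: D_def indicator_def)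
  qed
  also have "\<dots> = (SUP n. \<integral>\<^sup>+q. h q * indicator (D [] n) q \<partial>count_space UNIV)"
    by (rule nn_integral_monotone_convergence_SUP)
      (auto simp: incseq_def le_fun_def D_def indicator_def)
  also have "\<dots> \<le> h []"
    by (rule SUP_least) (rule D_le, simp)
  finally have S_le: "(\<integral>\<^sup>+q. h q * indicator S q \<partial>count_space UNIV) \<le> h []" .
  have "ennreal \<theta> * cost S = (\<integral>\<^sup>+q. ennreal \<theta> * (ennreal (\<beta> ^ length q) * indicator S q) \<partial>count_space UNIV)"
    unfolding cost_indicator by (rule nn_integral_cmult[symmetric]) simp
  also have "\<dots> \<le> (\<integral>\<^sup>+q. h q * indicator S q \<partial>count_space UNIV)"
  proof (intro nn_integral_mono)
    fix q
    show "ennreal \<theta> * (ennreal (\<beta> ^ length q) * indicator S q) \<le> h q * indicator S q"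
      using \<theta> beta by (auto simp: indicator_def S_def Sat_def ennreal_mult)
  qed
  finally have cost_S: "ennreal \<theta> * cost S \<le> h []" using S_le by (rule order_trans)

  define B where "B k = {y \<in> A k. \<forall>n. pre n y \<notin> Sat}" for k
  have "content (B k) = 0" for k
  proof (rule content_null_of_thin[OF \<theta>(2,1)])
    fix n y assume "y \<in> B k"
    have "content (B k \<inter> cell (pre n y)) \<le> content (A k \<inter> cell (pre n y))"
      by (rule content_mono) (auto simp: B_def)
    also have "\<dots> \<le> h (pre n y)" unfolding h_def by (rule SUP_upper) simp
    also have "\<dots> \<le> ennreal (\<theta> * \<beta> ^ n)"
      using \<open>y \<in> B k\<close> by (auto simp: B_def Sat_def not_less)
    finally show "content (B k \<inter> cell (pre n y)) \<le> ennreal (\<theta> * \<beta> ^ n)" .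
  qed
  then have "content (\<Union>k. B k) = 0"
    using content_UN[of B] by simp
  have "content (\<Union>k. A k) \<le> cost S"
  proof (rule ennreal_le_epsilon)
    fix e :: real assume "0 < e"
    then have "content (\<Union>k. B k) < ennreal e" using \<open>content (\<Union>k. B k) = 0\<close> by simp
    then obtain R where R: "covers R (\<Union>k. B k)" "cost R < ennreal e" by (rule content_lessE)
    have "covers (S \<union> R) (\<Union>k. A k)"
      unfolding covers_def
    proof
      fix y assume "y \<in> (\<Union>k. A k)"
      show "\<exists>n. pre n y \<in> S \<union> R"
      proof (cases "\<exists>n. pre n y \<in> Sat")
        case True
        define n where "n = (LEAST n. pre n y \<in> Sat)"
        have "pre n y \<in> Sat" unfolding n_def using True by (rule LeastI_ex)
        moreover have "pre m y \<notin> Sat" if "m < n" for m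
          using that unfolding n_def by (rule not_less_Least)
        ultimately have "pre n y \<in> S" by (auto simp: S_def take_pre)
        then show ?thesis by blast
      next
        case False
        then have "y \<in> (\<Union>k. B k)" using \<open>y \<in> (\<Union>k. A k)\<close> by (auto simp: B_def)
        with R(1) show ?thesis by (auto simp: covers_def)
      qed
    qed
    then have "content (\<Union>k. A k) \<le> cost (S \<union> R)" by (rule content_le_cost)
    also have "\<dots> \<le> cost S + cost R" by (rule cost_Un)
    also have "\<dots> \<le> cost S + ennreal e" using R(2) by (intro add_left_mono) simp
    finally show "content (\<Union>k. A k) \<le> cost S + ennreal e" .
  qed
  then have "ennreal \<theta> * content (\<Union>k. A k) \<le> ennreal \<theta> * cost S"
    by (rule mult_left_mono) simp
  also note cost_S
  also have "h [] = (SUP k. content (A k))" by (simp add: h_def)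
  finally show ?thesis .
qed

text \<open>
  The increasing sets lemma for the net content. It makes it possible to bound the coordinates of a
  continuous image of the Baire space one after the other while the content stays above a given level.
\<close>
lemma content_incseq:
  assumes "incseq A" "e < content (\<Union>k. A k)"
  obtains k where "e < content (A k)"
proof -
  let ?C = "content (\<Union>k. A k)"
  define a where "a = enn2real ?C"
  have a: "?C = ennreal a" "0 \<le> a" using content_finite[of "\<Union>k. A k"] by (simp_all add: a_def less_top)
  define b where "b = enn2real e"
  have "e < \<infinity>" using assms(2) content_finite[of "\<Union>k. A k"] by (rule less_trans)
  then have b: "e = ennreal b" "0 \<le> b" by (simp_all add: b_def less_top)
  have "b < a" using assms(2) a b by (simp add: ennreal_less_iff)
  define \<theta> where "\<theta> = (b + a) / (2 * a)"
  have \<theta>: "0 < \<theta>" "\<theta> < 1" "b < \<theta> * a"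
    using \<open>b < a\<close> b a by (auto simp: \<theta>_def field_simps)
  have "e < ennreal \<theta> * ?C"
    using \<theta> a b by (simp add: ennreal_mult[symmetric] ennreal_less_iff)
  also have "\<dots> \<le> (SUP k. content (A k))" by (rule content_UN_incseq_le[OF assms(1) \<theta>(1,2)])
  finally show ?thesis using that by (auto simp: less_SUP_iff)
qed

text \<open>
  The max-flow min-cut theorem on a tree of finite depth, built from the leaves upwards: the flows
  into the children of a cell are added and, if they exceed the weight of the cell, scaled down
  to it. The content obeys the same recursion with \<open>\<le>\<close>, so the flow dominates it.
\<close>
lemma frostman_flow:
  assumes "length q + k = n"
  shows "\<exists>S P. finite S \<and> S \<subseteq> A \<inter> cell q \<and> (\<forall>y\<in>S. 0 \<le> P y) \<and>
     content (A \<inter> cell q) \<le> ennreal (sum P S) \<and>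
     (\<forall>q'. length q' \<le> n \<longrightarrow> sum P (S \<inter> cell q') \<le> \<beta> ^ length q')"
  using assms
proof (induction k arbitrary: q)
  case 0
  show ?case
  proof (cases "A \<inter> cell q = {}")
    case True
    then show ?thesis using beta by (intro exI[of _ "{}"]) auto
  next
    case False
    then obtain y where y: "y \<in> A \<inter> cell q" by blast
    have "sum (\<lambda>_. \<beta> ^ n) ({y} \<inter> cell q') \<le> \<beta> ^ length q'" if "length q' \<le> n" for q'
    proof -
      have "sum (\<lambda>_. \<beta> ^ n) ({y} \<inter> cell q') \<le> \<beta> ^ n"
        using beta by (cases "y \<in> cell q'") auto
      also have "\<dots> \<le> \<beta> ^ length q'" using that beta by (intro power_decreasing) auto
      finally show ?thesis .
    qed
    then show ?thesis
      using y beta content_cell[of A q] 0 by (intro exI[of _ "{y}"] exI[of _ "\<lambda>_. \<beta> ^ n"]) auto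
  qed
next
  case (Suc k)
  define J where "J = range (code (length q))"
  have "finite J" using finite_code by (simp add: J_def)
  have "\<exists>S P. finite S \<and> S \<subseteq> A \<inter> cell (q @ [j]) \<and> (\<forall>y\<in>S. 0 \<le> P y) \<and>
     content (A \<inter> cell (q @ [j])) \<le> ennreal (sum P S) \<and>
     (\<forall>q'. length q' \<le> n \<longrightarrow> sum P (S \<inter> cell q') \<le> \<beta> ^ length q')" for j
    by (rule Suc.IH) (use Suc.prems in simp)
  then obtain S P where S: "\<And>j. finite (S j)" "\<And>j. S j \<subseteq> A \<inter> cell (q @ [j])"
      "\<And>j. \<forall>y\<in>S j. 0 \<le> P j y"
      "\<And>j. content (A \<inter> cell (q @ [j])) \<le> ennreal (sum (P j) (S j))"
      "\<And>j q'. length q' \<le> n \<Longrightarrow> sum (P j) (S j \<inter> cell q') \<le> \<beta> ^ length q'"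
    by metis
  define U where "U = (\<Union>j\<in>J. S j)"
  define R where "R y = P (code (length q) y) y" for y
  have R: "R y = P j y" "y \<in> cell q" "y \<in> A" "code (length q) y = j" if "y \<in> S j" for y j
    using S(2)[of j] that by (auto simp: R_def in_cell_snoc)
  have sum_U: "sum R (U \<inter> X) = (\<Sum>j\<in>J. sum (P j) (S j \<inter> X))" for X
  proof -
    have "U \<inter> X = (\<Union>j\<in>J. S j \<inter> X)" by (auto simp: U_def)
    moreover have "sum R (\<Union>j\<in>J. S j \<inter> X) = (\<Sum>j\<in>J. sum R (S j \<inter> X))"
    proof (rule sum.UNION_disjoint)
      show "\<forall>i\<in>J. \<forall>j\<in>J. i \<noteq> j \<longrightarrow> S i \<inter> X \<inter> (S j \<inter> X) = {}"
        using R(4) by blast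
    qed (use \<open>finite J\<close> S(1) in auto)
    ultimately have "sum R (U \<inter> X) = (\<Sum>j\<in>J. sum R (S j \<inter> X))" by simp
    also have "\<dots> = (\<Sum>j\<in>J. sum (P j) (S j \<inter> X))"
      using R(1) by (intro sum.cong refl) auto
    finally show ?thesis .
  qed
  have nonneg: "\<forall>y\<in>U. 0 \<le> R y" using S(3) R(1) by (auto simp: U_def)
  have finU: "finite U" using \<open>finite J\<close> S(1) by (simp add: U_def)
  have subU: "U \<subseteq> A \<inter> cell q" using R by (auto simp: U_def)
  define total where "total = sum R U"
  have total_nonneg: "0 \<le> total" unfolding total_def using nonneg by (intro sum_nonneg) auto
  have cont: "content (A \<inter> cell q) \<le> ennreal total"
  proof -
    have "content (A \<inter> cell q) \<le> (\<Sum>j\<in>J. content (A \<inter> cell (q @ [j])))"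
      unfolding J_def by (rule content_children)
    also have "\<dots> \<le> (\<Sum>j\<in>J. ennreal (sum (P j) (S j)))" using S(4) by (intro sum_mono)
    also have "\<dots> = ennreal (\<Sum>j\<in>J. sum (P j) (S j))"
      using S(3) by (intro sum_ennreal sum_nonneg) auto
    also have "(\<Sum>j\<in>J. sum (P j) (S j)) = total" using sum_U[of UNIV] by (simp add: total_def)
    finally show ?thesis .
  qed
  have deep: "sum R (U \<inter> cell q') \<le> \<beta> ^ length q'"
    if q': "length q' \<le> n" "length q < length q'" for q'
  proof -
    define i where "i = q' ! length q"
    have "S j \<inter> cell q' = {}" if "j \<noteq> i" for j
    proof -
      have False if y: "y \<in> S j" "y \<in> cell q'" for y
      proof -
        have "pre (length q') y ! length q = q' ! length q" using y(2) by (simp add: in_cell_iff)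
        then have "code (length q) y = i" using q'(2) by (simp add: i_def pre_def)
        with R(4)[OF y(1)] \<open>j \<noteq> i\<close> show False by simp
      qed
      then show ?thesis by blast
    qed
    then have "sum R (U \<inter> cell q') = (\<Sum>j\<in>J. if j = i then sum (P i) (S i \<inter> cell q') else 0)"
      unfolding sum_U by (intro sum.cong) auto
    also have "\<dots> \<le> \<beta> ^ length q'"
      using \<open>finite J\<close> S(5)[OF q'(1)] beta by (simp add: sum.delta)
    finally show ?thesis .
  qed
  \<comment> \<open>The capacity of the edge above the cell is enforced by scaling the flow down when necessary.\<close>
  define sc where "sc = (if total \<le> \<beta> ^ length q then 1 else \<beta> ^ length q / total)"
  have lam: "0 \<le> sc" "sc \<le> 1" "sc * total \<le> \<beta> ^ length q"
  proof -
    have "0 < \<beta> ^ length q" using beta by simp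
    then show "0 \<le> sc" "sc \<le> 1" "sc * total \<le> \<beta> ^ length q"
      using total_nonneg by (auto simp: sc_def divide_le_eq)
  qed
  have lam_cont: "content (A \<inter> cell q) \<le> ennreal (sc * total)"
  proof (cases "total \<le> \<beta> ^ length q")
    case True
    then show ?thesis using cont by (simp add: sc_def)
  next
    case False
    moreover have "0 < \<beta> ^ length q" using beta by simp
    ultimately have "sc * total = \<beta> ^ length q" by (simp add: sc_def)
    then show ?thesis using content_cell[of A q] by simp
  qed
  have "sum (\<lambda>y. sc * R y) (U \<inter> cell q') \<le> \<beta> ^ length q'" if "length q' \<le> n" for q'
  proof -
    have eq: "sum (\<lambda>y. sc * R y) (U \<inter> cell q') = sc * sum R (U \<inter> cell q')"
      by (simp add: sum_distrib_left)
    have nn: "0 \<le> sum R (U \<inter> cell q')" using nonneg by (intro sum_nonneg) auto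
    show ?thesis
    proof (cases "length q < length q'")
      case True
      have "sc * sum R (U \<inter> cell q') \<le> 1 * sum R (U \<inter> cell q')"
        using lam(2) nn by (rule mult_right_mono)
      with deep[OF that True] eq show ?thesis by simp
    next
      case False
      have "sum R (U \<inter> cell q') \<le> total"
        unfolding total_def using finU nonneg by (intro sum_mono2) auto
      then have "sc * sum R (U \<inter> cell q') \<le> sc * total" using lam(1) by (rule mult_left_mono)
      also have "\<dots> \<le> \<beta> ^ length q" by (rule lam(3))
      also have "\<dots> \<le> \<beta> ^ length q'" using False beta by (intro power_decreasing) auto
      finally show ?thesis using eq by simp
    qed
  qed
  moreover have "sum (\<lambda>y. sc * R y) U = sc * total" by (simp add: total_def sum_distrib_left)
  ultimately show ?case
    using finU subU nonneg lam(1) lam_cont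
    by (intro exI[of _ U] exI[of _ "\<lambda>y. sc * R y"]) auto
qed

lemma nth_pre: "i < n \<Longrightarrow> pre n y ! i = code i y"
  by (simp add: pre_def)

lemma card_pre_image_le:
  assumes "\<And>i. i < n \<Longrightarrow> real (card (code i ` X)) \<le> N"
  shows "real (card (pre n ` X)) \<le> N ^ n"
  using assms
proof (induction n)
  case 0
  have "pre 0 ` X \<subseteq> {[]}" by (auto simp: pre_def)
  then have "card (pre 0 ` X) \<le> card {[] :: nat list}" by (intro card_mono) auto
  then show ?case by simp
next
  case (Suc n)
  have fin: "finite (code i ` X)" for i
    using finite_code[of i] by (rule rev_finite_subset) auto
  have fin_pre: "finite (pre m ` X)" for m
  proof (induction m)
    case (Suc m)
    have "pre (Suc m) ` X \<subseteq> (\<lambda>(p, j). p @ [j]) ` (pre m ` X \<times> code m ` X)"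
      by (auto simp: pre_def image_iff)
    with Suc fin show ?case by (meson finite_SigmaI finite_imageI finite_subset)
  qed (rule finite_subset[of _ "{[]}"], auto simp: pre_def)
  have "pre (Suc n) ` X \<subseteq> (\<lambda>(p, j). p @ [j]) ` (pre n ` X \<times> code n ` X)"
    by (auto simp: pre_def image_iff)
  then have "card (pre (Suc n) ` X) \<le> card (pre n ` X \<times> code n ` X)"
    using fin fin_pre by (intro surj_card_le) auto
  then have "real (card (pre (Suc n) ` X)) \<le> real (card (pre n ` X)) * real (card (code n ` X))"
    by (simp add: card_cartesian_product of_nat_mult[symmetric] del: of_nat_mult)
  also have "\<dots> \<le> N ^ n * N"
    using Suc by (intro mult_mono) (auto intro: order_trans[OF of_nat_0_le_iff])
  finally show ?case by (simp add: mult.commute)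
qed

end

section \<open>Frostman measures on analytic sets\<close>

text \<open>
  Pick \<open>\<sigma>\<^sub>n\<close> in the \<open>n\<close>-th box with \<open>f \<sigma>\<^sub>n\<close> close to \<open>y\<close>. In each coordinate all but finitely many of the
  \<open>\<sigma>\<^sub>n\<close> obey the bound \<open>m\<close>, so the whole sequence lies in a compact product of finite sets, and a
  limit point \<open>\<tau>\<close> of it satisfies \<open>f \<tau> = y\<close>.
\<close>
lemma INT_closure_analytic_boxes_subset:
  fixes f :: "(nat \<Rightarrow> nat) \<Rightarrow> 'a::metric_space"
  assumes f: "continuous_on UNIV f"
  shows "(\<Inter>n. closure (f ` {\<sigma>. \<forall>i<n. \<sigma> i \<le> m i})) \<subseteq> range f"
proof
  fix y assume y: "y \<in> (\<Inter>n. closure (f ` {\<sigma>. \<forall>i<n. \<sigma> i \<le> m i}))"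
  have "\<exists>\<sigma>. (\<forall>i<n. \<sigma> i \<le> m i) \<and> dist (f \<sigma>) y < inverse (real (Suc n))" for n
  proof -
    have "y \<in> closure (f ` {\<sigma>. \<forall>i<n. \<sigma> i \<le> m i})" using y by blast
    then have "\<exists>z\<in>f ` {\<sigma>. \<forall>i<n. \<sigma> i \<le> m i}. dist z y < inverse (real (Suc n))"
      unfolding closure_approachable by (rule allE[where x="inverse (real (Suc n))"]) simp
    then show ?thesis by blast
  qed
  then obtain \<sigma> where \<sigma>: "\<And>n i. i < n \<Longrightarrow> \<sigma> n i \<le> m i"
      "\<And>n. dist (f (\<sigma> n)) y < inverse (real (Suc n))"
    by metis
  \<comment> \<open>Only \<open>\<sigma> j\<close> with \<open>j \<le> i\<close> can violate the bound \<open>m i\<close> in coordinate \<open>i\<close>.\<close>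
  define b where "b i = m i + (\<Sum>j\<le>i. \<sigma> j i)" for i
  have in_box: "\<sigma> n i \<le> b i" for n i
  proof (cases "i < n")
    case True
    then show ?thesis using \<sigma>(1) by (simp add: b_def trans_le_add1)
  next
    case False
    then have "\<sigma> n i \<le> (\<Sum>j\<le>i. \<sigma> j i)" by (intro member_le_sum) auto
    then show ?thesis by (simp add: b_def)
  qed
  have "compactin (product_topology (\<lambda>_. euclidean) UNIV) (PiE UNIV (\<lambda>i. {..b i}))"
    unfolding compactin_PiE by (simp add: finite_imp_compact)
  then have "compact (PiE UNIV (\<lambda>i. {..b i}))"
    by (simp add: euclidean_product_topology)
  then have "seq_compact (PiE UNIV (\<lambda>i. {..b i}))"
    by (rule compact_imp_seq_compact)
  moreover have "\<forall>n. \<sigma> n \<in> PiE UNIV (\<lambda>i. {..b i})" using in_box by auto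
  ultimately obtain \<tau> r where r: "strict_mono r" "(\<sigma> \<circ> r) \<longlonglongrightarrow> \<tau>"
    by (rule seq_compactE)
  have lim1: "(\<lambda>n. f (\<sigma> (r n))) \<longlonglongrightarrow> f \<tau>"
    using continuous_on_tendsto_compose[OF f r(2)] by (simp add: comp_def)
  have "(\<lambda>n. dist (f (\<sigma> n)) y) \<longlonglongrightarrow> 0"
    by (rule tendsto_sandwich[OF _ _ tendsto_const LIMSEQ_inverse_real_of_nat])
      (use \<sigma>(2) in \<open>auto intro!: always_eventually less_imp_le\<close>)
  then have "(\<lambda>n. f (\<sigma> n)) \<longlonglongrightarrow> y" by (subst tendsto_dist_iff)
  then have "(\<lambda>n. f (\<sigma> (r n))) \<longlonglongrightarrow> y"
    using LIMSEQ_subseq_LIMSEQ[OF _ r(1), of "\<lambda>n. f (\<sigma> n)"] by (simp add: comp_def)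
  with lim1 have "y = f \<tau>" using LIMSEQ_unique by blast
  then show "y \<in> range f" by simp
qed

context regular_mps
begin

text \<open>
  Every point is labelled by a nearby point of a maximal separated set. A ball of the same scale sees
  a number of labels that is bounded independently of the scale.
\<close>
lemma net_code:
  assumes "0 < \<delta>" "\<delta> \<le> 1"
  shows "\<exists>f :: 'a \<Rightarrow> nat. finite (range f) \<and> (\<forall>y z. f y = f z \<longrightarrow> dist y z \<le> 2 * \<delta>) \<and>
    (\<forall>y. real (card (f ` cball y \<delta>)) \<le> c\<^sup>2 * 6 powr s)"
proof -
  obtain Z :: "'a set" where Z: "finite Z" "separated \<delta> Z" "UNIV \<subseteq> (\<Union>z\<in>Z. cball z \<delta>)"
    by (rule maximal_separated_subset[OF assms, of UNIV])
  have "\<exists>z. z \<in> Z \<and> dist z y \<le> \<delta>" for y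
    using subsetD[OF Z(3), of y] by auto
  then obtain g where g: "\<And>y. g y \<in> Z" "\<And>y. dist (g y) y \<le> \<delta>" by metis
  define f where "f = to_nat_on Z \<circ> g"
  have inj: "inj_on (to_nat_on Z) Z" using Z(1) by (intro inj_on_to_nat_on countable_finite)
  have "finite (range f)"
    using finite_subset[of "range f" "to_nat_on Z ` Z"] Z(1) g(1) by (auto simp: f_def)
  moreover have "dist y z \<le> 2 * \<delta>" if "f y = f z" for y z
  proof -
    have "g y = g z" using inj g(1) that by (auto simp: f_def inj_on_def)
    then have "dist y z \<le> dist (g y) y + dist (g y) z"
      using dist_triangle2[of y z "g y"] by (simp add: dist_commute)
    then show ?thesis using g(2)[of y] g(2)[of z] \<open>g y = g z\<close> by simp
  qed
  moreover have "real (card (f ` cball y \<delta>)) \<le> c\<^sup>2 * 6 powr s" for y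
  proof -
    have sep: "separated \<delta> (Z \<inter> cball y (2 * \<delta>))" using Z(2) by (auto simp: separated_def)
    have card: "real (card (Z \<inter> cball y (2 * \<delta>))) \<le> c\<^sup>2 * (2 * (2 * \<delta> + \<delta>) / \<delta>) powr s"
      using card_separated_le[OF sep, of y "2 * \<delta>"] assms by simp
    have "f ` cball y \<delta> \<subseteq> to_nat_on Z ` (Z \<inter> cball y (2 * \<delta>))"
    proof
      fix i assume "i \<in> f ` cball y \<delta>"
      then obtain z where z: "i = f z" "dist y z \<le> \<delta>" by auto
      have "dist y (g z) \<le> dist y z + dist (g z) z"
        using dist_triangle[of y "g z" z] by (simp add: dist_commute)
      then have "g z \<in> Z \<inter> cball y (2 * \<delta>)" using g[of z] z by simp
      then show "i \<in> to_nat_on Z ` (Z \<inter> cball y (2 * \<delta>))" using z by (auto simp: f_def)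
    qed
    then have "card (f ` cball y \<delta>) \<le> card (Z \<inter> cball y (2 * \<delta>))"
      using Z(1) by (intro surj_card_le) auto
    also note card
    also have "2 * (2 * \<delta> + \<delta>) / \<delta> = 6" using assms by simp
    finally show ?thesis by simp
  qed
  ultimately show ?thesis by blast
qed

text \<open>
  The partitions are taken at the scales \<open>b\<^sup>-\<^sup>i\<close> with the weight \<open>\<beta> = b\<^sup>-\<^sup>t\<close>, independently of each other,
  so a ball of radius \<open>b\<^sup>-\<^sup>j\<close> may meet as many as \<open>N\<^sup>j\<^sup>+\<^sup>1\<close> cells of level \<open>j + 1\<close>. Choosing \<open>b\<close> so large
  that \<open>N \<le> b\<^sup>t\<^sup>-\<^sup>t\<^sup>'\<close> reduces this to a loss from \<open>t\<close> to \<open>t'\<close> in the exponent. For a continuous image of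
  the Baire space the increasing sets lemma bounds one coordinate after the other while the
  content stays above a positive \<open>\<kappa>\<close>; the closures of the resulting images serve as \<open>K\<close>.
\<close>
lemma analytic_frostman:
  assumes "analytic_set G" and pos: "hausdorff_measure t G \<noteq> 0" and t: "0 \<le> t'" "t' < t"
  obtains C K where "1 \<le> C" "\<And>k. closed (K k)" "decseq K" "(\<Inter>k::nat. K k) \<subseteq> G"
    "\<And>k \<delta>. 0 < \<delta> \<Longrightarrow> \<exists>S P. finite S \<and> S \<subseteq> K k \<and> (\<forall>y\<in>S. 0 \<le> P y) \<and> sum P S = 1 \<and>
        (\<forall>(y::'a) r. \<delta> \<le> r \<longrightarrow> sum P (S \<inter> cball y r) \<le> C * r powr t')"
proof -
  define N where "N = c\<^sup>2 * 6 powr s"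
  have "1 * 1 \<le> c\<^sup>2 * 6 powr s"
    using c_ge_1 s_pos by (intro mult_mono) (auto simp: ge_one_powr_ge_zero)
  then have N: "1 \<le> N" by (simp add: N_def)
  \<comment> \<open>The ratio of consecutive scales: a power of \<open>b\<close> with the small exponent \<open>t - t'\<close> absorbs \<open>N\<close>.\<close>
  define b where "b = max 2 (N powr (1 / (t - t')))"
  have b: "2 \<le> b" "N \<le> b powr (t - t')"
  proof -
    have "N = (N powr (1 / (t - t'))) powr (t - t')" using N t by (simp add: powr_powr)
    also have "\<dots> \<le> b powr (t - t')" using t by (intro powr_mono2) (auto simp: b_def)
    finally show "N \<le> b powr (t - t')" .
  qed (simp add: b_def)
  define a where "a = 1 / b"
  have a: "0 < a" "a \<le> 1/2" "a < 1" using b(1) by (auto simp: a_def field_simps)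
  define \<beta> where "\<beta> = a powr t"
  have \<beta>: "0 < \<beta>" "\<beta> < 1" using a t powr_less_mono2[of t a 1] by (auto simp: \<beta>_def)
  have N\<beta>: "N * \<beta> \<le> a powr t'"
  proof -
    have "N * \<beta> \<le> b powr (t - t') * \<beta>" using b(2) \<beta> by (intro mult_right_mono) auto
    also have "\<dots> = a powr t'"
      using b(1) by (simp add: \<beta>_def a_def powr_divide powr_diff field_simps)
    finally show ?thesis .
  qed
  have "\<exists>f :: 'a \<Rightarrow> nat. finite (range f) \<and> (\<forall>y z. f y = f z \<longrightarrow> dist y z \<le> 2 * a ^ i) \<and>
    (\<forall>y. real (card (f ` cball y (a ^ i))) \<le> c\<^sup>2 * 6 powr s)" for i
    using a by (intro net_code) (auto simp: power_le_one)
  then obtain code :: "nat \<Rightarrow> 'a \<Rightarrow> nat" where code: "\<And>i. finite (range (code i))"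
      "\<And>i y z. code i y = code i z \<Longrightarrow> dist y z \<le> 2 * a ^ i"
      "\<And>i y. real (card (code i ` cball y (a ^ i))) \<le> N"
    unfolding N_def[symmetric] by metis
  interpret tree_coding code \<beta> by unfold_locales (use \<beta> code(1) in auto)

  have "content G \<noteq> 0"
  proof
    assume zero: "content G = 0"
    have "hausdorff_measure t G = 0"
    proof (rule hausdorff_nullI)
      fix \<delta> e :: real assume "0 < \<delta>" "0 < e"
      obtain m0 where m0: "a ^ m0 < \<delta> / 2"
        using real_arch_pow_inv[of "\<delta> / 2" a] \<open>0 < \<delta>\<close> a by auto
      \<comment> \<open>A cover cheaper than \<open>\<beta> ^ m0\<close> has only cells of level above \<open>m0\<close>, hence of small diameter.\<close>
      define e' where "e' = min (e / (2 * b) powr t) (\<beta> ^ m0)"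
      have "0 < e'" using \<open>0 < e\<close> \<beta> b(1) by (simp add: e'_def)
      then have "content G < ennreal e'" using zero by simp
      then obtain S where S: "covers S G" "cost S < ennreal e'" by (rule content_lessE)
      have long: "m0 < length p" if "p \<in> S" for p
      proof (rule ccontr)
        assume "\<not> m0 < length p"
        then have "ennreal (\<beta> ^ m0) \<le> ennreal (\<beta> ^ length p)"
          using \<beta> by (intro ennreal_leI power_decreasing) auto
        also have "\<dots> \<le> cost S" using that by (rule cost_ge)
        also have "\<dots> < ennreal e'" by (rule S(2))
        also have "\<dots> \<le> ennreal (\<beta> ^ m0)" by (intro ennreal_leI) (simp add: e'_def)
        finally show False by simp
      qed
      have diam: "diameter (cell p) \<le> 2 * a ^ (length p - 1)" if "p \<in> S" for p
      proof (rule diameter_leI)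
        fix y z assume "y \<in> cell p" "z \<in> cell p"
        then have "pre (length p) y ! (length p - 1) = pre (length p) z ! (length p - 1)"
          by (simp add: in_cell_iff)
        then have "code (length p - 1) y = code (length p - 1) z"
          using long[OF that] by (simp add: nth_pre)
        then show "dist y z \<le> 2 * a ^ (length p - 1)" by (rule code(2))
      qed (use a in simp)
      have bdd: "bounded X" for X :: "'a set"
        using compact_imp_bounded[OF compact_space] by (rule bounded_subset) simp
      have "hausdorff_premeasure t \<delta> G \<le> (\<integral>\<^sup>+p. diam_pow t (cell p) \<partial>count_space S)"
      proof (rule hausdorff_premeasure_le_nn_integral)
        show "G \<subseteq> (\<Union>p\<in>S. cell p)" 
        proof
          fix y assume "y \<in> G"
          then obtain n where "pre n y \<in> S" using S(1) by (auto simp: covers_def)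
          then show "y \<in> (\<Union>p\<in>S. cell p)" by (intro UN_I[of "pre n y"]) auto
        qed
        fix p assume p: "p \<in> S"
        have "a ^ (length p - 1) \<le> a ^ m0" using long[OF p] a by (intro power_decreasing) auto
        then show "bounded (cell p) \<and> diameter (cell p) \<le> \<delta>" using diam[OF p] m0 bdd by auto
      qed (use \<open>0 < \<delta>\<close> in auto)
      also have "\<dots> \<le> (\<integral>\<^sup>+p. ennreal ((2 * b) powr t) * ennreal (\<beta> ^ length p) \<partial>count_space S)"
      proof (rule nn_integral_mono)
        fix p assume "p \<in> space (count_space S)"
        then have p: "p \<in> S" by simp
        then obtain k where k: "length p = Suc k" using long[OF p] by (cases "length p") auto
        have "diameter (cell p) powr t \<le> (2 * a ^ k) powr t"
          using diam[OF p] k t by (intro powr_mono2 diameter_ge_0 bdd) auto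
        also have "2 * a ^ k = (2 * b) * a ^ length p" using b(1) k by (simp add: a_def)
        also have "\<dots> powr t = (2 * b) powr t * (a ^ length p) powr t"
          using b(1) a by (simp add: powr_mult)
        also have "(a ^ length p) powr t = \<beta> ^ length p"
          using a by (simp add: \<beta>_def powr_realpow[symmetric] powr_powr mult.commute)
        finally show "diam_pow t (cell p) \<le> ennreal ((2 * b) powr t) * ennreal (\<beta> ^ length p)"
          using t \<beta> by (simp add: diam_pow_def ennreal_mult[symmetric] ennreal_leI)
      qed
      also have "\<dots> = ennreal ((2 * b) powr t) * cost S" by (simp add: nn_integral_cmult cost_def)
      also have "\<dots> \<le> ennreal ((2 * b) powr t) * ennreal (e / (2 * b) powr t)"
      proof (rule mult_left_mono)
        have "cost S \<le> ennreal e'" using S(2) by simp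
        also have "\<dots> \<le> ennreal (e / (2 * b) powr t)" by (intro ennreal_leI) (simp add: e'_def)
        finally show "cost S \<le> ennreal (e / (2 * b) powr t)" .
      qed simp
      also have "\<dots> = ennreal e" using \<open>0 < e\<close> b(1) by (simp add: ennreal_mult[symmetric])
      finally show "hausdorff_premeasure t \<delta> G \<le> ennreal e" .
    qed
    with pos show False by simp
  qed
  then have "G \<noteq> {}" by auto
  then obtain f :: "(nat \<Rightarrow> nat) \<Rightarrow> 'a" where f: "continuous_on UNIV f" "range f = G"
    using \<open>analytic_set G\<close> by (auto simp: analytic_set_def)
  define \<kappa> where "\<kappa> = enn2real (content G) / 2"
  have G_eq: "content G = ennreal (2 * \<kappa>)"
    using content_finite[of G] by (simp add: \<kappa>_def less_top)
  have "0 < \<kappa>" using \<open>content G \<noteq> 0\<close> G_eq by (cases "0 < \<kappa>") (auto simp: not_less ennreal_neg)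
  have "ennreal (2 * \<kappa>) \<le> 1" using content_le_1[of G] G_eq by simp
  then have "\<kappa> \<le> 1" using \<open>0 < \<kappa>\<close> by simp
  define box where "box ms = {\<sigma> :: nat \<Rightarrow> nat. \<forall>i<length ms. \<sigma> i \<le> ms ! i}" for ms
  define good where "good n ms \<longleftrightarrow> length ms = n \<and> ennreal \<kappa> < content (f ` box ms)" for n and ms :: "nat list"
  have "\<exists>ms. \<forall>n. good n (ms n) \<and> (\<exists>k. ms (Suc n) = ms n @ [k])"
  proof (rule dependent_nat_choice)
    have "box [] = UNIV" by (simp add: box_def)
    then show "\<exists>ms. good 0 ms"
      using f(2) G_eq \<open>0 < \<kappa>\<close> by (auto simp: good_def ennreal_less_iff)
  next
    fix ms n assume ms: "good n ms"
    have box_snoc: "box (ms @ [k]) = {\<sigma> \<in> box ms. \<sigma> n \<le> k}" for k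
      using ms by (auto simp: box_def good_def nth_append less_Suc_eq)
    have "incseq (\<lambda>k. f ` box (ms @ [k]))"
      unfolding box_snoc by (auto simp: incseq_def)
    moreover have "(\<Union>k. f ` box (ms @ [k])) = f ` box ms"
      unfolding box_snoc by auto
    moreover have "ennreal \<kappa> < content (f ` box ms)" using ms by (simp add: good_def)
    ultimately obtain k where "ennreal \<kappa> < content (f ` box (ms @ [k]))"
      by (metis content_incseq)
    then have "good (Suc n) (ms @ [k])"
      using ms by (simp add: good_def)
    then show "\<exists>ms'. good (Suc n) ms' \<and> (\<exists>k. ms' = ms @ [k])"
      by blast
  qed
  then obtain ms where ms: "\<And>n. good n (ms n)" "\<And>n. \<exists>k. ms (Suc n) = ms n @ [k]" by blast
  define m where "m i = ms (Suc i) ! i" for i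
  have ms_nth: "ms n ! i = m i" if "i < n" for i n
    using that
  proof (induction n)
    case (Suc n)
    obtain k where "ms (Suc n) = ms n @ [k]" using ms(2) by blast
    moreover have "length (ms n) = n" using ms(1) by (simp add: good_def)
    ultimately show ?case using Suc by (cases "i = n") (auto simp: m_def nth_append)
  qed simp
  have box_ms: "box (ms n) = {\<sigma>. \<forall>i<n. \<sigma> i \<le> m i}" for n
    using ms(1)[of n] ms_nth by (auto simp: box_def good_def)
  define A where "A n = f ` {\<sigma>. \<forall>i<n. \<sigma> i \<le> m i}" for n
  have A_big: "ennreal \<kappa> < content (A n)" for n
    using ms(1)[of n] by (simp add: good_def box_ms A_def)
  show ?thesis
  proof (rule that[of "1 / \<kappa>" "\<lambda>n. closure (A n)"])
    show "1 \<le> 1 / \<kappa>" using \<open>0 < \<kappa>\<close> \<open>\<kappa> \<le> 1\<close> by simp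
    show "closed (closure (A k))" for k by simp
    show "decseq (\<lambda>n. closure (A n))"
      by (auto simp: decseq_def A_def intro!: closure_mono image_mono)
    show "(\<Inter>k. closure (A k)) \<subseteq> G"
      using INT_closure_analytic_boxes_subset[OF f(1)] f(2) by (simp add: A_def)
    fix k and \<delta> :: real assume "0 < \<delta>"
    obtain n where n: "a ^ n < \<delta>"
      using real_arch_pow_inv[OF \<open>0 < \<delta>\<close> a(3)] by blast
    obtain S P where S: "finite S" "S \<subseteq> A k" "\<forall>y\<in>S. 0 \<le> P y" "content (A k) \<le> ennreal (sum P S)"
        "\<And>q. length q \<le> Suc n \<Longrightarrow> sum P (S \<inter> cell q) \<le> \<beta> ^ length q"
      using frostman_flow[of "[]" "Suc n" "Suc n" "A k"] by auto
    define p where "p = sum P S"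
    have "ennreal \<kappa> < ennreal p" using A_big[of k] S(4) by (simp add: p_def)
    then have "\<kappa> < p" using \<open>0 < \<kappa>\<close> by (simp add: ennreal_less_iff)
    have ball: "sum P (S \<inter> cball y r) \<le> r powr t'" if r: "\<delta> \<le> r" for y r
    proof (cases "1 < r")
      case True
      have "sum P (S \<inter> cball y r) \<le> sum P (S \<inter> cell [])"
        using S(1,3) by (intro sum_mono2) auto
      also have "\<dots> \<le> 1" using S(5)[of "[]"] by simp
      also have "1 \<le> r powr t'" using True t by (intro ge_one_powr_ge_zero) auto
      finally show ?thesis .
    next
      case False
      have "a ^ Suc n \<le> a ^ n" using a by (intro power_decreasing) auto
      then have ex: "\<exists>j. a ^ Suc j < r" using n r by (intro exI[of _ n]) linarith
      \<comment> \<open>The level with \<open>a ^ (j + 1) < r \<le> a ^ j\<close>.\<close>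
      define j where "j = (LEAST j. a ^ Suc j < r)"
      have j1: "a ^ Suc j < r" unfolding j_def using ex by (rule LeastI_ex)
      have j2: "r \<le> a ^ j"
      proof (cases j)
        case 0
        then show ?thesis using False by simp
      next
        case (Suc i)
        then have "i < (LEAST j. a ^ Suc j < r)" by (simp add: j_def)
        then have "\<not> a ^ Suc i < r" by (rule not_less_Least)
        then show ?thesis using Suc by simp
      qed
      have "j \<le> n"
      proof (rule ccontr)
        assume "\<not> j \<le> n"
        then have "a ^ j \<le> a ^ n" using a by (intro power_decreasing) auto
        with j2 n r show False by simp
      qed
      have "sum P (S \<inter> cball y r)
          = (\<Sum>q\<in>pre (Suc j) ` (S \<inter> cball y r). sum P {z \<in> S \<inter> cball y r. pre (Suc j) z = q})"
        using S(1) by (intro sum.image_gen) simp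
      also have "\<dots> \<le> (\<Sum>q\<in>pre (Suc j) ` (S \<inter> cball y r). \<beta> ^ Suc j)"
      proof (rule sum_mono)
        fix q assume "q \<in> pre (Suc j) ` (S \<inter> cball y r)"
        then have q: "length q = Suc j" by auto
        have "sum P {z \<in> S \<inter> cball y r. pre (Suc j) z = q} \<le> sum P (S \<inter> cell q)"
          using S(1,3) q by (intro sum_mono2) (auto simp: cell_def)
        also have "\<dots> \<le> \<beta> ^ Suc j" using S(5)[of q] q \<open>j \<le> n\<close> by simp
        finally show "sum P {z \<in> S \<inter> cball y r. pre (Suc j) z = q} \<le> \<beta> ^ Suc j" .
      qed
      also have "\<dots> = real (card (pre (Suc j) ` (S \<inter> cball y r))) * \<beta> ^ Suc j" by simp
      also have "\<dots> \<le> N ^ Suc j * \<beta> ^ Suc j"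
      proof (intro mult_right_mono card_pre_image_le)
        fix i assume "i < Suc j"
        then have "a ^ j \<le> a ^ i" using a by (intro power_decreasing) auto
        then have "cball y r \<subseteq> cball y (a ^ i)" using j2 by (intro subset_cball) simp
        then have "card (code i ` (S \<inter> cball y r)) \<le> card (code i ` cball y (a ^ i))"
          using finite_subset[OF _ code(1)[of i], of "code i ` cball y (a ^ i)"]
          by (intro card_mono) auto
        then show "real (card (code i ` (S \<inter> cball y r))) \<le> N"
          using code(3)[of i y] by linarith
      qed (use \<beta> in simp)
      also have "\<dots> = (N * \<beta>) ^ Suc j" by (simp only: power_mult_distrib)
      also have "\<dots> \<le> (a powr t') ^ Suc j" using N\<beta> N \<beta> by (intro power_mono) auto
      also have "\<dots> = (a ^ Suc j) powr t'"
        using a by (simp only: powr_realpow[symmetric] powr_gt_zero powr_powr mult.commute)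
      also have "\<dots> \<le> r powr t'" using j1 a t by (intro powr_mono2) auto
      finally show ?thesis .
    qed
    show "\<exists>S P. finite S \<and> S \<subseteq> closure (A k) \<and> (\<forall>y\<in>S. 0 \<le> P y) \<and> sum P S = 1 \<and>
        (\<forall>y r. \<delta> \<le> r \<longrightarrow> sum P (S \<inter> cball y r) \<le> 1 / \<kappa> * r powr t')"
    proof (intro exI conjI allI impI ballI)
      show "finite S" by (rule S(1))
      show "S \<subseteq> closure (A k)" using S(2) closure_subset by blast
      show "0 \<le> P y / p" if "y \<in> S" for y using S(3) that \<open>\<kappa> < p\<close> \<open>0 < \<kappa>\<close> by simp
      show "sum (\<lambda>y. P y / p) S = 1"
        using \<open>\<kappa> < p\<close> \<open>0 < \<kappa>\<close> by (simp add: sum_divide_distrib[symmetric] p_def)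
      fix y r assume "\<delta> \<le> r"
      have "sum (\<lambda>y. P y / p) (S \<inter> cball y r) = sum P (S \<inter> cball y r) / p"
        by (simp add: sum_divide_distrib)
      also have "\<dots> \<le> r powr t' / \<kappa>"
        using ball[OF \<open>\<delta> \<le> r\<close>, of y] \<open>\<kappa> < p\<close> \<open>0 < \<kappa>\<close> by (intro frac_le) auto
      finally show "sum (\<lambda>y. P y / p) (S \<inter> cball y r) \<le> 1 / \<kappa> * r powr t'" by simp
    qed
  qed
qed

end

section \<open>Mixing for functions of the future\<close>

lemma nn_integral_mono_scaled_measure:
  fixes a b :: ennreal
  assumes sets: "sets N = sets M"
    and le: "\<And>F. F \<in> sets M \<Longrightarrow> a * emeasure N F \<le> b * emeasure M F"
    and g: "g \<in> borel_measurable M"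
  shows "a * (\<integral>\<^sup>+x. g x \<partial>N) \<le> b * (\<integral>\<^sup>+x. g x \<partial>M)"
  using g
proof (induction rule: borel_measurable_induct)
  case (cong f g)
  have "(\<integral>\<^sup>+x. f x \<partial>N) = (\<integral>\<^sup>+x. g x \<partial>N)" "(\<integral>\<^sup>+x. f x \<partial>M) = (\<integral>\<^sup>+x. g x \<partial>M)"
    using cong(3) sets_eq_imp_space_eq[OF sets] by (auto intro!: nn_integral_cong)
  with cong show ?case by simp
next
  case (set A)
  then show ?case using le sets by simp
next
  case (mult u c)
  then have "u \<in> borel_measurable N" using measurable_cong_sets[OF sets refl] by blast
  then have "a * (\<integral>\<^sup>+x. c * u x \<partial>N) = c * (a * (\<integral>\<^sup>+x. u x \<partial>N))"
    by (simp add: nn_integral_cmult mult_ac)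
  also have "\<dots> \<le> c * (b * (\<integral>\<^sup>+x. u x \<partial>M))" using mult by (intro mult_left_mono) auto
  also have "\<dots> = b * (\<integral>\<^sup>+x. c * u x \<partial>M)" using mult by (simp add: nn_integral_cmult mult_ac)
  finally show ?case .
next
  case (add u v)
  then have "u \<in> borel_measurable N" "v \<in> borel_measurable N"
    using measurable_cong_sets[OF sets refl] by blast+
  then have "a * (\<integral>\<^sup>+x. v x + u x \<partial>N) = a * (\<integral>\<^sup>+x. v x \<partial>N) + a * (\<integral>\<^sup>+x. u x \<partial>N)"
    by (simp add: nn_integral_add distrib_left)
  also have "\<dots> \<le> b * (\<integral>\<^sup>+x. v x \<partial>M) + b * (\<integral>\<^sup>+x. u x \<partial>M)" using add by (intro add_mono) auto
  also have "\<dots> = b * (\<integral>\<^sup>+x. v x + u x \<partial>M)" using add by (simp add: nn_integral_add distrib_left)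
  finally show ?case .
next
  case (seq U)
  have meas: "U i \<in> borel_measurable N" for i
    using seq(1)[of i] measurable_cong_sets[OF sets refl] by blast
  have "a * (\<integral>\<^sup>+x. (SUP i. U i) x \<partial>N) = (SUP i. a * (\<integral>\<^sup>+x. U i x \<partial>N))"
    using meas seq by (simp add: nn_integral_monotone_convergence_SUP SUP_mult_left_ennreal image_comp)
  also have "\<dots> \<le> (SUP i. b * (\<integral>\<^sup>+x. U i x \<partial>M))"
    using seq by (intro SUP_subset_mono) auto
  also have "\<dots> = b * (\<integral>\<^sup>+x. (SUP i. U i) x \<partial>M)"
    using seq by (simp add: nn_integral_monotone_convergence_SUP SUP_mult_left_ennreal image_comp)
  finally show ?case .
qed

text \<open>
  Exponential mixing with the conditional probability multiplied out, which then includes the null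
  sets \<open>F\<close>.
\<close>
locale mixing_mps = regular_mps M T s c
  for M :: "'a::metric_space measure" and T :: "'a \<Rightarrow> 'a" and s c +
  fixes C \<rho> :: real
  assumes C_pos: "0 < C" and rho: "0 < \<rho>" "\<rho> < 1"
    and mixing: "\<And>n z r F. 1 \<le> n \<Longrightarrow> 0 < r \<Longrightarrow> F \<in> sets M \<Longrightarrow>
      \<bar>measure M (cball z r \<inter> (T ^^ n) -` F) - measure M (cball z r) * measure M F\<bar>
        \<le> C * \<rho> ^ n * measure M F"
begin

text \<open>
  The mixing estimate is a comparison of the measures \<open>F \<mapsto> \<mu>(B \<inter> T\<^sup>-\<^sup>nF)\<close> and \<open>\<mu>\<close>, and therefore
  passes from sets \<open>F\<close> to functions.
\<close>
lemma mixing_nn_integral: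
  assumes n: "1 \<le> n" and r: "0 < r" and g: "g \<in> borel_measurable M"
  shows "(\<integral>\<^sup>+x. indicator (cball z r) x * g ((T ^^ n) x) \<partial>M)
      \<le> ennreal (measure M (cball z r) + C * \<rho> ^ n) * (\<integral>\<^sup>+x. g x \<partial>M)" (is ?upper)
    and "ennreal (measure M (cball z r) - C * \<rho> ^ n) * (\<integral>\<^sup>+x. g x \<partial>M)
      \<le> (\<integral>\<^sup>+x. indicator (cball z r) x * g ((T ^^ n) x) \<partial>M)" (is ?lower)
proof -
  let ?B = "cball z r" and ?e = "C * \<rho> ^ n"
  define N where "N = distr (density M (indicator ?B)) M (T ^^ n)"
  have e: "0 \<le> ?e" using C_pos rho by simp
  have sets_N: "sets N = sets M" by (simp add: N_def)
  have Tn: "T ^^ n \<in> density M (indicator ?B) \<rightarrow>\<^sub>M M" using T_pow_measurable by simp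
  have int_N: "(\<integral>\<^sup>+x. g x \<partial>N) = (\<integral>\<^sup>+x. indicator ?B x * g ((T ^^ n) x) \<partial>M)"
    unfolding N_def using g measurable_compose[OF T_pow_measurable g, of n]
    by (subst nn_integral_distr[OF Tn]) (simp_all add: nn_integral_density)
  have em: "emeasure N F = ennreal (measure M (?B \<inter> (T ^^ n) -` F))" if F: "F \<in> sets M" for F
  proof -
    have F': "(T ^^ n) -` F \<in> sets M" using measurable_sets[OF T_pow_measurable F, of n] by simp
    have "emeasure N F = (\<integral>\<^sup>+x. indicator ?B x * indicator ((T ^^ n) -` F) x \<partial>M)"
      unfolding N_def using F F' by (simp add: emeasure_distr[OF Tn F] emeasure_density)
    also have "\<dots> = (\<integral>\<^sup>+x. indicator (?B \<inter> (T ^^ n) -` F) x \<partial>M)"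
      by (intro nn_integral_cong) (simp add: indicator_inter_arith)
    also have "\<dots> = emeasure M (?B \<inter> (T ^^ n) -` F)" using F' by (intro nn_integral_indicator) auto
    finally show ?thesis by (simp add: emeasure_eq_measure)
  qed
  have "1 * (\<integral>\<^sup>+x. g x \<partial>N) \<le> ennreal (measure M ?B + ?e) * (\<integral>\<^sup>+x. g x \<partial>M)"
  proof (rule nn_integral_mono_scaled_measure[OF sets_N _ g])
    fix F assume F: "F \<in> sets M"
    have "measure M (?B \<inter> (T ^^ n) -` F) \<le> (measure M ?B + ?e) * measure M F"
      using mixing[OF n r F, of z] by (simp add: algebra_simps abs_le_iff)
    then show "1 * emeasure N F \<le> ennreal (measure M ?B + ?e) * emeasure M F"
      using e by (simp add: em[OF F] emeasure_eq_measure ennreal_mult[symmetric] ennreal_leI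
            del: ennreal_plus)
  qed
  then show ?upper by (simp add: int_N)
  show ?lower
  proof (cases "measure M ?B \<le> ?e")
    case True
    then show ?thesis by (simp add: ennreal_neg)
  next
    case False
    have gN: "g \<in> borel_measurable N" using g measurable_cong_sets[OF sets_N refl] by blast
    have "ennreal (measure M ?B - ?e) * (\<integral>\<^sup>+x. g x \<partial>M) \<le> 1 * (\<integral>\<^sup>+x. g x \<partial>N)"
    proof (rule nn_integral_mono_scaled_measure[OF sets_N[symmetric] _ gN])
      fix F assume "F \<in> sets N"
      then have F: "F \<in> sets M" by (simp add: sets_N)
      have "(measure M ?B - ?e) * measure M F \<le> measure M (?B \<inter> (T ^^ n) -` F)"
        using mixing[OF n r F, of z] by (simp add: algebra_simps abs_le_iff)
      then show "ennreal (measure M ?B - ?e) * emeasure M F \<le> 1 * emeasure N F"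
        using False by (simp add: em[OF F] emeasure_eq_measure ennreal_mult[symmetric] ennreal_leI)
    qed
    then show ?thesis by (simp add: int_N)
  qed
qed

text \<open>
  Observables that depend on the orbit from time \<open>q\<close> on. Boundedness and nonnegativity are included
  so that all products and sums of such observables are integrable.
\<close>
definition future :: "nat \<Rightarrow> ('a \<Rightarrow> real) \<Rightarrow> bool" where
  "future q h \<longleftrightarrow> (\<exists>g. g \<in> borel_measurable M \<and> (\<exists>K. \<forall>x. 0 \<le> g x \<and> g x \<le> K) \<and>
     h = (\<lambda>x. g ((T ^^ q) x)))"

lemma futureI:
  assumes "g \<in> borel_measurable M" "\<And>x. 0 \<le> g x" "\<And>x. g x \<le> K" "\<And>x. h x = g ((T ^^ q) x)"
  shows "future q h"
  unfolding future_def using assms by blast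

lemma futureE:
  assumes "future q h"
  obtains g K where "g \<in> borel_measurable M" "\<And>x. 0 \<le> g x" "\<And>x. g x \<le> K" "h = (\<lambda>x. g ((T ^^ q) x))"
  using assms unfolding future_def by blast

lemma future_nonneg: "future q h \<Longrightarrow> 0 \<le> h x"
  by (auto simp: future_def)

lemma future_integrable:
  assumes "future q h"
  shows "integrable M h"
proof -
  obtain g K where g: "g \<in> borel_measurable M" "\<And>x. 0 \<le> g x" "\<And>x. g x \<le> K" "h = (\<lambda>x. g ((T ^^ q) x))"
    using assms by (rule futureE) (rule that)
  have "h \<in> borel_measurable M" unfolding g(4) using measurable_compose[OF T_pow_measurable g(1)] .
  then show ?thesis using g by (intro integrable_const_bound[of _ K]) auto
qed

lemma future_mono:
  assumes "future q h" "m \<le> q"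
  shows "future m h"
proof -
  obtain g K where g: "g \<in> borel_measurable M" "\<And>x. 0 \<le> g x" "\<And>x. g x \<le> K" "h = (\<lambda>x. g ((T ^^ q) x))"
    using assms(1) by (rule futureE) (rule that)
  show ?thesis
  proof (rule futureI[of "\<lambda>x. g ((T ^^ (q - m)) x)" K])
    show "(\<lambda>x. g ((T ^^ (q - m)) x)) \<in> borel_measurable M"
      using measurable_compose[OF T_pow_measurable g(1)] .
    fix x
    have "(T ^^ q) x = (T ^^ (q - m + m)) x" using assms(2) by simp
    then show "h x = g ((T ^^ (q - m)) ((T ^^ m) x))" unfolding funpow_add g(4) by simp
  qed (use g in auto)
qed

lemma future_const: "0 \<le> a \<Longrightarrow> future q (\<lambda>_. a)"
  by (rule futureI[of "\<lambda>_. a" a]) auto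

lemma future_ball: "future n (\<lambda>x. indicator (cball y r) ((T ^^ n) x))"
  by (rule futureI[of "indicator (cball y r)" 1]) auto

lemma future_mult:
  assumes "future q h" "future q k"
  shows "future q (\<lambda>x. h x * k x)"
proof -
  obtain g K where g: "g \<in> borel_measurable M" "\<And>x. 0 \<le> g x" "\<And>x. g x \<le> K" "h = (\<lambda>x. g ((T ^^ q) x))"
    using assms(1) by (rule futureE) (rule that)
  obtain g' K' where g': "g' \<in> borel_measurable M" "\<And>x. 0 \<le> g' x" "\<And>x. g' x \<le> K'" "k = (\<lambda>x. g' ((T ^^ q) x))"
    using assms(2) by (rule futureE) (rule that)
  show ?thesis
  proof (rule futureI[of "\<lambda>x. g x * g' x" "K * K'"])
    show "g x * g' x \<le> K * K'" for x
      using g g' by (intro mult_mono) (auto intro: order_trans)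
  qed (use g g' in auto)
qed

lemma future_sum:
  assumes "\<And>i. i \<in> I \<Longrightarrow> future q (h i)"
  shows "future q (\<lambda>x. \<Sum>i\<in>I. h i x)"
proof -
  have "\<forall>i\<in>I. \<exists>g K. g \<in> borel_measurable M \<and> (\<forall>x. 0 \<le> g x \<and> g x \<le> K) \<and> h i = (\<lambda>x. g ((T ^^ q) x))"
    using assms unfolding future_def by blast
  then obtain g K where g: "\<And>i. i \<in> I \<Longrightarrow> g i \<in> borel_measurable M \<and> (\<forall>x. 0 \<le> g i x \<and> g i x \<le> K i) \<and>
      h i = (\<lambda>x. g i ((T ^^ q) x))"
    by metis
  show ?thesis
    by (rule futureI[of "\<lambda>x. \<Sum>i\<in>I. g i x" "\<Sum>i\<in>I. K i"])
      (use g in \<open>auto intro!: sum_nonneg sum_mono borel_measurable_sum\<close>)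
qed

lemma future_cmult: "0 \<le> a \<Longrightarrow> future q h \<Longrightarrow> future q (\<lambda>x. a * h x)"
  by (intro future_mult future_const)

lemma expectation_shift:
  assumes "g \<in> borel_measurable M"
  shows "(\<integral>x. g ((T ^^ m) x) \<partial>M) = (\<integral>x. (g x :: real) \<partial>M)"
proof -
  have "distr M M (T ^^ m) = M"
  proof (rule measure_eqI)
    fix A assume "A \<in> sets (distr M M (T ^^ m))"
    then show "emeasure (distr M M (T ^^ m)) A = emeasure M A"
      by (simp add: emeasure_distr T_pow_emeasure)
  qed simp
  then show ?thesis using integral_distr[OF T_pow_measurable assms, of m] by simp
qed

text \<open>
  The mixing estimate peels off the earliest visit: the ball is tested at time \<open>m\<close>, and \<open>h\<close> is an
  arbitrary observable of the orbit after a gap of length \<open>L\<close>.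
\<close>
lemma expectation_ball_mult:
  assumes h: "future q h" and mq: "m + L \<le> q" "1 \<le> L" and r: "0 < r"
    and small: "C * \<rho> ^ L \<le> \<eta> * measure M (cball y r)"
  shows "(1 - \<eta>) * measure M (cball y r) * expectation h
      \<le> expectation (\<lambda>x. indicator (cball y r) ((T ^^ m) x) * h x)"
    and "expectation (\<lambda>x. indicator (cball y r) ((T ^^ m) x) * h x)
      \<le> (1 + \<eta>) * measure M (cball y r) * expectation h"
proof -
  let ?B = "cball y r"
  define n where "n = q - m"
  have n: "L \<le> n" "1 \<le> n" "q = n + m" using mq by (auto simp: n_def)
  obtain g K where g: "g \<in> borel_measurable M" "\<And>x. 0 \<le> g x" "\<And>x. g x \<le> K" "h = (\<lambda>x. g ((T ^^ q) x))"
    using h by (rule futureE) (rule that)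
  have gn: "(\<lambda>x. g ((T ^^ n) x)) \<in> borel_measurable M"
    using measurable_compose[OF T_pow_measurable g(1)] .
  have int_g: "integrable M g" using g by (intro integrable_const_bound[of _ K]) auto
  have "expectation h = expectation g"
    unfolding g(4) by (rule expectation_shift[OF g(1)])
  have meas: "(\<lambda>x. indicator ?B x * g ((T ^^ n) x)) \<in> borel_measurable M"
    using gn by measurable
  have int_Bg: "integrable M (\<lambda>x. indicator ?B x * g ((T ^^ n) x))"
    using meas g by (intro integrable_const_bound[of _ K])
      (auto simp: indicator_def intro: order_trans)
  have eq0: "expectation (\<lambda>x. indicator ?B ((T ^^ m) x) * h x)
      = expectation (\<lambda>x. indicator ?B x * g ((T ^^ n) x))"
    using expectation_shift[OF meas, of m] unfolding g(4) n(3) funpow_add by simp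
  have eq1: "ennreal (expectation (\<lambda>x. indicator ?B x * g ((T ^^ n) x)))
      = (\<integral>\<^sup>+x. indicator ?B x * ennreal (g ((T ^^ n) x)) \<partial>M)"
  proof -
    have "(\<integral>\<^sup>+x. indicator ?B x * ennreal (g ((T ^^ n) x)) \<partial>M)
        = (\<integral>\<^sup>+x. ennreal (indicator ?B x * g ((T ^^ n) x)) \<partial>M)"
      by (intro nn_integral_cong) (simp add: indicator_def)
    also have "\<dots> = ennreal (expectation (\<lambda>x. indicator ?B x * g ((T ^^ n) x)))"
      using int_Bg g(2) by (intro nn_integral_eq_integral) auto
    finally show ?thesis by simp
  qed
  have eq2: "(\<integral>\<^sup>+x. ennreal (g x) \<partial>M) = ennreal (expectation g)"
    using int_g g(2) by (intro nn_integral_eq_integral) auto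
  have Eg: "0 \<le> expectation g" using g(2) by (intro integral_nonneg_AE) auto
  have EBg: "0 \<le> expectation (\<lambda>x. indicator ?B x * g ((T ^^ n) x))"
    using g(2) by (intro integral_nonneg_AE) auto
  have gm: "(\<lambda>x. ennreal (g x)) \<in> borel_measurable M" using g(1) by measurable
  have "C * \<rho> ^ n \<le> C * \<rho> ^ L" using n(1) rho C_pos by (intro mult_left_mono power_decreasing) auto
  with small have small': "C * \<rho> ^ n \<le> \<eta> * measure M ?B" by simp
  have "ennreal (expectation (\<lambda>x. indicator ?B x * g ((T ^^ n) x)))
      \<le> ennreal ((measure M ?B + C * \<rho> ^ n) * expectation g)"
    using mixing_nn_integral(1)[OF n(2) r gm, of y] C_pos rho Eg
    by (simp add: eq1 eq2 ennreal_mult del: ennreal_plus)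
  then have "expectation (\<lambda>x. indicator ?B x * g ((T ^^ n) x)) \<le> (measure M ?B + C * \<rho> ^ n) * expectation g"
    using Eg C_pos rho by (subst (asm) ennreal_le_iff) auto
  also have "\<dots> \<le> (1 + \<eta>) * measure M ?B * expectation g"
    using small' Eg by (intro mult_right_mono) (auto simp: algebra_simps)
  finally show "expectation (\<lambda>x. indicator ?B ((T ^^ m) x) * h x)
      \<le> (1 + \<eta>) * measure M ?B * expectation h"
    by (simp only: eq0 \<open>expectation h = expectation g\<close>)
  have "(1 - \<eta>) * measure M ?B * expectation g \<le> (measure M ?B - C * \<rho> ^ n) * expectation g"
    using small' Eg by (intro mult_right_mono) (auto simp: algebra_simps)
  also have "\<dots> \<le> expectation (\<lambda>x. indicator ?B x * g ((T ^^ n) x))"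
  proof (cases "measure M ?B \<le> C * \<rho> ^ n")
    case True
    then have "(measure M ?B - C * \<rho> ^ n) * expectation g \<le> 0"
      using Eg by (intro mult_nonpos_nonneg) auto
    with EBg show ?thesis by linarith
  next
    case False
    then have "ennreal ((measure M ?B - C * \<rho> ^ n) * expectation g)
        \<le> ennreal (expectation (\<lambda>x. indicator ?B x * g ((T ^^ n) x)))"
      using mixing_nn_integral(2)[OF n(2) r gm, of y] Eg by (simp add: eq1 eq2 ennreal_mult)
    then show ?thesis using EBg by (subst (asm) ennreal_le_iff) auto
  qed
  finally show "(1 - \<eta>) * measure M ?B * expectation h
      \<le> expectation (\<lambda>x. indicator ?B ((T ^^ m) x) * h x)"
    by (simp only: eq0 \<open>expectation h = expectation g\<close>)
qed

end

section \<open>Moments of the block densities\<close>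

context mixing_mps
begin

text \<open>
  The frequency of visits to \<open>B(y, r)\<close> at the times in \<open>B\<close>, relative to its expected value.
\<close>
definition block_density :: "nat set \<Rightarrow> real \<Rightarrow> 'a \<Rightarrow> 'a \<Rightarrow> real" where
  "block_density B r y x =
     (\<Sum>n\<in>B. indicator (cball y r) ((T ^^ n) x)) / (real (card B) * measure M (cball y r))"

text \<open>
  A finite set of times between \<open>q\<close> and \<open>q'\<close> with gaps, also towards \<open>q'\<close>, of a length \<open>L\<close> after
  which the mixing error is at most \<open>\<eta>\<close> times the measure of any ball of radius \<open>r\<close>.
\<close>
definition spaced_block :: "nat \<Rightarrow> nat \<Rightarrow> real \<Rightarrow> real \<Rightarrow> nat set \<Rightarrow> bool" where
  "spaced_block q q' r \<eta> B \<longleftrightarrow> finite B \<and> B \<noteq> {} \<and> 0 < r \<and> r \<le> 1 \<and> 0 \<le> \<eta> \<and>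
     (\<exists>L\<ge>1. C * \<rho> ^ L \<le> \<eta> * (r powr s / c) \<and> (\<forall>n\<in>B. q \<le> n \<and> n + L \<le> q') \<and>
        (\<forall>m\<in>B. \<forall>n\<in>B. m < n \<longrightarrow> m + L \<le> n))"

lemma spaced_block_le: "spaced_block q q' r \<eta> B \<Longrightarrow> q \<le> q'"
  by (fastforce simp: spaced_block_def)

lemma measure_cball_pos: "0 < r \<Longrightarrow> r \<le> 1 \<Longrightarrow> 0 < measure M (cball y r)"
  using ball_lower[of r y] c_ge_1 by (smt (verit) divide_pos_pos powr_gt_zero)

lemma block_density_nonneg: "0 \<le> block_density B r y x"
  unfolding block_density_def by (intro divide_nonneg_nonneg sum_nonneg) auto

lemma block_density_posD:
  assumes "block_density B r y x \<noteq> 0"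
  shows "\<exists>n\<in>B. dist y ((T ^^ n) x) \<le> r"
proof (rule ccontr)
  assume "\<not> ?thesis"
  then have "(\<Sum>n\<in>B. indicator (cball y r) ((T ^^ n) x) :: real) = 0"
    by (intro sum.neutral) auto
  with assms show False by (simp add: block_density_def)
qed

lemma future_block_density:
  assumes "spaced_block q q' r \<eta> B"
  shows "future q (block_density B r y)"
proof -
  have "future q (\<lambda>x. inverse (real (card B) * measure M (cball y r)) *
      (\<Sum>n\<in>B. indicator (cball y r) ((T ^^ n) x)))"
    using assms by (intro future_cmult future_sum future_mono[OF future_ball])
      (auto simp: spaced_block_def)
  then show ?thesis by (simp add: block_density_def[abs_def] divide_inverse mult.commute)
qed

lemma block_first_moment:
  assumes B: "spaced_block q q' r \<eta> B" and h: "future q' h"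
  shows "(1 - \<eta>) * expectation h \<le> expectation (\<lambda>x. block_density B r y x * h x)"
    and "expectation (\<lambda>x. block_density B r y x * h x) \<le> (1 + \<eta>) * expectation h"
proof -
  let ?\<mu> = "measure M (cball y r)"
  obtain L where L: "1 \<le> L" "C * \<rho> ^ L \<le> \<eta> * (r powr s / c)" "\<And>n. n \<in> B \<Longrightarrow> n + L \<le> q'"
    using B by (auto simp: spaced_block_def)
  have r: "0 < r" "r \<le> 1" and "finite B" "B \<noteq> {}" and \<eta>: "0 \<le> \<eta>"
    using B by (auto simp: spaced_block_def)
  have \<mu>: "0 < ?\<mu>" using r by (rule measure_cball_pos)
  have card: "0 < real (card B)" using \<open>finite B\<close> \<open>B \<noteq> {}\<close> by (simp add: card_gt_0_iff)
  have small: "C * \<rho> ^ L \<le> \<eta> * ?\<mu>"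
    using L(2) mult_left_mono[OF ball_lower[OF r] \<eta>] by (rule order_trans)
  define e where "e n = expectation (\<lambda>x. indicator (cball y r) ((T ^^ n) x) * h x)" for n
  have int: "integrable M (\<lambda>x. indicator (cball y r) ((T ^^ n) x) * h x)" if "n \<in> B" for n
    using L(3)[OF that] by (intro future_integrable[of n] future_mult future_ball future_mono[OF h]) simp
  have "expectation (\<lambda>x. block_density B r y x * h x)
      = expectation (\<lambda>x. (\<Sum>n\<in>B. indicator (cball y r) ((T ^^ n) x) * h x) / (real (card B) * ?\<mu>))"
    by (simp add: block_density_def sum_distrib_right)
  also have "\<dots> = (\<Sum>n\<in>B. e n) / (real (card B) * ?\<mu>)"
    using int by (simp add: e_def)
  finally have eq: "expectation (\<lambda>x. block_density B r y x * h x) = (\<Sum>n\<in>B. e n) / (real (card B) * ?\<mu>)" .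
  have bounds: "(1 - \<eta>) * ?\<mu> * expectation h \<le> e n" "e n \<le> (1 + \<eta>) * ?\<mu> * expectation h"
    if "n \<in> B" for n
    unfolding e_def using expectation_ball_mult[OF h L(3)[OF that] L(1) r(1) small] by auto
  have "real (card B) * ((1 - \<eta>) * ?\<mu> * expectation h) \<le> (\<Sum>n\<in>B. e n)"
    using bounds(1) by (intro sum_bounded_below) auto
  then show "(1 - \<eta>) * expectation h \<le> expectation (\<lambda>x. block_density B r y x * h x)"
    unfolding eq using card \<mu> by (simp add: pos_le_divide_eq mult_ac)
  have "(\<Sum>n\<in>B. e n) \<le> real (card B) * ((1 + \<eta>) * ?\<mu> * expectation h)"
    using bounds(2) by (intro sum_bounded_above) auto
  then show "expectation (\<lambda>x. block_density B r y x * h x) \<le> (1 + \<eta>) * expectation h"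
    unfolding eq using card \<mu> by (simp add: pos_divide_le_eq mult_ac)
qed

text \<open>
  Pairs of distinct times are treated by \<open>expectation_ball_mult\<close>, applied twice. Equal times contribute
  only when the two balls meet; the diagonal is a fraction \<open>1 / |B|\<close> of all pairs, and each of its terms
  lacks one factor \<open>\<mu>(B(z, r))\<close>.
\<close>
lemma block_second_moment:
  assumes B: "spaced_block q q' r \<eta> B" and h: "future q' h"
  shows "expectation (\<lambda>x. block_density B r y x * block_density B r z x * h x)
    \<le> ((1 + \<eta>)\<^sup>2 + (if dist y z \<le> 2 * r then (1 + \<eta>) * (c / (real (card B) * r powr s)) else 0))
        * expectation h"
proof -
  let ?\<mu> = "\<lambda>y. measure M (cball y r)"
  let ?I = "\<lambda>y n x. indicator (cball y r) ((T ^^ n) x) :: real"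
  let ?E = "expectation h"
  obtain L where L: "1 \<le> L" "C * \<rho> ^ L \<le> \<eta> * (r powr s / c)" "\<And>n. n \<in> B \<Longrightarrow> n + L \<le> q'"
    and gap: "\<And>m n. m \<in> B \<Longrightarrow> n \<in> B \<Longrightarrow> m < n \<Longrightarrow> m + L \<le> n"
    using B unfolding spaced_block_def by auto
  have r: "0 < r" "r \<le> 1" and "finite B" "B \<noteq> {}" and \<eta>: "0 \<le> \<eta>"
    using B by (auto simp: spaced_block_def)
  have \<mu>: "0 < ?\<mu> y" for y using r by (rule measure_cball_pos)
  have card: "0 < real (card B)" using \<open>finite B\<close> \<open>B \<noteq> {}\<close> by (simp add: card_gt_0_iff)
  have small: "C * \<rho> ^ L \<le> \<eta> * ?\<mu> y" for y
    using L(2) mult_left_mono[OF ball_lower[OF r] \<eta>] by (rule order_trans)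
  have E: "0 \<le> ?E" using future_nonneg[OF h] by (intro integral_nonneg_AE) auto
  have fut: "future n (\<lambda>x. ?I y n x * h x)" if "n \<in> B" for n y
    using L(3)[OF that] by (intro future_mult future_ball future_mono[OF h]) simp
  have single: "expectation (\<lambda>x. ?I y n x * h x) \<le> (1 + \<eta>) * ?\<mu> y * ?E" if "n \<in> B" for n y
    using expectation_ball_mult(2)[OF h L(3)[OF that] L(1) r(1) small] .
  define e where "e m n = expectation (\<lambda>x. ?I y m x * ?I z n x * h x)" for m n
  have int: "integrable M (\<lambda>x. ?I y m x * ?I z n x * h x)" if "m \<in> B" "n \<in> B" for m n
    using L(3)[OF that(1)] L(3)[OF that(2)]
    by (intro future_integrable[of "min m n"] future_mult future_mono[OF future_ball] future_mono[OF h]) auto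
  have pair: "expectation (\<lambda>x. ?I a m x * (?I b n x * h x)) \<le> (1 + \<eta>)\<^sup>2 * ?\<mu> a * ?\<mu> b * ?E"
    if "m \<in> B" "n \<in> B" "m < n" for m n a b
  proof -
    have "expectation (\<lambda>x. ?I a m x * (?I b n x * h x))
        \<le> (1 + \<eta>) * ?\<mu> a * expectation (\<lambda>x. ?I b n x * h x)"
      using expectation_ball_mult(2)[OF fut[OF that(2)] gap[OF that] L(1) r(1) small] .
    also have "\<dots> \<le> (1 + \<eta>) * ?\<mu> a * ((1 + \<eta>) * ?\<mu> b * ?E)"
      using single[OF that(2)] \<eta> by (intro mult_left_mono) auto
    finally show ?thesis by (simp add: power2_eq_square mult_ac)
  qed
  \<comment> \<open>The contribution of a diagonal pair of times.\<close>
  define D where "D = (if dist y z \<le> 2 * r then (1 + \<eta>) * ?\<mu> y * ?E else 0)"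
  have D: "0 \<le> D" using E \<eta> by (simp add: D_def)
  have e_bound: "e m n \<le> (1 + \<eta>)\<^sup>2 * ?\<mu> y * ?\<mu> z * ?E + (if m = n then D else 0)"
    if mn: "m \<in> B" "n \<in> B" for m n
  proof -
    have nn: "0 \<le> (1 + \<eta>)\<^sup>2 * ?\<mu> y * ?\<mu> z * ?E" using E by simp
    consider "m < n" | "n < m" | "m = n" by linarith
    then show ?thesis
    proof cases
      case 1
      then show ?thesis using pair[OF mn 1, of y z] by (simp add: e_def mult.assoc)
    next
      case 2
      have "e m n = expectation (\<lambda>x. ?I z n x * (?I y m x * h x))"
        unfolding e_def by (intro arg_cong[where f="integral\<^sup>L M"]) (auto simp: mult_ac)
      then show ?thesis using pair[OF mn(2,1) 2, of z y] 2 by (simp add: mult_ac)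
    next
      case 3
      have "e n n \<le> D"
      proof (cases "dist y z \<le> 2 * r")
        case True
        have "e n n \<le> expectation (\<lambda>x. ?I y n x * h x)"
          unfolding e_def
          by (intro integral_mono int future_integrable[OF fut] mn(2))
            (auto simp: indicator_def future_nonneg[OF h])
        also have "\<dots> \<le> D" using single[OF mn(2), of y] True by (simp add: D_def)
        finally show ?thesis .
      next
        case False
        then have "cball y r \<inter> cball z r = {}" by (intro disjoint_cballI) simp
        then have "(\<lambda>x. ?I y n x * ?I z n x * h x) = (\<lambda>x. 0)"
          by (intro ext) (auto simp: indicator_def)
        then show ?thesis using D by (simp add: e_def)
      qed
      then show ?thesis using 3 nn by simp
    qed
  qed
  have prod_eq: "block_density B r y x * block_density B r z x * h x
      = (\<Sum>m\<in>B. \<Sum>n\<in>B. ?I y m x * ?I z n x * h x) / ((real (card B))\<^sup>2 * ?\<mu> y * ?\<mu> z)" for x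
  proof -
    have "(\<Sum>m\<in>B. \<Sum>n\<in>B. ?I y m x * ?I z n x * h x)
        = (\<Sum>m\<in>B. ?I y m x) * (\<Sum>n\<in>B. ?I z n x) * h x"
      by (subst sum_product) (simp only: sum_distrib_right)
    then show ?thesis by (simp add: block_density_def power2_eq_square mult_ac)
  qed
  have "expectation (\<lambda>x. block_density B r y x * block_density B r z x * h x)
      = (\<Sum>m\<in>B. \<Sum>n\<in>B. e m n) / ((real (card B))\<^sup>2 * ?\<mu> y * ?\<mu> z)"
    unfolding prod_eq using int by (simp add: e_def)
  also have "\<dots> \<le> (\<Sum>m\<in>B. \<Sum>n\<in>B. (1 + \<eta>)\<^sup>2 * ?\<mu> y * ?\<mu> z * ?E + (if m = n then D else 0))
      / ((real (card B))\<^sup>2 * ?\<mu> y * ?\<mu> z)"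
    using e_bound by (intro divide_right_mono sum_mono) auto
  also have "(\<Sum>m\<in>B. \<Sum>n\<in>B. (1 + \<eta>)\<^sup>2 * ?\<mu> y * ?\<mu> z * ?E + (if m = n then D else 0))
      = (real (card B))\<^sup>2 * ((1 + \<eta>)\<^sup>2 * ?\<mu> y * ?\<mu> z * ?E) + real (card B) * D"
    using \<open>finite B\<close> by (simp add: sum.distrib sum.delta power2_eq_square algebra_simps)
  also have "\<dots> / ((real (card B))\<^sup>2 * ?\<mu> y * ?\<mu> z)
      = (1 + \<eta>)\<^sup>2 * ?E + D / (real (card B) * ?\<mu> y * ?\<mu> z)"
    using card \<mu>[of y] \<mu>[of z] by (simp add: field_simps power2_eq_square)
  also have "D / (real (card B) * ?\<mu> y * ?\<mu> z)
      \<le> (if dist y z \<le> 2 * r then (1 + \<eta>) * (c / (real (card B) * r powr s)) else 0) * ?E"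
  proof (cases "dist y z \<le> 2 * r")
    case True
    have "D / (real (card B) * ?\<mu> y * ?\<mu> z) = (1 + \<eta>) * ?E / real (card B) * (1 / ?\<mu> z)"
      using True card \<mu>[of y] \<mu>[of z] by (simp add: D_def field_simps)
    also have "\<dots> \<le> (1 + \<eta>) * ?E / real (card B) * (c / r powr s)"
    proof (rule mult_left_mono)
      have "1 / ?\<mu> z \<le> 1 / (r powr s / c)"
        using ball_lower[OF r, of z] r c_ge_1 \<mu>[of z] by (intro divide_left_mono) auto
      then show "1 / ?\<mu> z \<le> c / r powr s" by simp
    qed (use E \<eta> in simp)
    finally show ?thesis using True by (simp add: field_simps)
  qed (simp add: D_def)
  finally show ?thesis by (simp add: distrib_right)
qed

definition block_product :: "(nat \<Rightarrow> nat set) \<Rightarrow> (nat \<Rightarrow> real) \<Rightarrow> nat \<Rightarrow> nat \<Rightarrow> 'a \<Rightarrow> 'a \<Rightarrow> real" where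
  "block_product B r i k y x = (\<Prod>j\<in>{i..<k}. block_density (B j) (r j) y x)"

lemma block_product_nonneg: "0 \<le> block_product B r i k y x"
  unfolding block_product_def by (intro prod_nonneg) (auto intro: block_density_nonneg)

text \<open>
  Consecutive blocks are separated by the gap inside \<open>spaced_block\<close>, so the blocks can be peeled off
  from the earliest one on, the remaining ones being an observable of the future.
\<close>
lemma block_product_moments:
  assumes B: "\<And>j. spaced_block (q j) (q (Suc j)) (r j) (\<eta> j) (B j)"
    and \<eta>: "\<And>j. \<eta> j \<le> 1" and "i \<le> k"
  shows "future (q i) (block_product B r i k y)"
    and "(\<Prod>j\<in>{i..<k}. 1 - \<eta> j) \<le> expectation (block_product B r i k y)"
    and "expectation (\<lambda>x. block_product B r i k y x * block_product B r i k z x) \<le>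
      (\<Prod>j\<in>{i..<k}. (1 + \<eta> j)\<^sup>2 +
        (if dist y z \<le> 2 * r j then (1 + \<eta> j) * (c / (real (card (B j)) * r j powr s)) else 0))"
proof -
  let ?b = "\<lambda>j. (1 + \<eta> j)\<^sup>2 +
        (if dist y z \<le> 2 * r j then (1 + \<eta> j) * (c / (real (card (B j)) * r j powr s)) else 0)"
  have b_nonneg: "0 \<le> ?b j" for j
    using B[of j] c_ge_1 by (auto simp: spaced_block_def intro!: add_nonneg_nonneg)
  have step: "{i..<k} = insert i {Suc i..<k}" if "i < k" for i using that by auto
  have "(\<forall>y. future (q i) (block_product B r i k y)) \<and>
    (\<Prod>j\<in>{i..<k}. 1 - \<eta> j) \<le> expectation (block_product B r i k y) \<and>
    expectation (\<lambda>x. block_product B r i k y x * block_product B r i k z x) \<le> (\<Prod>j\<in>{i..<k}. ?b j)"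
    using \<open>i \<le> k\<close>
  proof (induction i rule: inc_induct)
    case base
    then show ?case using prob_space by (simp add: block_product_def future_const)
  next
    case (step i)
    have eq: "block_product B r i k y x = block_density (B i) (r i) y x * block_product B r (Suc i) k y x" for y x
      using \<open>i < k\<close> by (simp add: block_product_def prod.atLeast_Suc_lessThan)
    have fut: "future (q (Suc i)) (block_product B r (Suc i) k y)" for y using step.IH by blast
    have fut2: "future (q (Suc i)) (\<lambda>x. block_product B r (Suc i) k y x * block_product B r (Suc i) k z x)"
      by (intro future_mult fut)
    have "future (q i) (\<lambda>x. block_density (B i) (r i) y x * block_product B r (Suc i) k y x)" for y
      by (intro future_mult future_block_density[OF B] future_mono[OF fut spaced_block_le[OF B]])
    then have "future (q i) (block_product B r i k y)" for y by (simp add: eq[abs_def])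
    moreover have "(\<Prod>j\<in>{i..<k}. 1 - \<eta> j) \<le> expectation (block_product B r i k y)"
    proof -
      have "(\<Prod>j\<in>{i..<k}. 1 - \<eta> j) = (1 - \<eta> i) * (\<Prod>j\<in>{Suc i..<k}. 1 - \<eta> j)"
        using \<open>i < k\<close> by (simp add: prod.atLeast_Suc_lessThan)
      also have "\<dots> \<le> (1 - \<eta> i) * expectation (block_product B r (Suc i) k y)"
        using step.IH \<eta>[of i] by (intro mult_left_mono) auto
      also have "\<dots> \<le> expectation (block_product B r i k y)"
        using block_first_moment(1)[OF B fut] by (simp add: eq[abs_def])
      finally show ?thesis .
    qed
    moreover have "expectation (\<lambda>x. block_product B r i k y x * block_product B r i k z x) \<le> (\<Prod>j\<in>{i..<k}. ?b j)"
    proof -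
      have "expectation (\<lambda>x. block_product B r i k y x * block_product B r i k z x)
          = expectation (\<lambda>x. block_density (B i) (r i) y x * block_density (B i) (r i) z x *
              (block_product B r (Suc i) k y x * block_product B r (Suc i) k z x))"
        by (simp add: eq mult_ac)
      also have "\<dots> \<le> ?b i * expectation (\<lambda>x. block_product B r (Suc i) k y x * block_product B r (Suc i) k z x)"
        by (rule block_second_moment[OF B fut2])
      also have "\<dots> \<le> ?b i * (\<Prod>j\<in>{Suc i..<k}. ?b j)"
        using step.IH b_nonneg by (intro mult_left_mono) auto
      also have "\<dots> = (\<Prod>j\<in>{i..<k}. ?b j)"
        using \<open>i < k\<close> by (simp add: prod.atLeast_Suc_lessThan)
      finally show ?thesis .
    qed
    ultimately show ?case by blast
  qed
  then show "future (q i) (block_product B r i k y)"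
    and "(\<Prod>j\<in>{i..<k}. 1 - \<eta> j) \<le> expectation (block_product B r i k y)"
    and "expectation (\<lambda>x. block_product B r i k y x * block_product B r i k z x) \<le> (\<Prod>j\<in>{i..<k}. ?b j)"
    by blast+
qed

end

section \<open>The choice of the blocks\<close>

text \<open>
  If for all large \<open>j\<close> fewer than \<open>2\<^sup>j\<^sup>b\<close> terms were at least \<open>2\<^sup>-\<^sup>j\<close>, grouping the terms by dyadic
  size would bound the series by a geometric one of ratio \<open>2\<^sup>b\<^sup>-\<^sup>a\<close>.
\<close>
lemma not_summable_imp_many_large_terms:
  fixes l :: "nat \<Rightarrow> real"
  assumes pos: "\<And>n. n \<ge> 1 \<Longrightarrow> 0 < l n" and lim: "l \<longlonglongrightarrow> 0"
    and div: "\<not> summable (\<lambda>n. l (Suc n) powr a)" and "b < a" "0 \<le> a"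
  shows "\<exists>j\<ge>J. \<exists>A. finite A \<and> (\<forall>n\<in>A. q \<le> n \<and> (1/2) ^ j \<le> l n) \<and> 2 powr (real j * b) \<le> real (card A)"
proof (rule ccontr)
  assume neg: "\<not> ?thesis"
  have few: "real (card A) < 2 powr (real j * b)"
    if "J \<le> j" "finite A" "\<And>n. n \<in> A \<Longrightarrow> q \<le> n \<and> (1/2) ^ j \<le> l n" for j A
    using neg that by (meson not_le)
  have "\<forall>\<^sub>F n in sequentially. l n < (1/2) ^ J"
    by (intro order_tendstoD(2)[OF lim]) simp
  then obtain n2 where n2: "\<And>n. n \<ge> n2 \<Longrightarrow> l n < (1/2) ^ J"
    unfolding eventually_sequentially by blast
  define n1 where "n1 = max n2 (max q 1)"
  have n1: "l n < (1/2) ^ J" "q \<le> n" "0 < l n" if "n1 \<le> n" for n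
    using that n2[of n] pos[of n] by (auto simp: n1_def)
  define i where "i n = (LEAST j. (1/2) ^ j \<le> l n)" for n
  have i: "(1/2) ^ i n \<le> l n" "l n powr a \<le> 2 powr a * 2 powr (- (real (i n) * a))" "J \<le> i n"
    if n: "n1 \<le> n" for n
  proof -
    obtain j where "(1/2) ^ j < l n" using real_arch_pow_inv[OF n1(3)[OF n], of "1/2"] by auto
    then have ex: "\<exists>j. (1/2) ^ j \<le> l n" by (intro exI[of _ j]) simp
    show 1: "(1/2) ^ i n \<le> l n" unfolding i_def using ex by (rule LeastI_ex)
    show J: "J \<le> i n"
    proof (rule ccontr)
      assume "\<not> J \<le> i n"
      then have "(1/2 :: real) ^ J \<le> (1/2) ^ i n" by (intro power_decreasing) auto
      with 1 n1(1)[OF n] show False by simp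
    qed
    have "l n \<le> 2 * (1/2) ^ i n"
    proof (cases "i n")
      case 0
      have "l n < (1/2) ^ J" by (rule n1(1)[OF n])
      also have "\<dots> \<le> 1" by (simp add: power_le_one)
      finally show ?thesis using 0 by simp
    next
      case (Suc m)
      then have "\<not> (1/2) ^ m \<le> l n" unfolding i_def by (intro not_less_Least) simp
      then show ?thesis using Suc by simp
    qed
    then have "l n powr a \<le> (2 * (1/2) ^ i n) powr a"
      using n1(3)[OF n] \<open>0 \<le> a\<close> by (intro powr_mono2) auto
    also have "\<dots> = 2 powr a * 2 powr (- (real (i n) * a))"
      by (simp add: powr_mult powr_realpow[symmetric] powr_powr powr_minus powr_divide field_simps)
    finally show "l n powr a \<le> 2 powr a * 2 powr (- (real (i n) * a))" .
  qed
  define x where "x = 2 powr (b - a)"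
  have x: "0 < x" "x < 1" using \<open>b < a\<close> by (auto simp: x_def powr_less_one)
  have bound: "(\<Sum>n<N. l (n + n1) powr a) \<le> 2 powr a / (1 - x)" for N
  proof -
    define F where "F = {n1..<N + n1}"
    define m where "m = Suc (\<Sum>n\<in>F. i n)"
    have "(\<Sum>n<N. l (n + n1) powr a) = (\<Sum>n\<in>F. l n powr a)"
      unfolding F_def by (rule sum.reindex_bij_witness[of _ "\<lambda>n. n - n1" "\<lambda>n. n + n1"]) auto
    also have "\<dots> \<le> (\<Sum>n\<in>F. \<Sum>j\<in>{J..<m}. if (1/2) ^ j \<le> l n then 2 powr a * 2 powr (- (real j * a)) else 0)"
    proof (rule sum_mono)
      fix n assume "n \<in> F"
      then have n: "n1 \<le> n" by (simp add: F_def)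
      have "i n \<le> (\<Sum>n\<in>F. i n)" using \<open>n \<in> F\<close> by (intro member_le_sum) (auto simp: F_def)
      then have mem: "i n \<in> {J..<m}" using i(3)[OF n] by (simp add: m_def)
      have "l n powr a \<le> (if (1/2) ^ i n \<le> l n then 2 powr a * 2 powr (- (real (i n) * a)) else 0)"
        using i[OF n] by simp
      also have "\<dots> \<le> (\<Sum>j\<in>{J..<m}. if (1/2) ^ j \<le> l n then 2 powr a * 2 powr (- (real j * a)) else 0)"
        using mem by (intro member_le_sum) auto
      finally show "l n powr a \<le> \<dots>" .
    qed
    also have "\<dots> = (\<Sum>j\<in>{J..<m}. \<Sum>n\<in>F. if (1/2) ^ j \<le> l n then 2 powr a * 2 powr (- (real j * a)) else 0)"
      by (rule sum.swap)
    also have "\<dots> = (\<Sum>j\<in>{J..<m}. real (card {n \<in> F. (1/2) ^ j \<le> l n}) * (2 powr a * 2 powr (- (real j * a))))"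
      by (intro sum.cong refl) (simp add: sum.If_cases F_def Int_def)
    also have "\<dots> \<le> (\<Sum>j\<in>{J..<m}. 2 powr a * x ^ j)"
    proof (rule sum_mono)
      fix j assume "j \<in> {J..<m}"
      then have "real (card {n \<in> F. (1/2) ^ j \<le> l n}) \<le> 2 powr (real j * b)"
        using n1(2) by (intro less_imp_le[OF few]) (auto simp: F_def)
      then have "real (card {n \<in> F. (1/2) ^ j \<le> l n}) * (2 powr a * 2 powr (- (real j * a)))
          \<le> 2 powr (real j * b) * (2 powr a * 2 powr (- (real j * a)))"
        by (intro mult_right_mono) auto
      also have "\<dots> = 2 powr a * 2 powr (real j * b + - (real j * a))"
        by (subst powr_add) (simp only: mult_ac)
      also have "2 powr (real j * b + - (real j * a)) = x ^ j"
        using x(1) by (simp add: x_def powr_realpow[symmetric] powr_powr algebra_simps)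
      finally show "real (card {n \<in> F. (1/2) ^ j \<le> l n}) * (2 powr a * 2 powr (- (real j * a)))
          \<le> 2 powr a * x ^ j" .
    qed
    also have "\<dots> = 2 powr a * (\<Sum>j\<in>{J..<m}. x ^ j)" by (simp add: sum_distrib_left)
    also have "(\<Sum>j\<in>{J..<m}. x ^ j) \<le> (\<Sum>j. x ^ j)"
      using x by (intro sum_le_suminf summable_geometric) auto
    also have "(\<Sum>j. x ^ j) = 1 / (1 - x)" using x by (intro suminf_geometric) auto
    finally show ?thesis by simp
  qed
  then have "summable (\<lambda>n. l (n + n1) powr a)"
    by (intro summableI_nonneg_bounded) auto
  then have "summable (\<lambda>n. l n powr a)"
    using summable_iff_shift[of "\<lambda>n. l n powr a" n1] by simp
  then have "summable (\<lambda>n. l (Suc n) powr a)" by (subst summable_Suc_iff)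
  with div show False by simp
qed

text \<open>
  Distinct numbers in one residue class modulo \<open>L\<close> differ by at least \<open>L\<close>, and some class has at least
  the average size.
\<close>
lemma thin_by_residue:
  assumes "finite A" "1 \<le> L"
  obtains B where "B \<subseteq> A" "\<forall>m\<in>B. \<forall>n\<in>B. m < n \<longrightarrow> m + L \<le> n" "card A \<le> L * card B"
proof -
  define R where "R i = {n \<in> A. n mod L = i}" for i
  have A: "A = (\<Union>i<L. R i)" using \<open>1 \<le> L\<close> by (auto simp: R_def)
  have "card A \<le> (\<Sum>i<L. card (R i))"
    by (subst A) (rule card_UN_le, simp)
  have "\<exists>i<L. card A \<le> L * card (R i)"
  proof (rule ccontr)
    assume "\<not> ?thesis"
    then have "(\<Sum>i<L. L * card (R i)) < (\<Sum>i<L. card A)"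
      using \<open>1 \<le> L\<close> by (intro sum_strict_mono) (auto simp: not_le lessThan_empty_iff)
    then have "L * (\<Sum>i<L. card (R i)) < L * card A" by (simp add: sum_distrib_left)
    with \<open>card A \<le> (\<Sum>i<L. card (R i))\<close> show False by simp
  qed
  then obtain i where i: "card A \<le> L * card (R i)" by blast
  have "m + L \<le> n" if "m \<in> R i" "n \<in> R i" "m < n" for m n
  proof -
    have "n mod L = m mod L" using that by (simp add: R_def)
    then have "L dvd n - m" using that(3) by (simp add: mod_eq_dvd_iff_nat)
    then have "L \<le> n - m" using that(3) by (intro dvd_imp_le) auto
    then show ?thesis using that(3) by simp
  qed
  with i that[of "R i"] show ?thesis by (auto simp: R_def)
qed

context mixing_mps
begin

text \<open>
  At scale \<open>r = 2\<^sup>-\<^sup>j\<close> the required gap grows only linearly in \<open>j\<close>, so thinning to it costs less than any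
  power of \<open>r\<close>.
\<close>
lemma spaced_block_exists:
  assumes pos: "\<And>n. n \<ge> 1 \<Longrightarrow> 0 < l n" and lim: "l \<longlonglongrightarrow> 0"
    and div: "\<not> summable (\<lambda>n. l (Suc n) powr a)" and a': "a' < a" "0 \<le> a"
    and \<eta>: "0 < \<eta>" and R: "0 < R"
  shows "\<exists>r B q'. spaced_block q q' r \<eta> B \<and> r < R \<and> (\<forall>n\<in>B. r \<le> l n) \<and> r powr (- a') \<le> real (card B)"
proof -
  obtain K where K: "\<rho> ^ K < 2 powr (- s)"
    using real_arch_pow_inv[of "2 powr (- s)" \<rho>] rho by auto
  obtain L1 where L1: "\<rho> ^ L1 < \<eta> / c / C"
    using real_arch_pow_inv[of "\<eta> / c / C" \<rho>] rho \<eta> c_ge_1 C_pos by auto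
  define L0 where "L0 = Suc L1"
  have "\<rho> ^ L0 \<le> \<rho> ^ L1" using rho unfolding L0_def by (intro power_decreasing) auto
  then have "C * \<rho> ^ L0 \<le> C * (\<eta> / c / C)"
    using L1 C_pos by (intro mult_left_mono) auto
  then have L0: "C * \<rho> ^ L0 \<le> \<eta> / c" using C_pos by simp
  define b where "b = (a' + a) / 2"
  have b: "a' < b" "b < a" using a' by (auto simp: b_def)
  define x where "x = 2 powr (a' - b)"
  have x: "0 < x" "x < 1" using b by (auto simp: x_def powr_less_one)
  have "(\<lambda>j. real L0 * x ^ j + real K * (real j * x ^ j)) \<longlonglongrightarrow> real L0 * 0 + real K * 0"
    using x by (intro tendsto_intros LIMSEQ_realpow_zero powser_times_n_limit_0) auto
  then have "\<forall>\<^sub>F j in sequentially. real L0 * x ^ j + real K * (real j * x ^ j) < 1"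
    by (rule order_tendstoD) simp
  moreover have "\<forall>\<^sub>F j in sequentially. (1/2 :: real) ^ j < R"
    using R by (intro order_tendstoD(2)[OF LIMSEQ_realpow_zero]) auto
  ultimately have "\<forall>\<^sub>F j in sequentially. real L0 * x ^ j + real K * (real j * x ^ j) < 1 \<and> (1/2 :: real) ^ j < R"
    by (rule eventually_conj)
  then obtain J where J: "\<And>j. j \<ge> J \<Longrightarrow> real L0 * x ^ j + real K * (real j * x ^ j) < 1 \<and> (1/2 :: real) ^ j < R"
    unfolding eventually_sequentially by blast
  obtain j A where "J \<le> j" and A: "finite A" "\<forall>n\<in>A. q \<le> n \<and> (1/2) ^ j \<le> l n"
      "2 powr (real j * b) \<le> real (card A)"
    using not_summable_imp_many_large_terms[OF pos lim div b(2) a'(2), of J q] by blast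
  define r :: real where "r = (1/2) ^ j"
  define L where "L = L0 + K * j"
  have "1 \<le> L" by (simp add: L_def L0_def)
  obtain B where B: "B \<subseteq> A" "\<forall>m\<in>B. \<forall>n\<in>B. m < n \<longrightarrow> m + L \<le> n" "card A \<le> L * card B"
    using thin_by_residue[OF A(1) \<open>1 \<le> L\<close>] by blast
  have "finite B" using B(1) A(1) by (rule finite_subset)
  have Lx: "real L * x ^ j < 1" using J[OF \<open>J \<le> j\<close>] by (simp add: L_def algebra_simps)
  have "0 < real L" using \<open>1 \<le> L\<close> by simp
  have card_B: "r powr (- a') \<le> real (card B)"
  proof -
    have "r powr (- a') = 2 powr (real j * a')"
      by (simp add: r_def powr_realpow[symmetric] powr_powr powr_divide powr_minus field_simps)
    also have "\<dots> = 2 powr (real j * b) * x ^ j"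
      using x(1) by (simp add: x_def powr_realpow[symmetric] powr_powr powr_add[symmetric] algebra_simps)
    also have "\<dots> \<le> 2 powr (real j * b) * (1 / real L)"
      using Lx \<open>0 < real L\<close> by (intro mult_left_mono) (auto simp: field_simps)
    also have "\<dots> \<le> real (L * card B) * (1 / real L)"
      using order_trans[OF A(3) of_nat_mono[OF B(3)]] by (intro mult_right_mono) auto
    also have "\<dots> = real (card B)" using \<open>0 < real L\<close> by simp
    finally show ?thesis .
  qed
  have r: "0 < r" "r \<le> 1" by (auto simp: r_def power_le_one)
  have "B \<noteq> {}"
  proof
    assume "B = {}"
    with card_B r show False by simp
  qed
  have L_small: "C * \<rho> ^ L \<le> \<eta> * (r powr s / c)"
  proof -
    have "C * \<rho> ^ L = C * \<rho> ^ L0 * (\<rho> ^ K) ^ j" by (simp add: L_def power_add power_mult)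
    also have "\<dots> \<le> \<eta> / c * (2 powr (- s)) ^ j"
      using L0 K rho C_pos \<eta> c_ge_1 by (intro mult_mono power_mono) auto
    also have "(2 powr (- s)) ^ j = r powr s"
      by (simp add: r_def powr_realpow[symmetric] powr_powr powr_divide powr_minus field_simps)
    finally show ?thesis by simp
  qed
  have "spaced_block q (Max B + L) r \<eta> B"
    unfolding spaced_block_def
  proof (intro conjI exI[of _ L] ballI)
    fix n assume "n \<in> B"
    then show "q \<le> n" "n + L \<le> Max B + L" using A(2) B(1) \<open>finite B\<close> by auto
  qed (use \<open>finite B\<close> \<open>B \<noteq> {}\<close> r \<eta> \<open>1 \<le> L\<close> L_small B(2) in auto)
  moreover have "\<forall>n\<in>B. r \<le> l n" using A(2) B(1) by (auto simp: r_def)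
  moreover have "r < R" using J[OF \<open>J \<le> j\<close>] by (simp add: r_def)
  ultimately show ?thesis using card_B by blast
qed

text \<open>
  Bounds the excess correlation of a block density at two points whose balls overlap.
\<close>
abbreviation overlap :: "nat set \<Rightarrow> real \<Rightarrow> real" where
  "overlap B r \<equiv> c / (real (card B) * r powr s)"

text \<open>
  The scales are chosen one after the other. For \<open>a'\<close> just below \<open>a\<close>, \<open>overlap\<close> is at most \<open>c r\<^sup>a\<^sup>'\<^sup>-\<^sup>s\<close>
  and \<open>\<tau> + a' - s > 0\<close>, so that \<open>r\<^sup>\<tau> overlap\<close> tends to \<open>0\<close> with \<open>r\<close>; at each step a small enough \<open>r\<close> also beats the
  product of all previous factors.
\<close>
lemma block_sequence_exists:
  assumes pos: "\<And>n. n \<ge> 1 \<Longrightarrow> 0 < l n" and lim: "l \<longlonglongrightarrow> 0"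
    and div: "\<not> summable (\<lambda>n. l (Suc n) powr a)" and a: "0 \<le> a" "s - a < \<tau>"
    and \<sigma>: "0 < \<sigma>" and K: "0 < K"
  obtains q r B where
    "\<And>j. spaced_block (q j) (q (Suc j)) (r j) (\<sigma> * (1/2) ^ Suc j) (B j)"
    "\<And>j. r j \<le> 1/2" "\<And>j n. n \<in> B j \<Longrightarrow> r j \<le> l n"
    "\<And>j. K * (2 * r j) powr \<tau> * overlap (B j) (r j) * (\<Prod>i<j. 1 + overlap (B i) (r i)) \<le> \<sigma> * (1/2) ^ Suc j"
proof -
  define a' where "a' = (a + s - \<tau>) / 2"
  have a': "a' < a" "s - a' < \<tau>" using a by (auto simp: a'_def field_simps)
  define \<gamma> where "\<gamma> = \<tau> + a' - s"
  have \<gamma>: "0 < \<gamma>" using a' by (simp add: \<gamma>_def)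
  have step: "\<exists>r B q'. spaced_block q q' r (\<sigma> * (1/2) ^ Suc j) B \<and> r \<le> 1/2 \<and> (\<forall>n\<in>B. r \<le> l n) \<and>
      K * (2 * r) powr \<tau> * overlap B r * pr \<le> \<sigma> * (1/2) ^ Suc j" if pr: "0 < pr" for q j pr
  proof -
    define \<epsilon> where "\<epsilon> = \<sigma> * (1/2) ^ Suc j"
    have \<epsilon>: "0 < \<epsilon>" using \<sigma> by (simp add: \<epsilon>_def)
    define Q where "Q = K * 2 powr \<tau> * c * pr"
    have Q: "0 < Q" using K c_ge_1 pr by (simp add: Q_def)
    define R where "R = min (1/2) ((\<epsilon> / Q) powr (1 / \<gamma>))"
    have "0 < R" using \<epsilon> Q by (simp add: R_def)
    obtain r B q' where B: "spaced_block q q' r \<epsilon> B" "r < R" "\<forall>n\<in>B. r \<le> l n"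
        "r powr (- a') \<le> real (card B)"
      using spaced_block_exists[OF pos lim div a'(1) a(1) \<epsilon> \<open>0 < R\<close>] by blast
    have r: "0 < r" using B(1) by (simp add: spaced_block_def)
    have "overlap B r \<le> c / (r powr (- a') * r powr s)"
      using B(4) r c_ge_1 by (intro divide_left_mono mult_right_mono) (auto intro!: mult_pos_pos less_le_trans[OF _ B(4)])
    also have "\<dots> = c * r powr (a' - s)"
      using r by (simp add: powr_minus powr_diff field_simps)
    finally have "K * (2 * r) powr \<tau> * overlap B r * pr \<le> K * (2 * r) powr \<tau> * (c * r powr (a' - s)) * pr"
      using K pr by (intro mult_right_mono mult_left_mono) auto
    also have "\<dots> = Q * (r powr \<tau> * r powr (a' - s))"
      using r by (simp add: Q_def powr_mult mult_ac)
    also have "r powr \<tau> * r powr (a' - s) = r powr \<gamma>"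
      by (simp add: powr_add[symmetric] \<gamma>_def algebra_simps)
    also have "Q * r powr \<gamma> \<le> Q * ((\<epsilon> / Q) powr (1 / \<gamma>)) powr \<gamma>"
      using Q r B(2) \<gamma> by (intro mult_left_mono powr_mono2) (auto simp: R_def)
    also have "\<dots> = \<epsilon>" using Q \<epsilon> \<gamma> by (simp add: powr_powr)
    finally have "K * (2 * r) powr \<tau> * overlap B r * pr \<le> \<epsilon>" .
    moreover have "r \<le> 1/2" using B(2) by (simp add: R_def)
    ultimately show ?thesis using B(1,3) unfolding \<epsilon>_def by blast
  qed
  \<comment> \<open>A state records the start \<open>q\<close> and end \<open>q'\<close> of a block, its scale \<open>r\<close> and times \<open>B\<close>, and the
    product \<open>pr\<close> of the factors \<open>1 + overlap\<close> of the previous blocks.\<close>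
  define ok where "ok j x \<longleftrightarrow> (case x of (q, pr, r, B, q') \<Rightarrow> 0 < pr \<and> (j = 0 \<longrightarrow> pr = 1) \<and>
      spaced_block q q' r (\<sigma> * (1/2) ^ Suc j) B \<and> r \<le> 1/2 \<and> (\<forall>n\<in>B. r \<le> l n) \<and>
      K * (2 * r) powr \<tau> * overlap B r * pr \<le> \<sigma> * (1/2) ^ Suc j)"
    for j :: nat and x :: "nat \<times> real \<times> real \<times> nat set \<times> nat"
  define link where "link x y \<longleftrightarrow> fst y = snd (snd (snd (snd x))) \<and>
      fst (snd y) = fst (snd x) * (1 + overlap (fst (snd (snd (snd x)))) (fst (snd (snd x))))"
    for x y :: "nat \<times> real \<times> real \<times> nat set \<times> nat"
  have "\<exists>f. \<forall>j. ok j (f j) \<and> link (f j) (f (Suc j))"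
  proof (rule dependent_nat_choice)
    obtain r B q' where "spaced_block 0 q' r (\<sigma> * (1/2) ^ Suc 0) B \<and> r \<le> 1/2 \<and> (\<forall>n\<in>B. r \<le> l n) \<and>
      K * (2 * r) powr \<tau> * overlap B r * 1 \<le> \<sigma> * (1/2) ^ Suc 0"
      using step[of 1 0 0] by auto
    then have "ok 0 (0, 1, r, B, q')" by (simp add: ok_def)
    then show "\<exists>x. ok 0 x" by blast
  next
    fix x j assume x: "ok j x"
    obtain q pr r B q' where xe: "x = (q, pr, r, B, q')" by (cases x)
    define pr' where "pr' = pr * (1 + overlap B r)"
    have "0 \<le> overlap B r" using c_ge_1 by simp
    then have "0 < pr'" using x unfolding pr'_def by (intro mult_pos_pos) (auto simp: ok_def xe)
    then obtain r' B' q'' where "spaced_block q' q'' r' (\<sigma> * (1/2) ^ Suc (Suc j)) B' \<and> r' \<le> 1/2 \<and>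
      (\<forall>n\<in>B'. r' \<le> l n) \<and> K * (2 * r') powr \<tau> * overlap B' r' * pr' \<le> \<sigma> * (1/2) ^ Suc (Suc j)"
      using step[of pr' q' "Suc j"] by blast
    then have "ok (Suc j) (q', pr', r', B', q'')" using \<open>0 < pr'\<close> by (simp add: ok_def)
    moreover have "link x (q', pr', r', B', q'')" by (simp add: link_def xe pr'_def)
    ultimately show "\<exists>y. ok (Suc j) y \<and> link x y" by blast
  qed
  then obtain f where f: "\<And>j. ok j (f j)" "\<And>j. link (f j) (f (Suc j))" by blast
  define q where "q j = fst (f j)" for j
  define pr where "pr j = fst (snd (f j))" for j
  define r where "r j = fst (snd (snd (f j)))" for j
  define B where "B j = fst (snd (snd (snd (f j))))" for j
  define q' where "q' j = snd (snd (snd (snd (f j))))" for j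
  have fe: "f j = (q j, pr j, r j, B j, q' j)" for j
    by (simp add: q_def pr_def r_def B_def q'_def)
  have ok: "0 < pr j" "j = 0 \<Longrightarrow> pr j = 1" "spaced_block (q j) (q' j) (r j) (\<sigma> * (1/2) ^ Suc j) (B j)"
    "r j \<le> 1/2" "\<And>n. n \<in> B j \<Longrightarrow> r j \<le> l n"
    "K * (2 * r j) powr \<tau> * overlap (B j) (r j) * pr j \<le> \<sigma> * (1/2) ^ Suc j" for j
    using f(1)[of j] unfolding ok_def fe by auto
  have link: "q (Suc j) = q' j" "pr (Suc j) = pr j * (1 + overlap (B j) (r j))" for j
    using f(2)[of j] unfolding link_def fe by auto
  have pr_eq: "pr j = (\<Prod>i<j. 1 + overlap (B i) (r i))" for j
  proof (induction j)
    case 0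
    show ?case using ok(2)[of 0] by simp
  next
    case (Suc j)
    then show ?case using link(2)[of j] by simp
  qed
  show ?thesis
  proof (rule that[of q r B])
    show "spaced_block (q j) (q (Suc j)) (r j) (\<sigma> * (1/2) ^ Suc j) (B j)" for j
      using ok(3)[of j] link(1)[of j] by simp
    show "K * (2 * r j) powr \<tau> * overlap (B j) (r j) * (\<Prod>i<j. 1 + overlap (B i) (r i)) \<le> \<sigma> * (1/2) ^ Suc j" for j
      using ok(6)[of j] by (simp add: pr_eq)
  qed (use ok in auto)
qed

end

section \<open>Energy and Hausdorff measure\<close>

text \<open>
  For \<open>u > 0\<close> and distances up to \<open>1\<close>, comparable to the Riesz kernel \<open>d(y, z)\<^sup>-\<^sup>u\<close> truncated near distance
  \<open>2\<^sup>-\<^sup>m\<close>. Being bounded, it gives finite energy to finitely supported measures.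
\<close>
definition dyadic_kernel :: "real \<Rightarrow> nat \<Rightarrow> 'a::metric_space \<Rightarrow> 'a \<Rightarrow> real" where
  "dyadic_kernel u m y z = (\<Sum>n<m. if dist y z \<le> (1/2) ^ n then 2 powr (real n * u) else 0)"

lemma dyadic_kernel_nonneg: "0 \<le> dyadic_kernel u m y z"
  unfolding dyadic_kernel_def by (intro sum_nonneg) auto

lemma dyadic_kernel_ge: "n < m \<Longrightarrow> dist y z \<le> (1/2) ^ n \<Longrightarrow> 2 powr (real n * u) \<le> dyadic_kernel u m y z"
  unfolding dyadic_kernel_def
  using member_le_sum[of n "{..<m}" "\<lambda>n. if dist y z \<le> (1/2) ^ n then 2 powr (real n * u) else 0"]
  by simp

text \<open>
  At the dyadic radius \<open>a\<close> the Frostman bound gives mass \<open>C min(a, R)\<^sup>t\<close>, which is at most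
  \<open>C a\<^sup>t\<^sup>-\<^sup>\<tau> R\<^sup>\<tau>\<close>; the first factor makes the sum over the radii geometric.
\<close>
lemma dyadic_kernel_sum_le:
  fixes S :: "'a::metric_space set"
  assumes S: "finite S" "\<forall>y\<in>S. 0 \<le> P y" and C: "0 \<le> C"
    and frostman: "\<And>y r. \<delta> \<le> r \<Longrightarrow> sum P (S \<inter> cball y r) \<le> C * r powr t"
    and \<delta>: "0 < \<delta>" "\<delta> \<le> (1/2) ^ m" "\<delta> \<le> R"
    and exps: "0 \<le> u" "0 \<le> \<tau>" "u + \<tau> < t"
  shows "(\<Sum>z\<in>S \<inter> cball y R. P z * dyadic_kernel u m y z) \<le> C / (1 - 2 powr (u + \<tau> - t)) * R powr \<tau>"
proof -
  define x where "x = 2 powr (u + \<tau> - t)"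
  have x: "0 < x" "x < 1" using exps by (auto simp: x_def powr_less_one)
  have "(\<Sum>z\<in>S \<inter> cball y R. P z * dyadic_kernel u m y z)
      = (\<Sum>n<m. \<Sum>z\<in>S \<inter> cball y R. if dist y z \<le> (1/2) ^ n then P z * 2 powr (real n * u) else 0)"
    unfolding dyadic_kernel_def sum_distrib_left by (subst sum.swap) (intro sum.cong refl, auto)
  also have "\<dots> \<le> (\<Sum>n<m. C * R powr \<tau> * x ^ n)"
  proof (rule sum_mono)
    fix n assume "n \<in> {..<m}"
    define a :: real where "a = (1/2) ^ n"
    have "(1/2 :: real) ^ m \<le> a" unfolding a_def using \<open>n \<in> {..<m}\<close> by (intro power_decreasing) auto
    then have a: "\<delta> \<le> a" "0 < a" "0 < R" "\<delta> \<le> min a R" using \<delta> by auto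
    have "(\<Sum>z\<in>S \<inter> cball y R. if dist y z \<le> a then P z * 2 powr (real n * u) else 0)
        = (\<Sum>z\<in>S \<inter> cball y (min a R). P z * 2 powr (real n * u))"
      using S(1) by (intro sum.mono_neutral_cong_right) auto
    also have "\<dots> = 2 powr (real n * u) * sum P (S \<inter> cball y (min a R))"
      by (simp add: sum_distrib_left mult.commute)
    also have "\<dots> \<le> 2 powr (real n * u) * (C * (a powr (t - \<tau>) * R powr \<tau>))"
    proof (intro mult_left_mono)
      have "sum P (S \<inter> cball y (min a R)) \<le> C * min a R powr t" using a(4) by (rule frostman)
      also have "min a R powr t = min a R powr (t - \<tau>) * min a R powr \<tau>"
        by (simp add: powr_add[symmetric])
      also have "\<dots> \<le> a powr (t - \<tau>) * R powr \<tau>"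
        using exps a by (intro mult_mono powr_mono2) auto
      finally show "sum P (S \<inter> cball y (min a R)) \<le> C * (a powr (t - \<tau>) * R powr \<tau>)"
        using C by (simp add: mult_left_mono)
    qed simp
    also have "\<dots> = C * R powr \<tau> * (2 powr (real n * u) * a powr (t - \<tau>))" by (simp only: mult_ac)
    also have "a powr (t - \<tau>) = 2 powr (- (real n * (t - \<tau>)))"
    proof -
      have "a = 2 powr (- real n)" by (simp add: a_def powr_minus powr_realpow power_one_over inverse_eq_divide)
      then show ?thesis by (simp add: powr_powr)
    qed
    also have "2 powr (real n * u) * 2 powr (- (real n * (t - \<tau>))) = x ^ n"
      using x(1) by (simp add: x_def powr_realpow[symmetric] powr_powr powr_add[symmetric] algebra_simps)
    finally show "(\<Sum>z\<in>S \<inter> cball y R. if dist y z \<le> (1/2) ^ n then P z * 2 powr (real n * u) else 0)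
        \<le> C * R powr \<tau> * x ^ n" by (simp add: a_def)
  qed
  also have "\<dots> = C * R powr \<tau> * (\<Sum>n<m. x ^ n)" by (simp add: sum_distrib_left)
  also have "\<dots> \<le> C * R powr \<tau> * (1 / (1 - x))"
  proof (rule mult_left_mono)
    have "(\<Sum>n<m. x ^ n) \<le> (\<Sum>n. x ^ n)" using x by (intro sum_le_suminf summable_geometric) auto
    then show "(\<Sum>n<m. x ^ n) \<le> 1 / (1 - x)" using x by (simp add: suminf_geometric)
  qed (use C in simp)
  finally show ?thesis by (simp add: x_def)
qed

text \<open>
  The mass distribution principle without passing to a limit measure. An efficient cover of the
  intersection is enlarged to an open one; by compactness finitely many of its members already cover
  \<open>F k\<close> for all large \<open>k\<close>. Distributing the weights on \<open>F k\<close> to these members \<open>V\<^sub>i\<close> of diameter at most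
  \<open>D\<^sub>i\<close>, with masses \<open>Q\<^sub>i\<close>, the energy is at least of the order of \<open>\<Sum> Q\<^sub>i\<^sup>2 D\<^sub>i\<^sup>-\<^sup>u\<close>, and the Cauchy-Schwarz
  inequality bounds \<open>(\<Sum> Q\<^sub>i)\<^sup>2\<close> by that times \<open>\<Sum> D\<^sub>i\<^sup>u\<close>.
\<close>
lemma hausdorff_measure_pos_of_energy:
  fixes F :: "nat \<Rightarrow> 'a::metric_space set"
  assumes compact: "compact (UNIV :: 'a set)" and F: "\<And>n. closed (F n)" "decseq F"
    and u: "0 < u"
    and energy: "\<exists>\<^sub>\<infinity>n. \<exists>S w. finite S \<and> (\<forall>y\<in>S. 0 \<le> w y \<and> (w y \<noteq> 0 \<longrightarrow> y \<in> F n)) \<and>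
      1/2 \<le> sum w S \<and> (\<Sum>y\<in>S. \<Sum>z\<in>S. w y * w z * dyadic_kernel u n y z) \<le> E"
  shows "hausdorff_measure u (\<Inter>n. F n) \<noteq> 0"
proof
  assume null: "hausdorff_measure u (\<Inter>n. F n) = 0"
  \<comment> \<open>Small enough for the final estimate to give \<open>1/4 \<le> 1/8\<close>.\<close>
  define e where "e = 1 / (16 * 2 powr u * (1 + \<bar>E\<bar>))"
  have den: "1 \<le> 2 powr u * (1 + \<bar>E\<bar>)"
    using u mult_mono[of 1 "2 powr u" 1 "1 + \<bar>E\<bar>"] by (simp add: ge_one_powr_ge_zero)
  have e: "0 < e" "2 * e \<le> 1" using den by (auto simp: e_def field_simps)
  obtain U where U: "(\<Inter>n. F n) \<subseteq> (\<Union>i. U i)" "\<And>i. bounded (U i)"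
      "(\<Sum>i. diam_pow u (U i)) < ennreal e"
    using hausdorff_null_coverE[OF null zero_less_one e(1)] by metis
  define d where "d i = diameter (U i)" for i
  have d: "0 \<le> d i" for i unfolding d_def using U(2) by (rule diameter_ge_0)
  have diam_pow: "diam_pow u (U i) = ennreal (d i powr u)" for i
    using u by (simp add: diam_pow_def d_def)
  have "(\<Sum>i. ennreal (d i powr u)) < ennreal e" using U(3) by (simp only: diam_pow)
  then have d_summ: "summable (\<lambda>i. d i powr u)"
    by (intro summable_suminf_not_top) auto
  then have d_sum: "(\<Sum>i. d i powr u) \<le> e"
    using \<open>(\<Sum>i. ennreal (d i powr u)) < ennreal e\<close> e(1)
    by (simp add: suminf_ennreal2 ennreal_less_iff suminf_nonneg)
  \<comment> \<open>Each covering set is replaced by an open one that is only slightly larger.\<close>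
  define D where "D i = (d i powr u + e * (1/2) ^ Suc i) powr (1 / u)" for i
  have Du: "D i powr u = d i powr u + e * (1/2) ^ Suc i" for i
    using u e(1) by (simp add: D_def powr_powr add_nonneg_nonneg)
  have D_pos: "0 < D i" for i
  proof -
    have "0 < d i powr u + e * (1/2) ^ Suc i" using e(1) by (intro add_nonneg_pos) auto
    then show ?thesis by (simp add: D_def)
  qed
  have dD: "d i < D i" for i
  proof -
    have "d i powr u < D i powr u" using e(1) by (simp add: Du)
    then show ?thesis using u D_pos[of i] d[of i] by (meson less_imp_le not_le powr_mono2)
  qed
  have geo: "(\<lambda>i. e * (1/2) ^ Suc i) sums e"
    using sums_mult[OF power_half_series, of e] by simp
  have D_summ: "summable (\<lambda>i. D i powr u)"
    unfolding Du using d_summ sums_summable[OF geo] by (rule summable_add)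
  have D_sum: "(\<Sum>i. D i powr u) \<le> 2 * e"
    unfolding Du using d_summ geo d_sum by (simp add: suminf_add[symmetric] sums_iff)
  have D_le: "sum (\<lambda>i. D i powr u) I \<le> 2 * e" if "finite I" for I
    using sum_le_suminf[OF D_summ that] D_sum by simp
  have D_1: "D i \<le> 1" for i
  proof (rule ccontr)
    assume "\<not> D i \<le> 1"
    then have "1 < D i powr u" using u by (intro gr_one_powr) auto
    with D_le[of "{i}"] e(2) show False by simp
  qed
  define V where "V i = (\<Union>z\<in>U i. ball z ((D i - d i) / 2))" for i
  have V_open: "open (V i)" for i by (auto simp: V_def)
  have V_U: "U i \<subseteq> V i" for i using dD[of i] by (force simp: V_def)
  have V_diam: "dist y z \<le> D i" if yz: "y \<in> V i" "z \<in> V i" for y z i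
  proof -
    obtain a where a: "a \<in> U i" "y \<in> ball a ((D i - d i) / 2)" using yz(1) unfolding V_def by blast
    obtain b where b: "b \<in> U i" "z \<in> ball b ((D i - d i) / 2)" using yz(2) unfolding V_def by blast
    have ab: "a \<in> U i" "dist a y < (D i - d i) / 2" "b \<in> U i" "dist b z < (D i - d i) / 2"
      using a b by simp_all
    have "dist a b \<le> d i" unfolding d_def using U(2) ab by (intro diameter_bounded_bound) auto
    moreover have "dist y z \<le> dist a y + dist a b + dist b z"
      using dist_triangle[of y z a] dist_triangle[of a z b] by (simp add: dist_commute)
    ultimately show ?thesis using ab by simp
  qed
  \<comment> \<open>An increasing open cover of the compact space, so one of these sets is the whole space.\<close>
  define G where "G n = (\<Union>i\<le>n. V i) \<union> - F n" for n
  have "UNIV \<subseteq> (\<Union>n\<in>UNIV. G n)"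
  proof
    fix y :: 'a
    show "y \<in> (\<Union>n\<in>UNIV. G n)"
    proof (cases "y \<in> (\<Inter>n. F n)")
      case True
      then obtain i where "y \<in> V i" using U(1) V_U by blast
      then show ?thesis by (auto simp: G_def)
    qed (auto simp: G_def)
  qed
  moreover have "open (G n)" for n
    unfolding G_def using V_open F(1) by (intro open_Un open_UN open_Compl) auto
  ultimately obtain N' where N': "finite N'" "UNIV \<subseteq> (\<Union>n\<in>N'. G n)"
    using compactE_image[OF compact, of UNIV G] by auto
  define N where "N = Max (insert 0 N')"
  have cover: "F k \<subseteq> (\<Union>i\<le>N. V i)" if "N \<le> k" for k
  proof
    fix y assume y: "y \<in> F k"
    obtain n where n: "n \<in> N'" "y \<in> G n" using N'(2) by auto
    have "n \<le> N" unfolding N_def using N'(1) n(1) by (intro Max_ge) auto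
    then have "y \<in> F n" using y decseqD[OF F(2), of n k] that by auto
    then show "y \<in> (\<Union>i\<le>N. V i)" using n(2) \<open>n \<le> N\<close> by (fastforce simp: G_def)
  qed
  have "\<exists>n. (1/2) ^ Suc n < D i \<and> D i \<le> (1/2) ^ n" for i
  proof -
    obtain j where j: "(1/2) ^ j < D i" using real_arch_pow_inv[OF D_pos[of i], of "1/2"] by auto
    define n where "n = (LEAST j. (1/2) ^ j < D i)"
    have n: "(1/2) ^ n < D i" unfolding n_def using j by (rule LeastI)
    then have "n \<noteq> 0" using D_1[of i] by (intro notI) simp
    then obtain m where m: "n = Suc m" by (cases n) auto
    then have "\<not> (1/2) ^ m < D i" unfolding n_def by (intro not_less_Least) (simp add: n_def[symmetric] m)
    then show ?thesis using n m by (intro exI[of _ m]) auto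
  qed
  then obtain lev where lev: "\<And>i. (1/2) ^ Suc (lev i) < D i" "\<And>i. D i \<le> (1/2) ^ lev i" by metis
  \<comment> \<open>From \<open>k0\<close> on the kernel resolves the diameters of all members of the finite cover.\<close>
  define k0 where "k0 = N + (\<Sum>i\<le>N. Suc (lev i))"
  obtain k S w where k: "k0 \<le> k" and S: "finite S" "\<forall>y\<in>S. 0 \<le> w y \<and> (w y \<noteq> 0 \<longrightarrow> y \<in> F k)"
      "1/2 \<le> sum w S" "(\<Sum>y\<in>S. \<Sum>z\<in>S. w y * w z * dyadic_kernel u k y z) \<le> E"
    using INFM_nat_le[THEN iffD1, OF energy, rule_format, of k0] by (elim exE conjE) (rule that)
  have "N \<le> k" using k by (simp add: k0_def)
  have lev_k: "lev i < k" if "i \<le> N" for i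
  proof -
    have "Suc (lev i) \<le> (\<Sum>i\<le>N. Suc (lev i))" using that by (intro member_le_sum) auto
    then show ?thesis using k by (simp add: k0_def)
  qed
  define X where "X = {y \<in> S. w y \<noteq> 0}"
  have X: "finite X" "X \<subseteq> S" "X \<subseteq> F k" using S(1,2) by (auto simp: X_def)
  define idx where "idx y = (LEAST i. y \<in> V i)" for y
  have idx: "idx y \<le> N" "y \<in> V (idx y)" if yX: "y \<in> X" for y
  proof -
    have "y \<in> (\<Union>i\<le>N. V i)" using yX X(3) cover[OF \<open>N \<le> k\<close>] by blast
    then obtain i where i: "i \<le> N" "y \<in> V i" by auto
    show "y \<in> V (idx y)" unfolding idx_def using i(2) by (rule LeastI)
    have "idx y \<le> i" unfolding idx_def using i(2) by (rule Least_le)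
    then show "idx y \<le> N" using i(1) by simp
  qed
  define Q where "Q i = sum w {y \<in> X. idx y = i}" for i
  have w_nonneg: "0 \<le> w y" if "y \<in> X" for y using S(2) X(2) that by auto
  have total: "sum w S = (\<Sum>i\<le>N. Q i)"
  proof -
    have "sum w S = sum w X" unfolding X_def using S(1) by (intro sum.mono_neutral_right) auto
    also have "\<dots> = (\<Sum>i\<le>N. Q i)"
      unfolding Q_def using X(1) idx(1) by (intro sum.group[symmetric]) auto
    finally show ?thesis .
  qed
  define J where "J i = (\<Sum>y\<in>{y \<in> X. idx y = i}. \<Sum>z\<in>{z \<in> X. idx z = i}. w y * w z * dyadic_kernel u k y z)" for i
  have Q_J: "(Q i)\<^sup>2 \<le> (2 * D i) powr u * J i" if "i \<le> N" for i
  proof -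
    have "(Q i)\<^sup>2 = (\<Sum>y\<in>{y \<in> X. idx y = i}. \<Sum>z\<in>{z \<in> X. idx z = i}. w y * w z)"
      by (simp add: Q_def power2_eq_square sum_product)
    also have "\<dots> \<le> (\<Sum>y\<in>{y \<in> X. idx y = i}. \<Sum>z\<in>{z \<in> X. idx z = i}.
        (2 * D i) powr u * (w y * w z * dyadic_kernel u k y z))"
    proof (intro sum_mono)
      fix y z assume yz: "y \<in> {y \<in> X. idx y = i}" "z \<in> {z \<in> X. idx z = i}"
      then have "dist y z \<le> (1/2) ^ lev i"
        using V_diam[of y i z] idx(2) lev(2)[of i] by fastforce
      then have "2 powr (real (lev i) * u) \<le> dyadic_kernel u k y z"
        using lev_k[OF that] by (intro dyadic_kernel_ge)
      moreover have "1 \<le> (2 * D i) powr u * 2 powr (real (lev i) * u)"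
      proof -
        have "1 = (2 * (1/2) ^ Suc (lev i)) powr u * 2 powr (real (lev i) * u)"
          by (simp add: powr_realpow[symmetric] powr_powr powr_divide)
        also have "\<dots> \<le> (2 * D i) powr u * 2 powr (real (lev i) * u)"
          using lev(1)[of i] u by (intro mult_right_mono powr_mono2) auto
        finally show ?thesis .
      qed
      ultimately have "1 \<le> (2 * D i) powr u * dyadic_kernel u k y z"
        by (meson mult_left_mono order_trans powr_ge_zero)
      then have "w y * w z * 1 \<le> w y * w z * ((2 * D i) powr u * dyadic_kernel u k y z)"
        using w_nonneg yz by (intro mult_left_mono) auto
      then show "w y * w z \<le> (2 * D i) powr u * (w y * w z * dyadic_kernel u k y z)" by (simp add: mult_ac)
    qed
    also have "\<dots> = (2 * D i) powr u * J i" by (simp add: J_def sum_distrib_left)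
    finally show ?thesis .
  qed
  have J_sum: "(\<Sum>i\<le>N. J i) \<le> E"
  proof -
    have nn: "0 \<le> w y * w z * dyadic_kernel u k y z" if "y \<in> S" "z \<in> S" for y z
      using S(2) that by (auto intro!: mult_nonneg_nonneg dyadic_kernel_nonneg)
    have "(\<Sum>i\<le>N. J i) \<le> (\<Sum>i\<le>N. \<Sum>y\<in>{y \<in> X. idx y = i}. \<Sum>z\<in>S. w y * w z * dyadic_kernel u k y z)"
      unfolding J_def using X S(1) nn by (intro sum_mono sum_mono2) auto
    also have "\<dots> = (\<Sum>y\<in>X. \<Sum>z\<in>S. w y * w z * dyadic_kernel u k y z)"
      using X(1) idx(1) by (intro sum.group) auto
    also have "\<dots> \<le> (\<Sum>y\<in>S. \<Sum>z\<in>S. w y * w z * dyadic_kernel u k y z)"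
      using X S(1) nn by (intro sum_mono2) (auto intro!: sum_nonneg)
    finally show ?thesis using S(4) by simp
  qed
  have "(1/2)\<^sup>2 \<le> (sum w S)\<^sup>2" using S(3) by (intro power_mono) auto
  also have "\<dots> = (\<Sum>i\<le>N. (Q i * D i powr (- u / 2)) * D i powr (u / 2))\<^sup>2"
    unfolding total using D_pos by (simp add: mult.assoc powr_add[symmetric] less_imp_neq[symmetric])
  also have "\<dots> \<le> (\<Sum>i\<le>N. (Q i * D i powr (- u / 2))\<^sup>2) * (\<Sum>i\<le>N. (D i powr (u / 2))\<^sup>2)"
    by (rule Cauchy_Schwarz_ineq_sum)
  also have "\<dots> \<le> (2 powr u * (1 + \<bar>E\<bar>)) * (2 * e)"
  proof (rule mult_mono)
    have "(\<Sum>i\<le>N. (D i powr (u / 2))\<^sup>2) = (\<Sum>i\<le>N. D i powr u)"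
      by (intro sum.cong refl) (simp add: power2_eq_square powr_add[symmetric])
    then show "(\<Sum>i\<le>N. (D i powr (u / 2))\<^sup>2) \<le> 2 * e" using D_le[of "{..N}"] by simp
    have "(\<Sum>i\<le>N. (Q i * D i powr (- u / 2))\<^sup>2) \<le> (\<Sum>i\<le>N. 2 powr u * J i)"
    proof (rule sum_mono)
      fix i assume i: "i \<in> {..N}"
      have "(Q i * D i powr (- u / 2))\<^sup>2 = (Q i)\<^sup>2 * D i powr (- u)"
        by (simp add: power_mult_distrib) (simp add: power2_eq_square powr_add[symmetric])
      also have "\<dots> \<le> ((2 * D i) powr u * J i) * D i powr (- u)"
        using Q_J i by (intro mult_right_mono) auto
      also have "\<dots> = 2 powr u * J i"
        using D_pos[of i] by (simp add: powr_mult powr_minus field_simps)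
      finally show "(Q i * D i powr (- u / 2))\<^sup>2 \<le> 2 powr u * J i" .
    qed
    also have "\<dots> = 2 powr u * (\<Sum>i\<le>N. J i)" by (simp add: sum_distrib_left)
    also have "\<dots> \<le> 2 powr u * (1 + \<bar>E\<bar>)" using J_sum by (intro mult_left_mono) auto
    finally show "(\<Sum>i\<le>N. (Q i * D i powr (- u / 2))\<^sup>2) \<le> 2 powr u * (1 + \<bar>E\<bar>)" .
  qed (auto intro!: sum_nonneg)
  also have "\<dots> = 1/8" using den by (simp add: e_def field_simps)
  finally show False by (simp add: power2_eq_square)
qed

section \<open>Random measures on the intersection\<close>

text \<open>
  Telescoping over the factors. Keeping the indicator of one factor only is enough, because the
  Frostman bound is applied at the scale of that factor.
\<close>
lemma prod_one_plus_indicator_le: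
  fixes g v :: "nat \<Rightarrow> real"
  assumes "\<And>j. 0 \<le> g j" "\<And>j. 0 \<le> v j" "\<And>j. v j \<le> 1"
  shows "(\<Prod>j<n. 1 + g j * v j) \<le> 1 + (\<Sum>j<n. g j * v j * (\<Prod>i<j. 1 + g i))"
proof (induction n)
  case (Suc n)
  have "(\<Prod>j<n. 1 + g j * v j) \<le> (\<Prod>j<n. 1 + g j)"
    using assms by (intro prod_mono) (auto intro!: mult_left_le add_nonneg_nonneg)
  then have "g n * v n * (\<Prod>j<n. 1 + g j * v j) \<le> g n * v n * (\<Prod>j<n. 1 + g j)"
    using assms by (intro mult_left_mono) auto
  with Suc show ?case by (simp add: algebra_simps)
qed simp

lemma sum_half_powers_le: "0 \<le> \<sigma> \<Longrightarrow> (\<Sum>j<n. \<sigma> * (1/2) ^ Suc j) \<le> (\<sigma>::real)"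
  using sum_le_suminf[of "\<lambda>j. \<sigma> * (1/2) ^ Suc j" "{..<n}"] sums_mult[OF power_half_series, of \<sigma>]
  by (auto simp: sums_iff)

context prob_space
begin

lemma limsup_event_measure_ge:
  assumes A: "\<And>n::nat. A n \<in> sets M" and ge: "\<And>n. p \<le> measure M (A n)"
  shows "p \<le> measure M (\<Inter>m. \<Union>n\<in>{m..}. A n)" "(\<Inter>m. \<Union>n\<in>{m..}. A n) \<in> sets M"
proof -
  define U where "U m = (\<Union>n\<in>{m..}. A n)" for m
  have U: "U m \<in> sets M" for m unfolding U_def using A by auto
  then show "(\<Inter>m. \<Union>n\<in>{m..}. A n) \<in> sets M" unfolding U_def[symmetric] by blast
  have "decseq U" unfolding decseq_def U_def by (intro allI impI UN_mono) auto
  then have "(\<lambda>m. measure M (U m)) \<longlonglongrightarrow> measure M (\<Inter>m. U m)"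
    using U by (intro finite_Lim_measure_decseq) auto
  moreover have "p \<le> measure M (U m)" for m
  proof -
    have "A m \<subseteq> U m" by (auto simp: U_def)
    then have "measure M (A m) \<le> measure M (U m)" using U by (intro finite_measure_mono)
    with ge[of m] show ?thesis by simp
  qed
  ultimately show "p \<le> measure M (\<Inter>m. \<Union>n\<in>{m..}. A n)"
    unfolding U_def[symmetric] by (intro LIMSEQ_le_const) auto
qed

text \<open>
  Chebyshev's inequality for \<open>W\<close>, whose second moment around \<open>1\<close> is at most \<open>8\<sigma>\<close>, costs \<open>32\<sigma>\<close>; Markov's
  inequality for \<open>I\<close> costs \<open>\<sigma>\<close>.
\<close>
lemma moment_event_ge:
  assumes W: "integrable M W" "integrable M (\<lambda>x. (W x)\<^sup>2)" and I: "integrable M I" "\<And>x. 0 \<le> I x"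
    and EW: "1 - \<sigma> \<le> expectation W" "expectation (\<lambda>x. (W x)\<^sup>2) \<le> 1 + 6 * \<sigma>"
    and EI: "expectation I \<le> E" and pos: "0 < \<sigma>" "0 < E"
  shows "1 - 33 * \<sigma> \<le> measure M {x \<in> space M. 1/2 \<le> W x \<and> I x \<le> E / \<sigma>}"
    and "{x \<in> space M. 1/2 \<le> W x \<and> I x \<le> E / \<sigma>} \<in> sets M"
proof -
  let ?G = "{x \<in> space M. 1/2 \<le> W x \<and> I x \<le> E / \<sigma>}"
  let ?A = "{x \<in> space M. 1/4 \<le> (W x - 1)\<^sup>2}" and ?B = "{x \<in> space M. E / \<sigma> \<le> I x}"
  have [measurable]: "W \<in> borel_measurable M" "I \<in> borel_measurable M" using W(1) I(1) by auto
  show G: "?G \<in> sets M" by measurable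
  have A: "?A \<in> sets M" by measurable
  have B: "?B \<in> sets M" by measurable
  note AB = A B
  have sq: "(W x - 1)\<^sup>2 = (W x)\<^sup>2 - 2 * W x + 1" for x by (simp add: power2_eq_square algebra_simps)
  have int: "integrable M (\<lambda>x. (W x - 1)\<^sup>2)" unfolding sq using W by auto
  have "expectation (\<lambda>x. (W x - 1)\<^sup>2) = expectation (\<lambda>x. (W x)\<^sup>2) - 2 * expectation W + 1"
    unfolding sq using W prob_space by simp
  then have E: "expectation (\<lambda>x. (W x - 1)\<^sup>2) \<le> 8 * \<sigma>" using EW by simp
  have "measure M ?A \<le> expectation (\<lambda>x. (W x - 1)\<^sup>2) / (1/4)"
    using int by (intro integral_Markov_inequality_measure[where A="{}"]) auto
  with E have mA: "measure M ?A \<le> 32 * \<sigma>" by simp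
  have "measure M ?B \<le> expectation I / (E / \<sigma>)"
    using I pos by (intro integral_Markov_inequality_measure[where A="{}"]) auto
  also have "\<dots> \<le> E / (E / \<sigma>)" using EI pos by (intro divide_right_mono) auto
  finally have mB: "measure M ?B \<le> \<sigma>" using pos by simp
  have "space M \<subseteq> ?G \<union> (?A \<union> ?B)"
  proof
    fix x assume x: "x \<in> space M"
    have "1/4 \<le> (W x - 1)\<^sup>2" if "W x < 1/2"
    proof -
      have "(1/2)\<^sup>2 \<le> (1 - W x)\<^sup>2" using that by (intro power_mono) auto
      moreover have "(1/2)\<^sup>2 = (1/4 :: real)" by (simp add: power2_eq_square)
      ultimately show ?thesis unfolding power2_commute[of "W x" 1] by linarith
    qed
    then show "x \<in> ?G \<union> (?A \<union> ?B)"
      using x by (cases "W x < 1/2"; cases "I x \<le> E / \<sigma>") (simp_all add: not_le not_less)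
  qed
  then have "measure M (space M) \<le> measure M (?G \<union> (?A \<union> ?B))"
    using G AB by (intro finite_measure_mono) auto
  also have "\<dots> \<le> measure M ?G + measure M (?A \<union> ?B)"
    using G AB by (intro measure_Un_le) auto
  also have "\<dots> \<le> measure M ?G + (measure M ?A + measure M ?B)"
    using AB by (intro add_left_mono measure_Un_le)
  finally show "1 - 33 * \<sigma> \<le> measure M ?G" using mA mB prob_space by simp
qed

end

text \<open>
  The second product is bounded through the first one, since \<open>(1 + \<eta>)(1 - \<eta>) \<le> 1\<close>.
\<close>
lemma prod_perturbations:
  fixes \<eta> :: "nat \<Rightarrow> real"
  assumes \<eta>: "\<And>j. 0 \<le> \<eta> j" "(\<Sum>j<n. \<eta> j) \<le> \<sigma>" and \<sigma>: "\<sigma> \<le> 1/4"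
  shows "1 - \<sigma> \<le> (\<Prod>j<n. 1 - \<eta> j)" "(\<Prod>j<n. (1 + \<eta> j)\<^sup>2) \<le> 1 + 4 * \<sigma>"
proof -
  have le: "\<eta> j \<le> \<sigma>" if "j < n" for j
    using member_le_sum[of j "{..<n}" \<eta>] \<eta> that by simp
  have "0 \<le> \<sigma>" using \<eta> sum_nonneg[of "{..<n}" \<eta>] by simp
  have "1 - (\<Sum>j<n. \<eta> j) \<le> (\<Prod>j<n. 1 - \<eta> j)"
    using \<eta> le \<sigma> by (intro Weierstrass_prod_ineq) fastforce
  then show lower: "1 - \<sigma> \<le> (\<Prod>j<n. 1 - \<eta> j)" using \<eta>(2) by simp
  let ?p = "\<Prod>j<n. 1 + \<eta> j" and ?m = "\<Prod>j<n. 1 - \<eta> j"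
  have p: "0 \<le> ?p" using \<eta> by (intro prod_nonneg) (auto intro: add_nonneg_nonneg)
  have "?p * ?m = (\<Prod>j<n. (1 + \<eta> j) * (1 - \<eta> j))" by (rule prod.distrib[symmetric])
  also have "\<dots> \<le> (\<Prod>j<n. 1)"
  proof (intro prod_mono conjI)
    fix j assume j: "j \<in> {..<n}"
    then have "\<eta> j \<le> 1" using le[of j] \<sigma> by simp
    then show "0 \<le> (1 + \<eta> j) * (1 - \<eta> j)" using \<eta>(1)[of j] by simp
    show "(1 + \<eta> j) * (1 - \<eta> j) \<le> 1" using \<eta>(1)[of j] by (simp add: algebra_simps)
  qed
  finally have "?p * ?m \<le> 1" by simp
  then have "?p * (1 - \<sigma>) \<le> 1" using mult_left_mono[OF lower p] by simp
  then have "(?p * (1 - \<sigma>))\<^sup>2 \<le> 1" using p \<sigma> by (intro power_le_one) auto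
  then have 1: "?p\<^sup>2 * (1 - \<sigma>)\<^sup>2 \<le> 1" by (simp add: power_mult_distrib)
  have "0 \<le> \<sigma> * (2 - 7 * \<sigma> + 4 * \<sigma>\<^sup>2)"
    using \<open>0 \<le> \<sigma>\<close> \<sigma> by (intro mult_nonneg_nonneg add_nonneg_nonneg) auto
  then have "1 \<le> (1 + 4 * \<sigma>) * (1 - \<sigma>)\<^sup>2"
    by (simp add: power2_eq_square algebra_simps)
  with 1 have "?p\<^sup>2 * (1 - \<sigma>)\<^sup>2 \<le> (1 + 4 * \<sigma>) * (1 - \<sigma>)\<^sup>2" by simp
  then have "?p\<^sup>2 \<le> 1 + 4 * \<sigma>" using \<sigma> by (simp add: mult_le_cancel_right)
  then show "(\<Prod>j<n. (1 + \<eta> j)\<^sup>2) \<le> 1 + 4 * \<sigma>" by (simp add: prod_power_distrib)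
qed

context mixing_mps
begin

text \<open>
  Both the second moment of the total mass (\<open>k = 1\<close>) and the mean energy (\<open>k\<close> a Riesz kernel) of the
  random measures are of this form. The \<open>j\<close>-th term of the telescoped correlation is concentrated on pairs
  at distance at most \<open>2r\<^sub>j\<close>, where the Frostman condition \<open>near\<close> makes it as small as \<open>small\<close> demands.
\<close>
lemma expectation_double_sum_le:
  assumes B: "\<And>j. spaced_block (q j) (q (Suc j)) (r j) (\<eta> j) (B j)" and \<eta>: "\<And>j. \<eta> j \<le> 1"
    and S: "finite S" "\<forall>y\<in>S. 0 \<le> P y" "sum P S = 1"
    and k: "\<And>y z. 0 \<le> k y z"
    and near: "\<And>j y. j < n \<Longrightarrow> y \<in> S \<Longrightarrow> (\<Sum>z\<in>S \<inter> cball y (2 * r j). P z * k y z) \<le> K * (2 * r j) powr \<tau>"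
    and small: "\<And>j. K * (2 * r j) powr \<tau> * overlap (B j) (r j) * (\<Prod>i<j. 1 + overlap (B i) (r i)) \<le> \<sigma> * (1/2) ^ Suc j"
    and \<sigma>: "0 \<le> \<sigma>"
  shows "expectation (\<lambda>x. \<Sum>y\<in>S. \<Sum>z\<in>S. P y * P z * k y z * (block_product B r 0 n y x * block_product B r 0 n z x))
    \<le> (\<Prod>j<n. (1 + \<eta> j)\<^sup>2) * ((\<Sum>y\<in>S. \<Sum>z\<in>S. P y * P z * k y z) + \<sigma>)"
proof -
  let ?g = "\<lambda>j. overlap (B j) (r j)"
  let ?v = "\<lambda>y z j. if dist y z \<le> 2 * r j then 1 else 0 :: real"
  let ?A = "\<Prod>j<n. (1 + \<eta> j)\<^sup>2"
  let ?h = "\<lambda>j. \<Prod>i<j. 1 + ?g i"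
  have g: "0 \<le> ?g j" for j using c_ge_1 by simp
  have \<eta>0: "0 \<le> \<eta> j" for j using B[of j] by (simp add: spaced_block_def)
  have pr: "0 \<le> ?h j" for j using g by (intro prod_nonneg) (auto intro!: add_nonneg_nonneg)
  have fut: "future (q 0) (block_product B r 0 n y)" for y by (rule block_product_moments(1)[of q r \<eta> B, OF B \<eta>]) simp
  have int: "integrable M (\<lambda>x. block_product B r 0 n y x * block_product B r 0 n z x)" for y z
    by (intro future_integrable[of "q 0"] future_mult fut)
  have corr: "expectation (\<lambda>x. block_product B r 0 n y x * block_product B r 0 n z x)
      \<le> ?A * (1 + (\<Sum>j<n. ?g j * ?v y z j * ?h j))" for y z
  proof -
    have "expectation (\<lambda>x. block_product B r 0 n y x * block_product B r 0 n z x)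
        \<le> (\<Prod>j\<in>{0..<n}. (1 + \<eta> j)\<^sup>2 + (if dist y z \<le> 2 * r j then (1 + \<eta> j) * ?g j else 0))"
      by (rule block_product_moments(3)[of q r \<eta> B, OF B \<eta>]) simp
    also have "\<dots> = (\<Prod>j<n. (1 + \<eta> j)\<^sup>2 + (if dist y z \<le> 2 * r j then (1 + \<eta> j) * ?g j else 0))"
      by (simp add: atLeast0LessThan)
    also have "\<dots> \<le> (\<Prod>j<n. (1 + \<eta> j)\<^sup>2 * (1 + ?g j * ?v y z j))"
    proof (intro prod_mono conjI)
      fix j
      show "0 \<le> (1 + \<eta> j)\<^sup>2 + (if dist y z \<le> 2 * r j then (1 + \<eta> j) * ?g j else 0)"
        using mult_nonneg_nonneg[of "1 + \<eta> j" "?g j"] \<eta>0[of j] g[of j] by simp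
      have "(1 + \<eta> j) * ?g j \<le> (1 + \<eta> j)\<^sup>2 * ?g j"
        using \<eta>0[of j] g[of j] by (intro mult_right_mono) (auto simp: power2_eq_square)
      then show "(1 + \<eta> j)\<^sup>2 + (if dist y z \<le> 2 * r j then (1 + \<eta> j) * ?g j else 0)
          \<le> (1 + \<eta> j)\<^sup>2 * (1 + ?g j * ?v y z j)"
        by (simp add: distrib_left)
    qed
    also have "\<dots> = ?A * (\<Prod>j<n. 1 + ?g j * ?v y z j)" by (rule prod.distrib)
    also have "\<dots> \<le> ?A * (1 + (\<Sum>j<n. ?g j * ?v y z j * ?h j))"
      by (intro mult_left_mono prod_one_plus_indicator_le prod_nonneg) (use g in auto)
    finally show ?thesis .
  qed
  have "expectation (\<lambda>x. \<Sum>y\<in>S. \<Sum>z\<in>S. P y * P z * k y z * (block_product B r 0 n y x * block_product B r 0 n z x))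
      = (\<Sum>y\<in>S. \<Sum>z\<in>S. P y * P z * k y z * expectation (\<lambda>x. block_product B r 0 n y x * block_product B r 0 n z x))"
    using int by simp
  also have "\<dots> \<le> (\<Sum>y\<in>S. \<Sum>z\<in>S. P y * P z * k y z * (?A * (1 + (\<Sum>j<n. ?g j * ?v y z j * ?h j))))"
    using S(2) k corr by (intro sum_mono mult_left_mono) auto
  also have "\<dots> = ?A * ((\<Sum>y\<in>S. \<Sum>z\<in>S. P y * P z * k y z) +
      (\<Sum>y\<in>S. \<Sum>z\<in>S. \<Sum>j<n. P y * (?g j * ?h j * (P z * k y z * ?v y z j))))"
    by (simp add: sum_distrib_left sum_distrib_right distrib_left sum.distrib mult_ac)
  also have "\<dots> \<le> ?A * ((\<Sum>y\<in>S. \<Sum>z\<in>S. P y * P z * k y z) + \<sigma>)"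
  proof (intro mult_left_mono add_left_mono)
    have "(\<Sum>y\<in>S. \<Sum>z\<in>S. \<Sum>j<n. P y * (?g j * ?h j * (P z * k y z * ?v y z j)))
        = (\<Sum>y\<in>S. P y * (\<Sum>j<n. ?g j * ?h j * (\<Sum>z\<in>S. P z * k y z * ?v y z j)))"
      unfolding sum_distrib_left by (intro sum.cong refl) (rule sum.swap)
    also have "\<dots> \<le> (\<Sum>y\<in>S. P y * \<sigma>)"
    proof (intro sum_mono mult_left_mono)
      fix y assume y: "y \<in> S"
      have "(\<Sum>j<n. ?g j * ?h j * (\<Sum>z\<in>S. P z * k y z * ?v y z j)) \<le> (\<Sum>j<n. \<sigma> * (1/2) ^ Suc j)"
      proof (rule sum_mono)
        fix j assume j: "j \<in> {..<n}"
        have "(\<Sum>z\<in>S. P z * k y z * ?v y z j) = (\<Sum>z\<in>S \<inter> cball y (2 * r j). P z * k y z)"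
          using S(1) by (intro sum.mono_neutral_cong_right) auto
        also have "\<dots> \<le> K * (2 * r j) powr \<tau>" using near j y by simp
        finally have "?g j * ?h j * (\<Sum>z\<in>S. P z * k y z * ?v y z j) \<le> ?g j * ?h j * (K * (2 * r j) powr \<tau>)"
          using mult_nonneg_nonneg[OF g[of j] pr[of j]] by (intro mult_left_mono)
        also have "\<dots> \<le> \<sigma> * (1/2) ^ Suc j" using small[of j] by (simp add: mult_ac)
        finally show "?g j * ?h j * (\<Sum>z\<in>S. P z * k y z * ?v y z j) \<le> \<sigma> * (1/2) ^ Suc j" .
      qed
      also have "\<dots> \<le> \<sigma>" using \<sigma> by (rule sum_half_powers_le)
      finally show "(\<Sum>j<n. ?g j * ?h j * (\<Sum>z\<in>S. P z * k y z * ?v y z j)) \<le> \<sigma>" .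
    qed (use S(2) in auto)
    also have "\<dots> = \<sigma>" using S(3) by (simp add: sum_distrib_right[symmetric])
    finally show "(\<Sum>y\<in>S. \<Sum>z\<in>S. \<Sum>j<n. P y * (?g j * ?h j * (P z * k y z * ?v y z j))) \<le> \<sigma>" .
  qed (auto intro!: prod_nonneg)
  finally show ?thesis .
qed

text \<open>
  Stage \<open>n\<close> multiplies Frostman weights on \<open>K n\<close>, valid down to the scale \<open>\<delta> n\<close>, by the densities of the
  first \<open>n\<close> blocks. With probability at least \<open>1 - 33\<sigma>\<close> the result has mass \<open>W n\<close> at least \<open>1/2\<close> and an energy
  \<open>I n\<close> below a bound independent of \<open>n\<close>. With the same probability this happens for infinitely many \<open>n\<close>, which is all
  that \<open>hausdorff_measure_pos_of_energy\<close> asks for.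
\<close>
lemma covered_intersection_large_event:
  assumes pos: "\<And>n. n \<ge> 1 \<Longrightarrow> 0 < l n" and lim: "l \<longlonglongrightarrow> 0"
    and div: "\<not> summable (\<lambda>n. l (Suc n) powr a)" and a: "0 \<le> a" "a \<le> s"
    and G: "analytic_set G" "hausdorff_measure t G \<noteq> 0" and u: "0 < u" "u + s - a < t"
    and \<sigma>: "0 < \<sigma>" "\<sigma> \<le> 1/4"
  shows "\<exists>\<Omega>\<in>sets M. 1 - 33 * \<sigma> \<le> measure M \<Omega> \<and>
    (\<forall>x\<in>\<Omega>. hausdorff_measure u (covered_set T l x \<inter> G) \<noteq> 0)"
proof -
  \<comment> \<open>The slack in \<open>u + s - a < t\<close> is shared out between the loss in Frostman's lemma, the
    convergence of the kernel sums and the choice of the scales.\<close>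
  define g where "g = t - (u + s - a)"
  have g: "0 < g" using u by (simp add: g_def)
  define \<tau> where "\<tau> = s - a + g / 2"
  define t' where "t' = t - g / 4"
  have exps: "0 < \<tau>" "s - a < \<tau>" "u + \<tau> < t'" "0 \<le> t'" "t' < t" "\<tau> \<le> t'"
    unfolding \<tau>_def t'_def using g a u g_def by linarith+
  obtain C0 K where C0: "1 \<le> C0" and K: "\<And>k. closed (K k)" "decseq K" "(\<Inter>k::nat. K k) \<subseteq> G"
    and frostman: "\<And>k \<delta>. 0 < \<delta> \<Longrightarrow> \<exists>S P. finite S \<and> S \<subseteq> K k \<and> (\<forall>y\<in>S. 0 \<le> P y) \<and> sum P S = 1 \<and>
        (\<forall>(y::'a) r. \<delta> \<le> r \<longrightarrow> sum P (S \<inter> cball y r) \<le> C0 * r powr t')"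
    using analytic_frostman[OF G exps(4,5)] by blast
  define x0 where "x0 = 2 powr (u + \<tau> - t')"
  have x0: "0 < x0" "x0 < 1" using exps by (auto simp: x0_def powr_less_one)
  define C1 where "C1 = C0 / (1 - x0)"
  have C1: "C0 \<le> C1" "0 < C1" using C0 x0 by (auto simp: C1_def field_simps)
  obtain q r B where B: "\<And>j. spaced_block (q j) (q (Suc j)) (r j) (\<sigma> * (1/2) ^ Suc j) (B j)"
    and r_half: "\<And>j. r j \<le> 1/2" and rl: "\<And>j n. n \<in> B j \<Longrightarrow> r j \<le> l n"
    and small: "\<And>j. C1 * (2 * r j) powr \<tau> * overlap (B j) (r j) * (\<Prod>i<j. 1 + overlap (B i) (r i)) \<le> \<sigma> * (1/2) ^ Suc j"
    using block_sequence_exists[OF pos lim div a(1) exps(2) \<sigma>(1) C1(2)] by blast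
  define \<eta> where "\<eta> j = \<sigma> * (1/2) ^ Suc j" for j
  have B': "spaced_block (q j) (q (Suc j)) (r j) (\<eta> j) (B j)" for j using B by (simp add: \<eta>_def)
  have r_pos: "0 < r j" for j using B[of j] by (simp add: spaced_block_def)
  have \<eta>: "0 \<le> \<eta> j" "\<eta> j \<le> 1" for j
  proof -
    show "0 \<le> \<eta> j" using \<sigma> by (simp add: \<eta>_def)
    have "\<eta> j \<le> 1 * 1" unfolding \<eta>_def using \<sigma> by (intro mult_mono power_le_one) auto
    then show "\<eta> j \<le> 1" by simp
  qed
  have \<eta>_sum: "(\<Sum>j<n. \<eta> j) \<le> \<sigma>" for n
    unfolding \<eta>_def using \<sigma>(1) by (intro sum_half_powers_le) simp
  note pert = prod_perturbations[OF \<eta>(1) \<eta>_sum \<sigma>(2)]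
  \<comment> \<open>Stage \<open>n\<close> tests balls of the radii \<open>2 r\<^sub>j\<close> with \<open>j < n\<close> and the dyadic radii down to \<open>2\<^sup>-\<^sup>n\<close>.\<close>
  define \<delta> where "\<delta> n = Min (insert ((1/2) ^ n) ((\<lambda>j. 2 * r j) ` {..<n}))" for n
  have \<delta>: "0 < \<delta> n" "\<delta> n \<le> (1/2) ^ n" "j < n \<Longrightarrow> \<delta> n \<le> 2 * r j" for n j
    unfolding \<delta>_def using r_pos by (auto simp: Min_gr_iff intro!: Min_le)
  have "\<exists>S P. finite S \<and> S \<subseteq> K n \<and> (\<forall>y\<in>S. 0 \<le> P y) \<and> sum P S = 1 \<and>
        (\<forall>(y::'a) r. \<delta> n \<le> r \<longrightarrow> sum P (S \<inter> cball y r) \<le> C0 * r powr t')" for n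
    using frostman[OF \<delta>(1)] .
  then obtain S P where SP: "\<And>n. finite (S n)" "\<And>n. S n \<subseteq> K n" "\<And>n. \<forall>y\<in>S n. 0 \<le> P n y"
      "\<And>n. sum (P n) (S n) = 1" "\<And>n y r. \<delta> n \<le> r \<Longrightarrow> sum (P n) (S n \<inter> cball y r) \<le> C0 * r powr t'"
    by metis
  obtain R0 :: real where R0: "1 \<le> R0" "\<And>y z :: 'a. dist y z \<le> R0"
  proof -
    obtain e where "\<forall>x\<in>UNIV. \<forall>y\<in>UNIV. dist x (y :: 'a) \<le> e"
      using compact_imp_bounded[OF compact_space] unfolding bounded_two_points by blast
    then show ?thesis using that[of "max e 1"] by (auto simp: le_max_iff_disj)
  qed
  have ker: "(\<Sum>z\<in>S n \<inter> cball y R. P n z * dyadic_kernel u n y z) \<le> C1 * R powr \<tau>" if "\<delta> n \<le> R" for n y R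
    unfolding C1_def x0_def
    using dyadic_kernel_sum_le[OF SP(1,3) _ SP(5) \<delta>(1,2) that] C0 u exps by simp
  define st where "st n y x = block_product B r 0 n y x" for n y x
  define W where "W n x = (\<Sum>y\<in>S n. P n y * st n y x)" for n x
  define I where "I n x = (\<Sum>y\<in>S n. \<Sum>z\<in>S n. P n y * P n z * dyadic_kernel u n y z * (st n y x * st n z x))" for n x
  define E where "E = 2 * (C1 * R0 powr \<tau> + 1)"
  have E: "0 < E" using C1 by (simp add: E_def add_nonneg_pos)
  have st_nonneg: "0 \<le> st n y x" for n y x by (simp add: st_def block_product_nonneg)
  have fut: "future (q 0) (st n y)" for n y
    unfolding st_def by (rule block_product_moments(1)[of q r \<eta> B, OF B' \<eta>(2)]) simp
  have W_fut: "future (q 0) (W n)" for n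
    unfolding W_def using SP(3) by (intro future_sum future_cmult fut) auto
  have I_fut: "future (q 0) (I n)" for n
    unfolding I_def using SP(3)
    by (intro future_sum future_cmult future_mult fut) (auto intro!: mult_nonneg_nonneg dyadic_kernel_nonneg)
  have EW: "1 - \<sigma> \<le> expectation (W n)" for n
  proof -
    have st_ge: "1 - \<sigma> \<le> expectation (st n y)" for y
      using block_product_moments(2)[of q r \<eta> B 0 n y, OF B' \<eta>(2)] pert(1)[of n]
      by (simp add: st_def[abs_def] atLeast0LessThan)
    have "1 - \<sigma> = (\<Sum>y\<in>S n. P n y * (1 - \<sigma>))" using SP(4) by (simp add: sum_distrib_right[symmetric])
    also have "\<dots> \<le> (\<Sum>y\<in>S n. P n y * expectation (st n y))"
      using SP(3) st_ge by (intro sum_mono mult_left_mono) auto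
    also have "\<dots> = expectation (W n)"
      unfolding W_def using future_integrable[OF fut] by simp
    finally show ?thesis .
  qed
  have EW2: "expectation (\<lambda>x. (W n x)\<^sup>2) \<le> 1 + 6 * \<sigma>" for n
  proof -
    have "(\<lambda>x. (W n x)\<^sup>2) = (\<lambda>x. \<Sum>y\<in>S n. \<Sum>z\<in>S n. P n y * P n z * 1 * (st n y x * st n z x))"
      by (simp add: W_def power2_eq_square sum_product mult_ac)
    then have "expectation (\<lambda>x. (W n x)\<^sup>2)
        \<le> (\<Prod>j<n. (1 + \<eta> j)\<^sup>2) * ((\<Sum>y\<in>S n. \<Sum>z\<in>S n. P n y * P n z * 1) + \<sigma>)"
      unfolding st_def
    proof (simp only:, intro expectation_double_sum_le[where q=q, OF B' \<eta>(2) SP(1,3,4) _ _ small])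
      fix j y assume "j < n"
      then have "sum (P n) (S n \<inter> cball y (2 * r j)) \<le> C0 * (2 * r j) powr t'" by (intro SP(5) \<delta>)
      also have "\<dots> \<le> C1 * (2 * r j) powr \<tau>"
        using C1 C0 exps r_half[of j] r_pos[of j] by (intro mult_mono powr_mono') auto
      finally show "(\<Sum>z\<in>S n \<inter> cball y (2 * r j). P n z * 1) \<le> C1 * (2 * r j) powr \<tau>" by simp
    qed (use \<sigma> in auto)
    also have "(\<Sum>y\<in>S n. \<Sum>z\<in>S n. P n y * P n z * 1) = 1"
      using sum_product[of "P n" "S n" "P n" "S n"] SP(4) by simp
    also have "(\<Prod>j<n. (1 + \<eta> j)\<^sup>2) * (1 + \<sigma>) \<le> (1 + 4 * \<sigma>) * (1 + \<sigma>)"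
      using pert(2) \<sigma> by (intro mult_right_mono) auto
    also have "\<dots> \<le> 1 + 6 * \<sigma>"
      using mult_left_mono[OF \<sigma>(2), of \<sigma>] \<sigma>(1) by (simp add: algebra_simps)
    finally show ?thesis .
  qed
  have EI: "expectation (I n) \<le> E" for n
  proof -
    have R0\<delta>: "\<delta> n \<le> R0" using \<delta>(2)[of n] power_le_one[of "1/2::real" n] R0(1) by simp
    have "expectation (I n) \<le> (\<Prod>j<n. (1 + \<eta> j)\<^sup>2) *
        ((\<Sum>y\<in>S n. \<Sum>z\<in>S n. P n y * P n z * dyadic_kernel u n y z) + \<sigma>)"
      unfolding I_def st_def
      by (intro expectation_double_sum_le[where q=q, OF B' \<eta>(2) SP(1,3,4) _ _ small] ker \<delta>(3) dyadic_kernel_nonneg)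
        (use \<sigma> in auto)
    also have "\<dots> \<le> 2 * (C1 * R0 powr \<tau> + 1)"
    proof (rule mult_mono)
      show "(\<Prod>j<n. (1 + \<eta> j)\<^sup>2) \<le> 2" using pert(2)[of n] \<sigma> by simp
      have "(\<Sum>y\<in>S n. \<Sum>z\<in>S n. P n y * P n z * dyadic_kernel u n y z)
          = (\<Sum>y\<in>S n. P n y * (\<Sum>z\<in>S n \<inter> cball y R0. P n z * dyadic_kernel u n y z))"
        using R0(2) by (intro sum.cong refl) (simp add: sum_distrib_left mult.assoc Int_absorb2 subset_iff)
      also have "\<dots> \<le> (\<Sum>y\<in>S n. P n y * (C1 * R0 powr \<tau>))"
        using SP(3) ker[OF R0\<delta>] by (intro sum_mono mult_left_mono) auto
      also have "\<dots> = C1 * R0 powr \<tau>" using SP(4)[of n] by (simp add: sum_distrib_right[symmetric])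
      finally show "(\<Sum>y\<in>S n. \<Sum>z\<in>S n. P n y * P n z * dyadic_kernel u n y z) + \<sigma> \<le> C1 * R0 powr \<tau> + 1"
        using \<sigma> by simp
      show "0 \<le> (\<Sum>y\<in>S n. \<Sum>z\<in>S n. P n y * P n z * dyadic_kernel u n y z) + \<sigma>"
        using SP(3)[of n] \<sigma> by (intro add_nonneg_nonneg sum_nonneg mult_nonneg_nonneg dyadic_kernel_nonneg) auto
    qed simp
    finally show ?thesis by (simp add: E_def)
  qed
  define A where "A n = {x \<in> space M. 1/2 \<le> W n x \<and> I n x \<le> E / \<sigma>}" for n
  have W_int: "integrable M (W n)" "integrable M (\<lambda>x. (W n x)\<^sup>2)" for n
    unfolding power2_eq_square by (intro future_integrable[of "q 0"] W_fut future_mult)+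
  have A: "1 - 33 * \<sigma> \<le> measure M (A n)" "A n \<in> sets M" for n
    unfolding A_def
    using moment_event_ge[OF W_int future_integrable[OF I_fut] future_nonneg[OF I_fut] EW EW2 EI \<sigma>(1) E]
    by auto
  define \<Omega> where "\<Omega> = (\<Inter>m. \<Union>n\<in>{m..}. A n)"
  have \<Omega>: "\<Omega> \<in> sets M" "1 - 33 * \<sigma> \<le> measure M \<Omega>"
    unfolding \<Omega>_def using limsup_event_measure_ge[OF A(2) A(1)] by auto
  have "hausdorff_measure u (covered_set T l x \<inter> G) \<noteq> 0" if x: "x \<in> \<Omega>" for x
  proof
    assume null: "hausdorff_measure u (covered_set T l x \<inter> G) = 0"
    define F where "F n = K n \<inter> (\<Inter>j<n. \<Union>m\<in>B j. cball ((T ^^ m) x) (r j))" for n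
    have closed_F: "closed (F n)" for n
    proof -
      have "finite (B j)" for j using B[of j] by (simp add: spaced_block_def)
      then show ?thesis unfolding F_def using K(1) by (intro closed_Int closed_INT closed_UN) auto
    qed
    have "decseq F"
    proof (rule decseq_SucI)
      fix n show "F (Suc n) \<subseteq> F n" using decseqD[OF K(2), of n "Suc n"] by (auto simp: F_def)
    qed
    have "hausdorff_measure u (\<Inter>n. F n) \<noteq> 0"
    proof (rule hausdorff_measure_pos_of_energy[OF compact_space closed_F \<open>decseq F\<close> u(1)])
      have "\<exists>\<^sub>\<infinity>n. x \<in> A n" using x unfolding INFM_nat_le \<Omega>_def by fastforce
      then show "\<exists>\<^sub>\<infinity>n. \<exists>S w. finite S \<and> (\<forall>y\<in>S. 0 \<le> w y \<and> (w y \<noteq> 0 \<longrightarrow> y \<in> F n)) \<and>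
          1/2 \<le> sum w S \<and> (\<Sum>y\<in>S. \<Sum>z\<in>S. w y * w z * dyadic_kernel u n y z) \<le> E / \<sigma>"
      proof (rule INFM_mono)
        fix n assume "x \<in> A n"
        then have An: "1/2 \<le> W n x" "I n x \<le> E / \<sigma>" by (auto simp: A_def)
        show "\<exists>S w. finite S \<and> (\<forall>y\<in>S. 0 \<le> w y \<and> (w y \<noteq> 0 \<longrightarrow> y \<in> F n)) \<and>
          1/2 \<le> sum w S \<and> (\<Sum>y\<in>S. \<Sum>z\<in>S. w y * w z * dyadic_kernel u n y z) \<le> E / \<sigma>"
        proof (intro exI conjI ballI impI)
          show "finite (S n)" by (rule SP(1))
          show "1/2 \<le> (\<Sum>y\<in>S n. P n y * st n y x)" using An(1) by (simp add: W_def)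
          show "(\<Sum>y\<in>S n. \<Sum>z\<in>S n. (P n y * st n y x) * (P n z * st n z x) * dyadic_kernel u n y z) \<le> E / \<sigma>"
            using An(2) by (simp add: I_def mult_ac)
          fix y assume y: "y \<in> S n"
          show "0 \<le> P n y * st n y x" using y SP(3) st_nonneg by simp
          assume "P n y * st n y x \<noteq> 0"
          then have nz: "block_density (B j) (r j) y x \<noteq> 0" if "j < n" for j
            using that unfolding st_def block_product_def by (auto simp: prod_zero_iff)
          have "y \<in> (\<Union>m\<in>B j. cball ((T ^^ m) x) (r j))" if "j < n" for j
            using block_density_posD[OF nz[OF that]] by (auto simp: dist_commute)
          then show "y \<in> F n" using y SP(2) by (auto simp: F_def)
        qed
      qed
    qed
    moreover have "(\<Inter>n. F n) \<subseteq> covered_set T l x \<inter> G"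
    proof
      fix y assume y: "y \<in> (\<Inter>n. F n)"
      then have "y \<in> G" using K(3) by (auto simp: F_def)
      have q_ge: "j \<le> q j" for j
      proof (induction j)
        case (Suc j)
        obtain m where "m \<in> B j" using B[of j] by (auto simp: spaced_block_def)
        then have "q j < q (Suc j)" using B[of j] by (fastforce simp: spaced_block_def)
        with Suc show ?case by simp
      qed simp
      have "\<exists>m\<ge>j. (T ^^ m) x \<in> cball y (l m)" for j
      proof -
        have "y \<in> F (Suc j)" using y by blast
        then have "y \<in> (\<Union>m\<in>B j. cball ((T ^^ m) x) (r j))" by (simp add: F_def)
        then obtain m where m: "m \<in> B j" "dist ((T ^^ m) x) y \<le> r j" by auto
        have "q j \<le> m" using B[of j] m(1) by (auto simp: spaced_block_def)
        then show ?thesis using m rl[OF m(1)] q_ge[of j] by (intro exI[of _ m]) (auto simp: dist_commute)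
      qed
      then show "y \<in> covered_set T l x \<inter> G"
        using \<open>y \<in> G\<close> by (simp add: covered_set_def INFM_nat_le)
    qed
    ultimately show False using hausdorff_null_subset[OF null] by blast
  qed
  with \<Omega> show ?thesis by blast
qed

lemma AE_covered_intersection_pos:
  assumes pos: "\<And>n. n \<ge> 1 \<Longrightarrow> 0 < l n" and lim: "l \<longlonglongrightarrow> 0"
    and div: "\<not> summable (\<lambda>n. l (Suc n) powr a)" and a: "0 \<le> a" "a \<le> s"
    and G: "analytic_set G" "hausdorff_measure t G \<noteq> 0" and u: "0 < u" "u + s - a < t"
  shows "AE x in M. hausdorff_measure u (covered_set T l x \<inter> G) \<noteq> 0"
proof -
  have "\<exists>\<Omega>\<in>sets M. 1 - 33 * (1 / (4 * real (Suc n))) \<le> measure M \<Omega> \<and>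
    (\<forall>x\<in>\<Omega>. hausdorff_measure u (covered_set T l x \<inter> G) \<noteq> 0)" for n
    by (rule covered_intersection_large_event[OF pos lim div a G u]) (auto simp: field_simps)
  then obtain \<Omega> where \<Omega>: "\<And>n. \<Omega> n \<in> sets M" "\<And>n. 1 - 33 * (1 / (4 * real (Suc n))) \<le> measure M (\<Omega> n)"
      "\<And>n x. x \<in> \<Omega> n \<Longrightarrow> hausdorff_measure u (covered_set T l x \<inter> G) \<noteq> 0"
    by metis
  define U where "U = (\<Union>n. \<Omega> n)"
  have U: "U \<in> sets M" using \<Omega>(1) by (auto simp: U_def)
  have "1 - 33 * (1 / (4 * real (Suc n))) \<le> measure M U" for n
    using \<Omega>(2)[of n] finite_measure_mono[OF _ U, of "\<Omega> n"] by (auto simp: U_def intro: order_trans)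
  moreover have "(\<lambda>n. 1 - 33 / 4 * inverse (real (Suc n))) \<longlonglongrightarrow> 1 - 33 / 4 * 0"
    by (intro tendsto_intros LIMSEQ_inverse_real_of_nat)
  ultimately have "1 \<le> measure M U"
    by (intro LIMSEQ_le_const2[of "\<lambda>n. 1 - 33 / 4 * inverse (real (Suc n))" 1])
      (auto simp: field_simps)
  then have "prob U = 1" by (simp add: antisym)
  then have "AE x in M. x \<in> U" by (rule prob_eq_1[THEN iffD1, OF U])
  then show ?thesis by eventually_elim (use \<Omega>(3) in \<open>auto simp: U_def\<close>)
qed

end

section \<open>The dimension formula\<close>

lemma upper_BT_index_bounds:
  fixes l :: "nat \<Rightarrow> real"
  assumes pos: "\<And>n. n \<ge> 1 \<Longrightarrow> 0 < l n" and lim: "l \<longlonglongrightarrow> 0" and s: "0 < s"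
  defines "\<alpha> \<equiv> upper_BT_index s l"
  shows "\<And>v. \<alpha> < v \<Longrightarrow> \<alpha> < s \<Longrightarrow> summable (\<lambda>n. l (Suc n) powr v)"
    and "\<And>a. a < \<alpha> \<Longrightarrow> \<not> summable (\<lambda>n. l (Suc n) powr a)"
proof -
  define D where "D = {t. t \<le> s \<and> \<not> summable (\<lambda>n. l (Suc n) powr t)}"
  have \<alpha>: "\<alpha> = Sup D" by (simp add: \<alpha>_def upper_BT_index_def D_def)
  have bdd: "bdd_above D" by (auto simp: D_def intro: bdd_aboveI[of _ s])
  have "0 \<in> D" using not_summable_powr_nonpos[OF pos lim, of 0] s by (simp add: D_def)
  show "summable (\<lambda>n. l (Suc n) powr v)" if v: "\<alpha> < v" "\<alpha> < s" for v
  proof -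
    have "min v s \<notin> D"
    proof
      assume "min v s \<in> D"
      then have "min v s \<le> \<alpha>" unfolding \<alpha> using bdd by (rule cSup_upper)
      with v show False by simp
    qed
    then have "summable (\<lambda>n. l (Suc n) powr min v s)" by (simp add: D_def)
    from summable_powr_mono_exponent[OF pos lim this, of v] show ?thesis by simp
  qed
  show "\<not> summable (\<lambda>n. l (Suc n) powr a)" if a: "a < \<alpha>" for a
  proof
    assume sum: "summable (\<lambda>n. l (Suc n) powr a)"
    have "D \<noteq> {}" using \<open>0 \<in> D\<close> by blast
    then obtain d where "d \<in> D" "a < d" using a less_cSupD[of D a] unfolding \<alpha> by blast
    moreover have "summable (\<lambda>n. l (Suc n) powr d)"
      using summable_powr_mono_exponent[OF pos lim sum, of d] \<open>a < d\<close> by simp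
    ultimately show False by (simp add: D_def)
  qed
qed

text \<open>
  Two distinct points make the diameter positive, so the radii beyond it only affect the constant.
\<close>
lemma (in metric_mps) regular_mps_of_ahlfors:
  assumes s: "0 < s" and ahl: "ahlfors_regular s M" and ab: "(a :: 'a) \<noteq> b"
  shows "\<exists>c. regular_mps M T s c"
proof -
  define D where "D = diameter (UNIV :: 'a set)"
  have "bounded (UNIV :: 'a set)" by (rule compact_imp_bounded[OF compact_space])
  then have "dist a b \<le> D" unfolding D_def by (rule diameter_bounded_bound) auto
  then have D: "0 < D" using ab by (smt (verit) zero_less_dist_iff)
  obtain c0 where c0: "1 \<le> c0"
      "\<And>x r. 0 < r \<Longrightarrow> r \<le> D \<Longrightarrow> inverse c0 * r powr s \<le> measure M (cball x r) \<and> measure M (cball x r) \<le> c0 * r powr s"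
    using ahl unfolding ahlfors_regular_def D_def by blast
  define c where "c = c0 * max 1 (D powr (- s))"
  have c: "c0 \<le> c" "c0 * D powr (- s) \<le> c"
    using c0(1) mult_left_mono[of 1 "max 1 (D powr (- s))" c0] by (auto simp: c_def)
  have "regular_mps M T s c"
  proof (unfold_locales)
    show "0 < s" by (rule s)
    show "1 \<le> c" using c(1) c0(1) by simp
    fix x :: 'a and r :: real assume r: "0 < r"
    show "measure M (cball x r) \<le> c * r powr s"
    proof (cases "r \<le> D")
      case True
      have "measure M (cball x r) \<le> c0 * r powr s" using c0(2)[OF r True] by blast
      also have "\<dots> \<le> c * r powr s" using c(1) by (intro mult_right_mono) auto
      finally show ?thesis .
    next
      case False
      have "measure M (cball x r) \<le> 1 * (D powr (- s) * D powr s)"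
        using D by (simp add: powr_add[symmetric])
      also have "\<dots> \<le> c0 * (D powr (- s) * r powr s)"
        using c0(1) False D s by (intro mult_mono mult_left_mono powr_mono2) auto
      also have "\<dots> = (c0 * D powr (- s)) * r powr s" by simp
      also have "\<dots> \<le> c * r powr s" using c(2) by (intro mult_right_mono) auto
      finally show ?thesis .
    qed
    assume "r \<le> 1"
    show "r powr s / c \<le> measure M (cball x r)"
    proof (cases "r \<le> D")
      case True
      have "r powr s / c \<le> r powr s / c0" using c(1) c0(1) by (intro divide_left_mono) auto
      also have "\<dots> = inverse c0 * r powr s" by (simp add: divide_inverse mult.commute)
      also have "\<dots> \<le> measure M (cball x r)" using c0(2)[OF r True] by blast
      finally show ?thesis .
    next
      case False
      have "r powr s / c \<le> 1 / (c0 * D powr (- s))"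
        using c c0(1) r \<open>r \<le> 1\<close> s D by (intro frac_le) (auto simp: powr_le1)
      also have "\<dots> = inverse c0 * D powr s" using D by (simp add: powr_minus field_simps)
      also have "\<dots> \<le> measure M (cball x D)" using c0(2)[OF D] by blast
      also have "\<dots> \<le> measure M (cball x r)"
        using False by (intro finite_measure_mono subset_cball) (auto simp: sets_eq_borel)
      finally show ?thesis .
    qed
  qed
  then show ?thesis ..
qed

context regular_mps
begin

lemma mixing_mps_of_exponentially_mixing:
  assumes "exponentially_mixing M T"
  shows "\<exists>C \<rho>. mixing_mps M T s c C \<rho>"
proof -
  obtain C \<rho> where C: "0 < C" "0 < \<rho>" "\<rho> < 1"
    and mix: "\<forall>n\<ge>1. \<forall>z r F. 0 < r \<longrightarrow> F \<in> sets M \<longrightarrow> 0 < measure M F \<longrightarrow>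
      \<bar>\<P>(y in M. y \<in> cball z r \<bar> y \<in> (T ^^ n) -` F) - measure M (cball z r)\<bar> \<le> C * \<rho> ^ n"
    using assms unfolding exponentially_mixing_def by (elim exE conjE) (rule that)
  have "mixing_mps M T s c C \<rho>"
  proof (unfold_locales)
    fix n :: nat and z :: 'a and r :: real and F
    assume n: "1 \<le> n" and r: "0 < r" and F: "F \<in> sets M"
    let ?A = "cball z r \<inter> (T ^^ n) -` F"
    have F': "(T ^^ n) -` F \<in> sets M" using measurable_sets[OF T_pow_measurable F, of n] by simp
    have inv: "measure M ((T ^^ n) -` F) = measure M F"
      using T_pow_emeasure[OF F, of n] by (simp add: measure_def)
    show "\<bar>measure M ?A - measure M (cball z r) * measure M F\<bar> \<le> C * \<rho> ^ n * measure M F"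
    proof (cases "0 < measure M F")
      case True
      have "\<P>(y in M. y \<in> cball z r \<bar> y \<in> (T ^^ n) -` F) = measure M ?A / measure M F"
        unfolding cond_prob_def by (simp add: inv[symmetric] vimage_def Int_def)
      then have "\<bar>measure M ?A / measure M F - measure M (cball z r)\<bar> \<le> C * \<rho> ^ n"
        using mix[rule_format, OF n r F True, of z] by (simp only:)
      then have "\<bar>measure M ?A / measure M F - measure M (cball z r)\<bar> * measure M F \<le> C * \<rho> ^ n * measure M F"
        by (rule mult_right_mono) simp
      also have "\<bar>measure M ?A / measure M F - measure M (cball z r)\<bar> * measure M F
          = \<bar>(measure M ?A / measure M F - measure M (cball z r)) * measure M F\<bar>"
        by (simp add: abs_mult)
      also have "(measure M ?A / measure M F - measure M (cball z r)) * measure M F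
          = measure M ?A - measure M (cball z r) * measure M F"
        using True by (simp add: field_simps)
      finally show ?thesis .
    next
      case False
      then have zero: "measure M F = 0" by (simp add: zero_less_measure_iff)
      have "measure M ?A \<le> measure M ((T ^^ n) -` F)" using F' by (intro finite_measure_mono) auto
      then have "measure M ?A = 0" using inv zero measure_nonneg[of M ?A] by linarith
      then show ?thesis using zero by simp
    qed
  qed (use C in auto)
  then show ?thesis by blast
qed

end

theorem corollary1p1:
  fixes M :: "'a::metric_space measure"
    and T :: "'a \<Rightarrow> 'a"
    and s \<alpha> :: real
    and l :: "nat \<Rightarrow> real"
    and G :: "'a set"
  assumes "metric_mps M T"
    and "exponentially_mixing M T"
    and "0 < s"
    and "ahlfors_regular s M"
    and nondegenerate: "\<exists>a b :: 'a. a \<noteq> b"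
    and "\<And>n. n \<ge> 1 \<Longrightarrow> 0 < l n"
    and "l \<longlonglongrightarrow> 0"
    and "\<alpha> = upper_BT_index s l"
    and "\<alpha> < s"
    and "analytic_set G"
    and "hausdorff_dim G = packing_dim G"
  shows "AE x in M.
           (packing_dim G > ereal (s - \<alpha>) \<longrightarrow>
              hausdorff_dim (covered_set T l x \<inter> G) = packing_dim G + ereal \<alpha> - ereal s) \<and>
           (packing_dim G < ereal (s - \<alpha>) \<longrightarrow>
              hausdorff_dim (covered_set T l x \<inter> G) = -\<infinity>)"
proof -
  note pos = assms(6) and lim = assms(7)
  obtain c where "regular_mps M T s c"
    using metric_mps.regular_mps_of_ahlfors[OF assms(1,3,4)] nondegenerate by blast
  then interpret regular_mps M T s c .
  obtain C \<rho> where "mixing_mps M T s c C \<rho>"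
    using mixing_mps_of_exponentially_mixing[OF assms(2)] by blast
  then interpret mixing_mps M T s c C \<rho> .
  note index = upper_BT_index_bounds[OF pos lim \<open>0 < s\<close>, folded assms(8)]
  have summable_above: "\<And>v. \<alpha> < v \<Longrightarrow> summable (\<lambda>n. l (Suc n) powr v)"
    using index(1) \<open>\<alpha> < s\<close> by simp
  have diverges_below: "\<And>a. a < \<alpha> \<Longrightarrow> \<not> summable (\<lambda>n. l (Suc n) powr a)"
    using index(2) by simp
  let ?E = "\<lambda>x. covered_set T l x \<inter> G"
  let ?D = "packing_dim G + ereal \<alpha> - ereal s"
  have shift: "packing_dim G < ereal (v + s - \<alpha>) \<longleftrightarrow> ?D < ereal v"
    "ereal (v + s - \<alpha>) < packing_dim G \<longleftrightarrow> ereal v < ?D" for v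
    by (cases "packing_dim G"; auto)+
  \<comment> \<open>Rational exponents suffice, and there are only countably many of them.\<close>
  have lower: "AE x in M. \<forall>v::rat. 0 < v \<longrightarrow> ereal (of_rat v) < ?D \<longrightarrow>
      ereal (of_rat v) \<le> hausdorff_dim (?E x)"
    unfolding AE_all_countable
  proof
    fix v :: rat
    show "AE x in M. 0 < v \<longrightarrow> ereal (of_rat v) < ?D \<longrightarrow> ereal (of_rat v) \<le> hausdorff_dim (?E x)"
    proof (cases "0 < v \<and> ereal (of_rat v) < ?D")
      case True
      define u :: real where "u = of_rat v"
      have u: "0 < u" "ereal u < ?D" using True by (auto simp: u_def)
      have "ereal (u + s - \<alpha>) < hausdorff_dim G"
        using shift(2)[of u] u(2) assms(11) by simp
      then obtain t where t: "u + s - \<alpha> < t" "ereal t < hausdorff_dim G"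
        using ereal_dense2[of "ereal (u + s - \<alpha>)" "hausdorff_dim G"] by auto
      have "0 \<le> t" using t(1) u(1) \<open>\<alpha> < s\<close> by simp
      have Ht: "hausdorff_measure t G \<noteq> 0"
        using t(2) \<open>0 \<le> t\<close> by (rule hausdorff_measure_nonzero_below_dim)
      \<comment> \<open>For \<open>\<alpha> = 0\<close> there is no nonnegative exponent below \<open>\<alpha>\<close>, but at the exponent \<open>0\<close> the
        series diverges anyway.\<close>
      define a where "a = max 0 ((u + s - t + \<alpha>) / 2)"
      have a: "0 \<le> a" "(u + s - t + \<alpha>) / 2 \<le> a" "a \<le> s"
        using t(1) \<open>\<alpha> < s\<close> \<open>0 < s\<close> by (simp_all add: a_def)
      have "u + s - t < (u + s - t + \<alpha>) / 2"
        using t(1) by (simp add: less_divide_eq)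
      then have "u + s - t < a" using a(2) by (rule less_le_trans)
      then have uat: "u + s - a < t" by simp
      have "\<not> summable (\<lambda>n. l (Suc n) powr a)"
      proof (cases "a = 0")
        case True
        then show ?thesis using not_summable_powr_nonpos[OF pos lim, of a] by simp
      next
        case False
        then have "a = (u + s - t + \<alpha>) / 2" by (simp add: a_def max_def split: if_splits)
        also have "\<dots> < \<alpha>" using t(1) by (simp add: divide_less_eq)
        finally have "a < \<alpha>" .
        then show ?thesis by (rule diverges_below)
      qed
      then have "AE x in M. hausdorff_measure u (?E x) \<noteq> 0"
        by (intro AE_covered_intersection_pos[OF pos lim _ a(1,3) assms(10) Ht u(1) uat])
      then show ?thesis
      proof eventually_elim
        case (elim x)
        show ?case using hausdorff_dim_ge[OF elim] u(1) by (simp add: u_def)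
      qed
    next
      case False
      then show ?thesis by (intro AE_I2) blast
    qed
  qed
  have upper: "AE x in M. \<forall>v::rat. 0 < v \<longrightarrow> ?D < ereal (of_rat v) \<longrightarrow>
      hausdorff_dim (?E x) \<le> ereal (of_rat v)"
    unfolding AE_all_countable
  proof
    fix v :: rat
    show "AE x in M. 0 < v \<longrightarrow> ?D < ereal (of_rat v) \<longrightarrow> hausdorff_dim (?E x) \<le> ereal (of_rat v)"
    proof (cases "0 < v \<and> ?D < ereal (of_rat v)")
      case True
      define u :: real where "u = of_rat v"
      have u: "0 < u" "?D < ereal u" using True by (auto simp: u_def)
      show ?thesis
      proof (cases "G = {}")
        case True
        then show ?thesis by (simp add: hausdorff_dim_def)
      next
        case False
        obtain t where t: "0 \<le> t" "t < u + s - \<alpha>" "packing_measure t G = 0"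
          using packing_dim_lessE[OF shift(1)[THEN iffD2, OF u(2)] False] by blast
        have "summable (\<lambda>n. l (Suc n) powr (s - t + u))"
          using t(2)  by (intro summable_above) simp
        from AE_covered_intersection_null[OF t(3) pos lim this] u(1)
        have "AE x in M. hausdorff_measure u (?E x) = 0" by simp
        then show ?thesis
        proof eventually_elim
          case (elim x)
          show ?case using hausdorff_dim_le[OF elim] u(1) by (simp add: u_def)
        qed
      qed
    next
      case False
      then show ?thesis by (intro AE_I2) blast
    qed
  qed
  have empty: "AE x in M. packing_dim G < ereal (s - \<alpha>) \<longrightarrow> ?E x = {}"
  proof (cases "packing_dim G < ereal (s - \<alpha>) \<and> G \<noteq> {}")
    case True
    then obtain t where t: "0 \<le> t" "t < s - \<alpha>" "packing_measure t G = 0"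
      using packing_dim_lessE[of G "s - \<alpha>"] by blast
    have "summable (\<lambda>n. l (Suc n) powr (s - t + 0))"
      using t(2)  by (intro summable_above) simp
    from AE_covered_intersection_null[OF t(3) pos lim this] show ?thesis by simp
  next
    case False
    then show ?thesis by (intro AE_I2) auto
  qed
  show ?thesis
    using lower upper empty
  proof (eventually_elim, intro conjI impI)
    fix x
    assume low: "\<forall>v::rat. 0 < v \<longrightarrow> ereal (of_rat v) < ?D \<longrightarrow> ereal (of_rat v) \<le> hausdorff_dim (?E x)"
      and up: "\<forall>v::rat. 0 < v \<longrightarrow> ?D < ereal (of_rat v) \<longrightarrow> hausdorff_dim (?E x) \<le> ereal (of_rat v)"
      and emp: "packing_dim G < ereal (s - \<alpha>) \<longrightarrow> ?E x = {}"
    {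
      assume "ereal (s - \<alpha>) < packing_dim G"
      then have D: "0 < ?D" using shift(2)[of 0] by (simp add: zero_ereal_def)
      show "hausdorff_dim (?E x) = ?D"
      proof (rule antisym)
        show "hausdorff_dim (?E x) \<le> ?D"
        proof (rule ccontr)
          assume "\<not> ?thesis"
          then obtain v :: rat where v: "?D < ereal (of_rat v)" "ereal (of_rat v) < hausdorff_dim (?E x)"
            using ereal_dense3[of ?D "hausdorff_dim (?E x)"] by (auto simp: not_le)
          have "0 < ereal (of_rat v)" using D v(1) by (rule less_trans)
          then have "0 < v" by (simp add: zero_ereal_def)
          then have "hausdorff_dim (?E x) \<le> ereal (of_rat v)" using up v(1) by blast
          with v(2) show False by simp
        qed
        show "?D \<le> hausdorff_dim (?E x)"
        proof (rule ccontr)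
          assume "\<not> ?thesis"
          then have "max 0 (hausdorff_dim (?E x)) < ?D" using D by (simp add: not_le)
          then obtain v :: rat where v: "max 0 (hausdorff_dim (?E x)) < ereal (of_rat v)" "ereal (of_rat v) < ?D"
            using ereal_dense3 by blast
          have "0 < v" "hausdorff_dim (?E x) < ereal (of_rat v)"
            using v(1) by (simp_all add: zero_ereal_def)
          moreover from this have "ereal (of_rat v) \<le> hausdorff_dim (?E x)" using low v(2) by blast
          ultimately show False by simp
        qed
      qed
    next
      assume "packing_dim G < ereal (s - \<alpha>)"
      with emp show "hausdorff_dim (?E x) = -\<infinity>" by (simp add: hausdorff_dim_def)
    }
  qed
qed

end
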